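(* Let $z:[0,t_N]\to\mathbb{R}^2$, with node times $0=t_0<t_1<\dots<t_N$, be any solution of Problem (P); that is, any $C^1$ and piecewise-$C^2$ shortest path of constrained curvature (curvature at most $a$ almost everywhere) in the plane between the two prescribed endpoints $p_0,p_N$, with prescribed slopes $v_0,v_N$ at the endpoints, which visits the sequence of intermediate points $p_1,\dots,p_{N-1}$ in this order. Then, for each $i=1,\dots,N$, the part of the path between the two consecutive points $p_{i-1}$ and $p_i$ (i.e. over $[t_{i-1},t_i]$) is of type $CSC$, or of type $CCC$, or a subset thereof. Moreover, if the shortest path is of type $CCC$ between two consecutive points, then the second circular arc (of the three) is of length greater than $\pi/a$.
   Context: Fix an integer $N\ge 1$, a real $a>0$, points $p_0,\dots,p_N\in\mathbb{R}^2$ with $p_{i-1}\ne p_i$ for $i=1,\dots,N$, and unit vectors $v_0,v_N\in\mathbb{R}^2$. Problem (P): minimize $t_N$ over all node times $0=t_0<t_1<\dots<t_N$ (all free) and all $C^1$, piecewise-$C^2$ curves $z:[0,t_N]\to\mathbb{R}^2$ such that $z(t_i)=p_i$ for $i=0,\dots,N$, $\dot z(0)=v_0$, $\dot z(t_N)=v_N$, and $\|\ddot z(t)\|\le a$, $\|\dot z(t)\|=1$ for a.e. $t\in[0,t_N]$ ($\|\cdot\|$ is the Euclidean norm). Thus $t_N$ is the length of the curve. The part of the curve over $[t_{i-1},t_i]$ is called stage $i$. Types: $S$ denotes a straight line segment and $C$ denotes a circular arc of curvature $a$ (radius $1/a$), traversed with signed curvature $a$ (left turn) or $-a$ (right turn);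 two adjacent $C$'s in a stage have opposite signed curvatures. A string such as $CSC$ denotes a $C^1$ concatenation of arcs of positive length in this order; "a subset thereof" means a string obtained from it by deleting some of its letters (e.g. $CS$, $SC$, $CC$, $C$, $S$). *)

theory Defs
  imports "HOL-Analysis.Analysis" "HOL-Library.Sublist"
begin

definition velocity :: "real \<Rightarrow> real \<Rightarrow> (real \<Rightarrow> 'a::real_normed_vector) \<Rightarrow> real \<Rightarrow> 'a" where
  "velocity b c f = (\<lambda>t. vector_derivative f (at t within {b..c}))"

definition C1_on :: "real \<Rightarrow> real \<Rightarrow> (real \<Rightarrow> 'a::real_normed_vector) \<Rightarrow> bool" where
  "C1_on b c f \<longleftrightarrow>
     (\<forall>t\<in>{b..c}. f differentiable (at t within {b..c})) \<and> continuous_on {b..c} (velocity b c f)"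

definition C2_on :: "real \<Rightarrow> real \<Rightarrow> (real \<Rightarrow> 'a::real_normed_vector) \<Rightarrow> bool" where
  "C2_on b c f \<longleftrightarrow> C1_on b c f \<and> C1_on b c (velocity b c f)"

text \<open>Each piece is twice continuously differentiable up to its endpoints (one-sidedly), so the
  second derivative has one-sided limits at the breakpoints.  This is stronger than what
  \<open>piecewise_C1_differentiable_on\<close> would demand of the velocity.\<close>

definition piecewise_C2_on :: "real \<Rightarrow> real \<Rightarrow> (real \<Rightarrow> 'a::real_normed_vector) \<Rightarrow> bool" where
  "piecewise_C2_on b c f \<longleftrightarrow>
     (\<exists>(m::nat) (s :: nat \<Rightarrow> real). s 0 = b \<and> s m = c \<and>
        (\<forall>j<m. s j < s (Suc j) \<and> C2_on (s j) (s (Suc j)) f))"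

text \<open>Only \<open>t 0, \<dots>, t N\<close>, \<open>p 0, \<dots>, p N\<close> and the values of \<open>z\<close> on \<open>{0..t N}\<close> are relevant.\<close>

definition admissible ::
  "nat \<Rightarrow> real \<Rightarrow> (nat \<Rightarrow> real^2) \<Rightarrow> real^2 \<Rightarrow> real^2 \<Rightarrow> (nat \<Rightarrow> real) \<Rightarrow> (real \<Rightarrow> real^2) \<Rightarrow> bool" where
  "admissible N a p v0 vN t z \<longleftrightarrow>
     t 0 = 0 \<and> (\<forall>i\<in>{1..N}. t (i - 1) < t i) \<and>
     C1_on 0 (t N) z \<and> piecewise_C2_on 0 (t N) z \<and>
     (\<forall>i\<in>{0..N}. z (t i) = p i) \<and>
     velocity 0 (t N) z 0 = v0 \<and> velocity 0 (t N) z (t N) = vN \<and>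
     (AE s in lborel. s \<in> {0..t N} \<longrightarrow>
        norm (velocity 0 (t N) (velocity 0 (t N) z) s) \<le> a \<and>
        norm (velocity 0 (t N) z s) = 1)"

definition solution ::
  "nat \<Rightarrow> real \<Rightarrow> (nat \<Rightarrow> real^2) \<Rightarrow> real^2 \<Rightarrow> real^2 \<Rightarrow> (nat \<Rightarrow> real) \<Rightarrow> (real \<Rightarrow> real^2) \<Rightarrow> bool" where
  "solution N a p v0 vN t z \<longleftrightarrow>
     admissible N a p v0 vN t z \<and>
     (\<forall>t' z'. admissible N a p v0 vN t' z' \<longrightarrow> t N \<le> t' N)"

datatype letter = Arc | Seg

text \<open>Both kinds of pieces are parametrized by arc length, so that the length of a piece over
  \<open>{b..c}\<close> is \<open>c - b\<close>.  The signed curvature is \<open>\<sigma> * a\<close>: \<open>\<sigma> = 1\<close> is a left turn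
  (counterclockwise), \<open>\<sigma> = -1\<close> a right turn.\<close>

definition circular_arc :: "real \<Rightarrow> real \<Rightarrow> (real \<Rightarrow> real^2) \<Rightarrow> real \<Rightarrow> real \<Rightarrow> bool" where
  "circular_arc a \<sigma> z b c \<longleftrightarrow>
     (\<sigma> = 1 \<or> \<sigma> = -1) \<and>
     (\<exists>(q :: real^2) (\<theta> :: real). \<forall>s\<in>{b..c}.
        z s = q + (1 / a) *\<^sub>R vector [cos (\<theta> + \<sigma> * a * (s - b)), sin (\<theta> + \<sigma> * a * (s - b))])"

definition line_segment :: "(real \<Rightarrow> real^2) \<Rightarrow> real \<Rightarrow> real \<Rightarrow> bool" where
  "line_segment z b c \<longleftrightarrow>
     (\<exists>(q :: real^2) (d :: real^2). norm d = 1 \<and> (\<forall>s\<in>{b..c}. z s = q + (s - b) *\<^sub>R d))"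

fun is_piece :: "real \<Rightarrow> letter \<Rightarrow> real \<Rightarrow> (real \<Rightarrow> real^2) \<Rightarrow> real \<Rightarrow> real \<Rightarrow> bool" where
  "is_piece a Arc \<sigma> z b c = circular_arc a \<sigma> z b c"
| "is_piece a Seg \<sigma> z b c = line_segment z b c"

text \<open>The curve \<open>z\<close> over \<open>{b..c}\<close> is a concatenation spelling the word \<open>w\<close>; its \<open>j\<close>-th piece
  (counting from 0) lives over \<open>{s j..s (Suc j)}\<close>.  The sign \<open>\<sigma> j\<close> is irrelevant if the \<open>j\<close>-th
  letter is \<open>Seg\<close>.\<close>

definition decomposition ::
  "real \<Rightarrow> (real \<Rightarrow> real^2) \<Rightarrow> real \<Rightarrow> real \<Rightarrow> letter list \<Rightarrow> (nat \<Rightarrow> real) \<Rightarrow> (nat \<Rightarrow> real) \<Rightarrow> bool" where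
  "decomposition a z b c w s \<sigma> \<longleftrightarrow>
     C1_on b c z \<and> s 0 = b \<and> s (length w) = c \<and>
     (\<forall>j<length w. s j < s (Suc j) \<and> is_piece a (w ! j) (\<sigma> j) z (s j) (s (Suc j))) \<and>
     (\<forall>j. Suc j < length w \<and> w ! j = Arc \<and> w ! Suc j = Arc \<longrightarrow> \<sigma> (Suc j) = - \<sigma> j)"

definition of_type :: "real \<Rightarrow> (real \<Rightarrow> real^2) \<Rightarrow> real \<Rightarrow> real \<Rightarrow> letter list \<Rightarrow> bool" where
  "of_type a z b c w \<longleftrightarrow> (\<exists>s \<sigma>. decomposition a z b c w s \<sigma>)"

end

theory Submission
  imports Defs
begin

text \<open>Every subarc of a stage is itself shortest among the curves with the same initial and final
  position and velocity, so only local comparisons are needed.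

  Short subarcs are CSC: for a direction \<open>\<phi>\<close> let \<open>F \<phi>\<close> be the length that a CSC path with straight
  piece in direction \<open>\<phi>\<close> needs in order to cover the required displacement along \<open>\<phi>\<close>.  At an interior
  maximum of \<open>F\<close>, \<open>F' = 0\<close> says that the CSC path also has the right displacement across \<open>\<phi>\<close>, and
  \<open>F'' \<le> 0\<close> says that its straight piece has nonnegative length.  On the other hand \<open>F \<phi>\<close> is at most the
  length of any curve with the given ends, because the heading of such a curve cannot approach \<open>\<phi>\<close>
  faster, or leave it later, than that of the CSC path; equality forces the curve to be the CSC path.
  At a maximum at an end point of the range of \<open>\<phi>\<close> the curve is CC.

  Hence a stage is a finite concatenation of arcs and segments.  An explicit shorter path excludes SCS,
  SCC and CCS (shift the circle, moving the line sideways at second order cost), CCC with middle arc at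
  most \<open>pi\<close> (insert a segment into the middle arc) and CCCC (move the four-bar linkage of the centres).
  What remains is CSC, CCC with a long middle arc, and their subwords.\<close>

text \<open>The obstacle is that a solution may a priori change its curvature in any way the bounds
  permit, and no maximum principle is invoked. \<open>F\<close> takes its place. An arc of angle x
  that joins a straight piece of direction \<open>\<phi>\<close> tangentially has length x and
  advances sin x along \<open>\<phi>\<close>. A displacement Q with total turn b therefore needs Re
  (Q cis (-\<phi>)) plus the waste |x| - sin |x| of both arcs, x = \<phi> and x = \<phi> - b; this
  is \<open>F \<phi>\<close>. The derivative of Re (Q cis (-\<phi>)) in \<open>\<phi>\<close> is Im
  (Q cis (-\<phi>)), which is why stationarity settles the displacement across
  \<open>\<phi>\<close>. A maximum is sought because every \<open>F \<phi>\<close> bounds the length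
  from below, and an interior best bound is attained by an actual path. Subarcs of length at most 1
  keep all angles where sin and cos are monotone, and finitely many of them cover a stage, whence
  finitely many pieces. Every competitor is a finite word, so splicing it into the solution gives an
  admissible curve.\<close>

section \<open>Words of arcs and segments\<close>

text \<open>A word lists the pieces of a path in the complex plane that starts at 0 with velocity 1; the
  entry \<open>(u, l)\<close> is a piece of signed curvature \<open>u\<close> and length \<open>l\<close>.  The maximal curvature is scaled
  to 1, so that \<open>u\<close> is \<open>-1\<close>, \<open>0\<close> or \<open>1\<close>.\<close>

type_synonym word = "(real \<times> real) list"

definition valid :: "word \<Rightarrow> bool" where
  "valid w \<longleftrightarrow> (\<forall>(u, l) \<in> set w. u \<in> {-1, 0, 1} \<and> 0 \<le> l)"

text \<open>For u = 1 or u = -1 this is the integral of \<open>cis (u * s)\<close> over s from 0 to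
  l; the factor 1 / (\<i> u) appears as -\<i> u because u^2 = 1.\<close>

definition piece_disp :: "real \<Rightarrow> real \<Rightarrow> complex" where
  "piece_disp u l = (if u = 0 then of_real l else - \<i> * of_real u * (cis (u * l) - 1))"

fun disp :: "word \<Rightarrow> complex" where
  "disp [] = 0"
| "disp ((u, l) # w) = piece_disp u l + cis (u * l) * disp w"

definition turn :: "word \<Rightarrow> real" where
  "turn w = (\<Sum>(u, l)\<leftarrow>w. u * l)"

definition len :: "word \<Rightarrow> real" where
  "len w = (\<Sum>(u, l)\<leftarrow>w. l)"

text \<open>Final headings are compared through \<open>cis\<close>, hence modulo 2 pi: a competitor
  may wind differently, which is what removes full loops.\<close>

definition shortest :: "word \<Rightarrow> bool" where
  "shortest w \<longleftrightarrow>
     (\<forall>w'. valid w' \<and> cis (turn w') = cis (turn w) \<and> disp w' = disp w \<longrightarrow> len w \<le> len w')"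

lemma valid_simps [simp]:
  "valid []"
  "valid ((u, l) # w) \<longleftrightarrow> u \<in> {-1, 0, 1} \<and> 0 \<le> l \<and> valid w"
  "valid (v @ w) \<longleftrightarrow> valid v \<and> valid w"
  "valid (rev w) \<longleftrightarrow> valid w"
  by (auto simp: valid_def)

lemma turn_simps [simp]:
  "turn [] = 0" "turn ((u, l) # w) = u * l + turn w" "turn (v @ w) = turn v + turn w"
  "turn (rev w) = turn w"
  by (auto simp: turn_def rev_map [symmetric] sum_list_rev)

lemma len_simps [simp]:
  "len [] = 0" "len ((u, l) # w) = l + len w" "len (v @ w) = len v + len w" "len (rev w) = len w"
  by (auto simp: len_def rev_map [symmetric] sum_list_rev)

lemma len_nonneg: "valid w \<Longrightarrow> 0 \<le> len w"
  by (induction w) auto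

lemma disp_append [simp]: "disp (v @ w) = disp v + cis (turn v) * disp w"
  by (induction v rule: disp.induct) (auto simp: algebra_simps cis_mult [symmetric])

lemma piece_disp_0 [simp]: "piece_disp u 0 = 0"
  by (simp add: piece_disp_def)

text \<open>Running a path backwards negates its curvatures, and a reflection (\<open>cnj\<close>)
  restores them; the factor \<open>cis (turn w)\<close> normalises the new initial heading to
  1.\<close>

lemma disp_rev: "disp (rev w) = cis (turn w) * cnj (disp w)"
proof (induction w rule: disp.induct)
  case (2 u l w)
  have "cis (u * l) * cnj (piece_disp u l) = piece_disp u l"
    by (auto simp: piece_disp_def algebra_simps cis_mult cis_cnj)
  then show ?case
    using 2 by (simp add: algebra_simps cis_mult [symmetric] cis_cnj)
      (simp add: cis_mult cis_cnj flip: mult.assoc)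
qed simp

lemma shortest_rev:
  assumes "shortest w"
  shows "shortest (rev w)"
  unfolding shortest_def
proof (intro allI impI)
  fix w' assume w': "valid w' \<and> cis (turn w') = cis (turn (rev w)) \<and> disp w' = disp (rev w)"
  have "disp (rev w') = cis (turn w) * cnj (cis (turn w) * cnj (disp w))"
    using w' by (simp add: disp_rev)
  also have "\<dots> = disp w"
    by (simp add: cis_mult cis_cnj flip: mult.assoc)
  finally show "len (rev w) \<le> len w'"
    using assms w' by (auto simp: shortest_def dest!: spec[of _ "rev w'"])
qed

definition mirror :: "word \<Rightarrow> word" where
  "mirror w = map (\<lambda>(u, l). (-u, l)) w"

lemma mirror_simps [simp]:
  "mirror [] = []" "mirror ((u, l) # w) = (-u, l) # mirror w"
  "valid (mirror w) \<longleftrightarrow> valid w" "turn (mirror w) = - turn w" "len (mirror w) = len w"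
  "disp (mirror w) = cnj (disp w)"
proof -
  show "disp (mirror w) = cnj (disp w)"
    by (induction w rule: disp.induct) (auto simp: mirror_def piece_disp_def cis_cnj)
  show "valid (mirror w) \<longleftrightarrow> valid w"
    by (induction w) (auto simp: mirror_def)
  show "turn (mirror w) = - turn w" "len (mirror w) = len w"
    by (induction w) (auto simp: mirror_def)
qed (auto simp: mirror_def)

lemma shortest_mirror:
  assumes "shortest w"
  shows "shortest (mirror w)"
  unfolding shortest_def
proof (intro allI impI)
  fix w' assume w': "valid w' \<and> cis (turn w') = cis (turn (mirror w)) \<and> disp w' = disp (mirror w)"
  have "cis (turn (mirror w')) = cis (turn w)"
    using w' by simp (metis cis_cnj complex_cnj_cnj)
  then show "len (mirror w) \<le> len w'"
    using assms w' by (auto simp: shortest_def dest!: spec[of _ "mirror w'"])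
qed

section \<open>Shortening moves on words\<close>

lemma not_shortest_loop:
  assumes "shortest [(u, l)]" "u = 1 \<or> u = -1"
  shows "l < 2 * pi"
proof (rule ccontr)
  assume l: "\<not> l < 2 * pi"
  have "cis (u * (l - 2 * pi)) = cis (u * l)"
    using assms(2) by (auto simp: complex_eq_iff cos_diff sin_diff cos_add sin_add algebra_simps)
  then show False
    using assms l pi_gt_zero[folded not_le]
    by (auto simp: shortest_def piece_disp_def dest!: spec[of _ "[(u, l - 2 * pi)]"])
qed

text \<open>The lengthening b - sin b is controlled by the sideways gain 1 - cos b times the factor
  b, which can be made small. The difference of the two sides has derivative x sin x.\<close>

lemma diff_sin_le:
  fixes b :: real
  assumes "0 \<le> b" "b \<le> pi"
  shows "b - sin b \<le> b * (1 - cos b)"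
proof -
  let ?f = "\<lambda>x. sin x - x * cos x"
  have "?f 0 \<le> ?f b"
  proof (rule DERIV_nonneg_imp_nondecreasing[OF assms(1)])
    fix x :: real assume x: "0 \<le> x" "x \<le> b"
    have "(?f has_real_derivative x * sin x) (at x)"
      by (auto intro!: derivative_eq_intros)
    moreover have "0 \<le> x * sin x"
      using x assms by (intro mult_nonneg_nonneg sin_ge_zero) auto
    ultimately show "\<exists>y. (?f has_real_derivative y) (at x) \<and> 0 \<le> y" by blast
  qed
  then show ?thesis by (simp add: algebra_simps)
qed

text \<open>Two opposite arcs of angle \<open>b\<close> displace a straight piece sideways by \<open>2 (1 - cos b)\<close> but lengthen
  it only by \<open>2 (b - sin b)\<close>, which is of higher order.\<close>

lemma wiggle:
  fixes \<epsilon> \<eta> :: real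
  assumes "0 < \<epsilon>" "0 < \<eta>"
  shows "\<exists>r>0. \<forall>X y. \<bar>y\<bar> < r \<and> \<bar>X - \<epsilon>\<bar> < r \<longrightarrow>
    (\<exists>w. valid w \<and> turn w = 0 \<and> disp w = Complex X y \<and> len w \<le> X + \<eta> * \<bar>y\<bar>)"
proof -
  \<comment> \<open>b0 bounds the angle of the two arcs: b0 \<le> \<eta> yields the slope, and b0
    \<le> \<epsilon> / 4 leaves a straight piece of length X - 2 sin b \<ge> \<epsilon> / 2 - 2 b0
    \<ge> 0.\<close>
  define b0 where "b0 = Min {\<eta>, \<epsilon> / 4, 1}"
  have b0: "0 < b0" "b0 \<le> \<eta>" "b0 \<le> \<epsilon> / 4" "b0 \<le> 1"
    using assms by (auto simp: b0_def)
  have cb0: "cos b0 < 1"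
    using b0 cos_monotone_0_pi[of 0 b0] pi_gt3 by auto
  define r where "r = min (2 * (1 - cos b0)) (\<epsilon> / 2)"
  have "0 < r" using cb0 assms by (auto simp: r_def)
  moreover have "\<exists>w. valid w \<and> turn w = 0 \<and> disp w = Complex X y \<and> len w \<le> X + \<eta> * \<bar>y\<bar>"
    if "\<bar>y\<bar> < r" "\<bar>X - \<epsilon>\<bar> < r" for X y
  proof -
    \<comment> \<open>Chosen so that 2 (1 - cos b) = |y|: the two arcs produce the whole sideways
      displacement.\<close>
    define b where "b = arccos (1 - \<bar>y\<bar> / 2)"
    have y: "0 \<le> \<bar>y\<bar>" "\<bar>y\<bar> < 2 * (1 - cos b0)" using that by (auto simp: r_def)
    have "cos b0 \<le> 1 - \<bar>y\<bar> / 2" using y by (simp add: field_simps)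
    then have y1: "1 - \<bar>y\<bar> / 2 \<le> 1" "cos b0 \<le> 1 - \<bar>y\<bar> / 2" "-1 \<le> 1 - \<bar>y\<bar> / 2"
      using cos_ge_minus_one[of b0] by (simp, simp, linarith)
    have cosb: "cos b = 1 - \<bar>y\<bar> / 2"
      unfolding b_def by (rule cos_arccos) (use y1 in auto)
    have b: "0 \<le> b" "b \<le> pi" unfolding b_def using y1 by (auto intro: arccos_lbound arccos_ubound)
    have bb0: "b \<le> b0"
    proof (rule ccontr)
      assume "\<not> b \<le> b0"
      then have "cos b < cos b0" using b b0 by (intro cos_monotone_0_pi) auto
      then show False using cosb y1 by simp
    qed
    define \<sigma> :: real where "\<sigma> = (if y \<ge> 0 then 1 else -1)"
    have s: "\<sigma> = 1 \<or> \<sigma> = -1" "\<sigma> * \<bar>y\<bar> = y" by (auto simp: \<sigma>_def)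
    define w :: word where "w = [(\<sigma>, b), (-\<sigma>, b), (0, X - 2 * sin b)]"
    have "sin b \<le> b" using b by (rule_tac sin_x_le_x) auto
    then have "valid w"
      using s b b0 bb0 that by (auto simp: w_def r_def abs_if split: if_splits)
    moreover have "turn w = 0" by (simp add: w_def)
    moreover have "disp w = Complex X y"
      using s(1) cosb by (auto simp: w_def piece_disp_def complex_eq_iff algebra_simps \<sigma>_def
        sin_cos_squared_add3 split: if_splits)
    moreover have "len w \<le> X + \<eta> * \<bar>y\<bar>"
    proof -
      have "b - sin b \<le> b * (1 - cos b)" by (rule diff_sin_le[OF b])
      also have "\<dots> \<le> \<eta> * (1 - cos b)" using bb0 b0 by (intro mult_right_mono) auto
      finally show ?thesis using cosb by (simp add: w_def algebra_simps)
    qed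
    ultimately show ?thesis by blast
  qed
  ultimately show ?thesis by blast
qed


lemma sin_x_less:
  fixes x :: real
  assumes "0 < x"
  shows "sin x < x"
proof (cases "x \<le> pi")
  case True
  have "\<exists>z>0. z < x \<and> sin x - sin 0 = (x - 0) * cos z"
    using assms by (intro MVT2) auto
  then obtain z where z: "0 < z" "z < x" "sin x = x * cos z" by auto
  have "cos z < 1" using z True cos_monotone_0_pi[of 0 z] by simp
  then show ?thesis using z assms by simp
next
  case False
  then show ?thesis using sin_le_one[of x] pi_gt3 by linarith
qed

lemma cos_less_one:
  fixes x :: real
  assumes "0 < x" "x < 2 * pi"
  shows "cos x < 1"
proof -
  have "0 < sin (x / 2)" using assms by (intro sin_gt_zero) auto
  then show ?thesis using cos_double_sin[of "x / 2"] by simp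
qed

text \<open>The circle is moved by k (cis \<alpha> - 1). This vector points backwards along the
  first line and forwards along the second, so both lines lose k (1 - cos \<alpha>); its sideways
  parts have size k |sin \<alpha>| and are absorbed by \<open>wiggle\<close>.\<close>

lemma not_shortest_SCS:
  assumes "0 < \<epsilon>" "0 < \<epsilon>'" "0 < \<alpha>" "\<alpha> < 2 * pi"
  shows "\<not> shortest [(0, \<epsilon>), (1, \<alpha>), (0, \<epsilon>')]"
proof
  assume shortest: "shortest [(0, \<epsilon>), (1, \<alpha>), (0, \<epsilon>')]"
  define c s where "c = cos \<alpha>" and "s = sin \<alpha>"
  \<comment> \<open>Half the gain rate: each line saves k (1 - c) = 2 \<eta> k and pays at most
    \<eta> k.\<close>
  define \<eta> where "\<eta> = (1 - c) / 2"
  have c: "c < 1" unfolding c_def using assms by (intro cos_less_one)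
  have cs: "c * c + s * s = 1" "\<bar>s\<bar> \<le> 1" "- 1 \<le> c"
    using sin_cos_squared_add[of \<alpha>] by (auto simp: c_def s_def power2_eq_square)
  have "0 < \<eta>" using c by (simp add: \<eta>_def)
  from wiggle[OF assms(1) this] obtain r1 where r1: "0 < r1" and w1:
    "\<And>X y. \<bar>y\<bar> < r1 \<Longrightarrow> \<bar>X - \<epsilon>\<bar> < r1 \<Longrightarrow>
      \<exists>w. valid w \<and> turn w = 0 \<and> disp w = Complex X y \<and> len w \<le> X + \<eta> * \<bar>y\<bar>" by auto
  from wiggle[OF assms(2) \<open>0 < \<eta>\<close>] obtain r2 where r2: "0 < r2" and w2:
    "\<And>X y. \<bar>y\<bar> < r2 \<Longrightarrow> \<bar>X - \<epsilon>'\<bar> < r2 \<Longrightarrow>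
      \<exists>w. valid w \<and> turn w = 0 \<and> disp w = Complex X y \<and> len w \<le> X + \<eta> * \<bar>y\<bar>" by auto
  define k where "k = min r1 r2 / 3"
  have k: "0 < k" "2 * k < r1" "2 * k < r2" using r1 r2 by (auto simp: k_def)
  have ks: "\<bar>k * s\<bar> \<le> k" using cs(2) k(1) mult_left_mono[OF cs(2), of k] by (simp add: abs_mult)
  have kc: "0 \<le> k * (1 - c)" "k * (1 - c) \<le> 2 * k"
    using c k(1) cs(3) mult_left_mono[of "1 - c" 2 k] by auto
  obtain v1 where v1: "valid v1" "turn v1 = 0" "disp v1 = Complex (\<epsilon> - k * (1 - c)) (k * s)"
      "len v1 \<le> \<epsilon> - k * (1 - c) + \<eta> * \<bar>k * s\<bar>"
    using w1[of "k * s" "\<epsilon> - k * (1 - c)"] ks kc k by auto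
  obtain v2 where v2: "valid v2" "turn v2 = 0" "disp v2 = Complex (\<epsilon>' - k * (1 - c)) (- (k * s))"
      "len v2 \<le> \<epsilon>' - k * (1 - c) + \<eta> * \<bar>k * s\<bar>"
    using w2[of "- (k * s)" "\<epsilon>' - k * (1 - c)"] ks kc k by auto
  define w :: word where "w = v1 @ (1, \<alpha>) # v2"
  have "valid w" "turn w = \<alpha>" using v1 v2 assms by (auto simp: w_def)
  moreover have "disp w = disp [(0, \<epsilon>), (1, \<alpha>), (0, \<epsilon>')]"
  proof -
    have *: "cis \<alpha> = Complex c s" by (simp add: complex_eq_iff c_def s_def)
    show ?thesis using cs(1) v1 v2
      by (simp add: w_def * piece_disp_def complex_eq_iff) algebra
  qed
  ultimately have "len [(0, \<epsilon>), (1, \<alpha>), (0, \<epsilon>')] \<le> len w"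
    using shortest by (simp add: shortest_def)
  moreover have "\<eta> * \<bar>k * s\<bar> \<le> \<eta> * k" using ks \<open>0 < \<eta>\<close> by simp
  moreover have "0 < \<eta> * k" "k * (1 - c) = 2 * (\<eta> * k)"
    using k \<open>0 < \<eta>\<close> by (simp_all add: \<eta>_def field_simps)
  moreover have "len w = len v1 + \<alpha> + len v2" by (simp add: w_def)
  ultimately show False using v1(4) v2(4) by simp
qed

text \<open>Cutting x off both arcs keeps the turn and saves 2 x. The centre of the second circle
  swings about that of the first, at distance 2, and the line has to make up for the chord of this
  swing. Since k \<le> 2 x, it suffices that the line pays less than k.\<close>

lemma not_shortest_SCC:
  assumes "0 < \<epsilon>" "0 < \<epsilon>'" "0 < \<alpha>" "\<alpha> < 2 * pi"
  shows "\<not> shortest [(0, \<epsilon>), (1, \<alpha>), (-1, \<epsilon>')]"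
proof
  assume shortest: "shortest [(0, \<epsilon>), (1, \<alpha>), (-1, \<epsilon>')]"
  define \<eta> where "\<eta> = (1 - cos \<alpha>) / 2"
  have "cos \<alpha> < 1" using assms by (intro cos_less_one)
  then have "0 < \<eta>" "cos \<alpha> < 1 - \<eta>" by (simp_all add: \<eta>_def field_simps)
  from wiggle[OF assms(1) this(1)] obtain r where r: "0 < r" and w1:
    "\<And>X y. \<bar>y\<bar> < r \<Longrightarrow> \<bar>X - \<epsilon>\<bar> < r \<Longrightarrow>
      \<exists>w. valid w \<and> turn w = 0 \<and> disp w = Complex X y \<and> len w \<le> X + \<eta> * \<bar>y\<bar>" by auto
  \<comment> \<open>The chord has direction \<alpha> - x / 2 rather than \<alpha>; by continuity its
    cosine still leaves a margin \<eta> below 1 for small x.\<close>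
  have "((\<lambda>x. cos (\<alpha> - x / 2)) \<longlongrightarrow> cos (\<alpha> - 0 / 2)) (at_right 0)"
    by (intro tendsto_intros) auto
  then have "eventually (\<lambda>x. cos (\<alpha> - x / 2) < 1 - \<eta>) (at_right 0)"
    using order_tendstoD(2) \<open>cos \<alpha> < 1 - \<eta>\<close> by force
  moreover have "eventually (\<lambda>x. x < Min {\<epsilon>', \<alpha>, r / 2, pi}) (at_right 0)"
    using assms r by (intro order_tendstoD) auto
  moreover have "eventually (\<lambda>x. (0::real) < x) (at_right 0)" by (simp add: eventually_at_right_less)
  ultimately have "eventually (\<lambda>x. cos (\<alpha> - x / 2) < 1 - \<eta> \<and> x < Min {\<epsilon>', \<alpha>, r / 2, pi} \<and> 0 < x) (at_right 0)"
    by eventually_elim auto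
  then obtain x where x: "cos (\<alpha> - x / 2) < 1 - \<eta>" "x < \<epsilon>'" "x < \<alpha>" "2 * x < r" "x < pi" "0 < x"
    using eventually_happens'[OF trivial_limit_at_right_real] by force
  \<comment> \<open>Length of the chord of angle x on a circle of radius 2; \<open>g\<close> is its
    direction.\<close>
  define k where "k = 4 * sin (x / 2)"
  define g where "g = \<alpha> - x / 2"
  have k: "0 < k" using x sin_gt_zero[of "x / 2"] by (simp add: k_def)
  have k2: "k \<le> 2 * x" using x sin_x_le_x[of "x / 2"] by (simp add: k_def)
  have bounds: "\<bar>k * sin g\<bar> \<le> k" "\<bar>k * cos g\<bar> \<le> k"
    using k mult_left_mono[of "\<bar>sin g\<bar>" 1 k] mult_left_mono[of "\<bar>cos g\<bar>" 1 k] by (auto simp: abs_mult)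
  obtain v where v: "valid v" "turn v = 0" "disp v = Complex (\<epsilon> + k * cos g) (k * sin g)"
      "len v \<le> \<epsilon> + k * cos g + \<eta> * \<bar>k * sin g\<bar>"
    using w1[of "k * sin g" "\<epsilon> + k * cos g"] bounds k2 x by auto
  define w :: word where "w = v @ [(1, \<alpha> - x), (-1, \<epsilon>' - x)]"
  have "valid w" "turn w = turn [(0, \<epsilon>), (1, \<alpha>), (-1, \<epsilon>')]"
    using v x by (auto simp: w_def)
  moreover have "disp w = disp [(0, \<epsilon>), (1, \<alpha>), (-1, \<epsilon>')]"
  proof -
    have [simp]: "Complex (\<epsilon> + k * cos g) (k * sin g) = of_real \<epsilon> + of_real k * cis g"
      by (simp add: complex_eq_iff)
    have a: "cis \<alpha> = cis g * cis (x / 2)" "cis (\<alpha> - x) = cis g * cis (- (x / 2))"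
      by (simp_all add: cis_mult g_def)
    have e: "cis (\<alpha> - x) * cis (x - \<epsilon>') = cis \<alpha> * cis (- \<epsilon>')"
      by (simp add: cis_mult)
    have k': "of_real k = - 2 * \<i> * (cis (x / 2) - cis (- (x / 2)))"
      by (simp add: k_def complex_eq_iff)
    have "disp w = of_real \<epsilon> + of_real k * cis g + (\<i> - 2 * \<i> * cis (\<alpha> - x)
        + \<i> * (cis (\<alpha> - x) * cis (x - \<epsilon>')))"
      using v by (simp add: w_def piece_disp_def algebra_simps)
    also have "\<dots> = of_real \<epsilon> + (\<i> - 2 * \<i> * cis \<alpha> + \<i> * (cis \<alpha> * cis (- \<epsilon>')))"
      unfolding e unfolding a k' by (simp add: algebra_simps)
    also have "\<dots> = disp [(0, \<epsilon>), (1, \<alpha>), (-1, \<epsilon>')]"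
      by (simp add: piece_disp_def algebra_simps)
    finally show ?thesis .
  qed
  ultimately have "len [(0, \<epsilon>), (1, \<alpha>), (-1, \<epsilon>')] \<le> len w"
    using shortest unfolding shortest_def by metis
  moreover have "\<eta> * \<bar>k * sin g\<bar> \<le> \<eta> * k" using bounds \<open>0 < \<eta>\<close> by simp
  moreover have "k * cos g < k * (1 - \<eta>)" using k x by (simp add: g_def)
  ultimately show False using v k2 by (simp add: w_def algebra_simps)
qed

text \<open>Cutting x off each outer arc and 2 x off the middle arc saves 4 x and keeps the turn. A
  segment at the midpoint of the middle arc, parallel to the line through the outer centres,
  restores the displacement.\<close>

lemma not_shortest_CCC:
  assumes "0 < \<epsilon>" "0 < \<epsilon>'" "0 < \<alpha>" "\<alpha> \<le> pi"
  shows "\<not> shortest [(-1, \<epsilon>), (1, \<alpha>), (-1, \<epsilon>')]"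
proof
  assume shortest: "shortest [(-1, \<epsilon>), (1, \<alpha>), (-1, \<epsilon>')]"
  define x where "x = Min {\<epsilon>, \<epsilon>', \<alpha> / 2} / 2"
  have x: "0 < x" "x < \<epsilon>" "x < \<epsilon>'" "x < \<alpha> / 2" using assms by (auto simp: x_def)
  define h where "h = \<alpha> / 2"
  have h: "\<alpha> = 2 * h" "x < h" "h \<le> pi / 2" using x assms by (auto simp: h_def)
  \<comment> \<open>The outer centres are 4 sin h apart, and the shortened arcs alone would leave
    only 4 sin (h - x). That \<open>s\<close> is nonnegative needs h \<le> pi / 2, i.e. \<alpha>
    \<le> pi.\<close>
  define s where "s = 4 * (sin h - sin (h - x))"
  have s0: "0 \<le> s" using h x sin_monotone_2pi_le[of "h - x" h] by (simp add: s_def)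
  have s4: "s < 4 * x"
  proof -
    have "sin h - sin (h - x) = 2 * sin (x / 2) * cos (h - x / 2)"
      using sin_diff_sin[of h "h - x"] by (simp add: field_simps)
    also have "\<dots> \<le> 2 * sin (x / 2) * 1"
      using h x by (intro mult_left_mono) (auto intro!: sin_ge_zero)
    also have "\<dots> < x" using x sin_x_less[of "x / 2"] by simp
    finally show ?thesis by (simp add: s_def)
  qed
  define w :: word where "w = [(-1, \<epsilon> - x), (1, h - x), (0, s), (1, h - x), (-1, \<epsilon>' - x)]"
  have "valid w" "turn w = turn [(-1, \<epsilon>), (1, \<alpha>), (-1, \<epsilon>')]"
    using s0 h x by (auto simp: w_def)
  moreover have "disp w = disp [(-1, \<epsilon>), (1, \<alpha>), (-1, \<epsilon>')]"
  proof -
    define m e where "m = cis (h - \<epsilon>)" and "e = cis (2 * h - \<epsilon> - \<epsilon>')"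
    have s': "of_real s = - 2 * \<i> * (cis h - cis (- h)) + 2 * \<i> * (cis (h - x) - cis (- (h - x)))"
      using sin_minus[of "h - x"] cos_minus[of "h - x"] by (simp add: s_def complex_eq_iff)
    have "disp w = - \<i> + 2 * \<i> * (m * cis (- (h - x)) - m * cis (h - x)) + of_real s * m + \<i> * e"
      by (simp add: w_def piece_disp_def m_def e_def cis_mult algebra_simps)
    also have "\<dots> = - \<i> + 2 * \<i> * (m * cis (- h) - m * cis h) + \<i> * e"
      unfolding s' by (simp add: algebra_simps)
    also have "\<dots> = disp [(-1, \<epsilon>), (1, \<alpha>), (-1, \<epsilon>')]"
      by (simp add: piece_disp_def m_def e_def cis_mult algebra_simps h(1))
    finally show ?thesis .
  qed
  ultimately have "len [(-1, \<epsilon>), (1, \<alpha>), (-1, \<epsilon>')] \<le> len w"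
    using shortest unfolding shortest_def by metis
  then show False using s4 h by (simp add: w_def)
qed

text \<open>The centres of the four circles form a four-bar linkage whose outer two joints are fixed.
  Turning the common heading at the middle inflection point by \<open>-2h\<close> moves the linkage in the
  direction that shortens the path; \<open>M\<close> is the resulting sum of the headings at the two outer
  inflection points.\<close>

lemma not_shortest_CCCC:
  assumes pos: "0 < \<epsilon>" "0 < \<epsilon>'" and \<alpha>: "pi < \<alpha>" "\<alpha> < 2 * pi" and \<beta>: "pi < \<beta>" "\<beta> < 2 * pi"
  shows "\<not> shortest [(-1, \<epsilon>), (1, \<alpha>), (-1, \<beta>), (1, \<epsilon>')]"
proof
  assume shortest: "shortest [(-1, \<epsilon>), (1, \<alpha>), (-1, \<beta>), (1, \<epsilon>')]"
  \<comment> \<open>The headings at the three inflection points are \<mu> + \<kappa>, \<mu> +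
    \<gamma> and \<mu> - \<kappa>, in this order.\<close>
  define \<mu> \<kappa> \<gamma> where "\<mu> = (\<alpha> - \<beta>) / 2 - \<epsilon>" and "\<kappa> = (\<beta> - \<alpha>) / 2" and "\<gamma> = (\<alpha> + \<beta>) / 2"
  define \<sigma> :: real where "\<sigma> = (if \<kappa> \<ge> 0 then 1 else -1)"
  have \<sigma>: "\<sigma> * \<bar>\<kappa>\<bar> = \<kappa>" "\<sigma> = 1 \<or> \<sigma> = -1" by (auto simp: \<sigma>_def)
  have \<kappa>: "\<bar>\<kappa>\<bar> < pi / 2" using \<alpha> \<beta> by (auto simp: \<kappa>_def)
  then have cos\<kappa>: "0 < cos \<kappa>" using cos_gt_zero_pi by auto
  \<comment> \<open>Both middle arcs exceed pi, so \<gamma> lies between pi and 2 pi. This sign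
    makes \<open>\<rho>\<close> decrease to first order in h.\<close>
  have sin\<gamma>: "sin \<gamma> < 0"
    using \<alpha> \<beta> sin_gt_zero[of "\<gamma> - pi"] by (simp add: \<gamma>_def)
  have cc: "0 < cos \<kappa> - cos \<gamma>"
  proof -
    have "cos \<kappa> - cos \<gamma> = 2 * sin (\<beta> / 2) * sin (\<alpha> / 2)"
      using cos_diff_cos[of \<kappa> \<gamma>] by (simp add: \<kappa>_def \<gamma>_def field_simps)
    moreover have "0 < sin (\<beta> / 2)" "0 < sin (\<alpha> / 2)"
      using \<alpha> \<beta> by (auto intro!: sin_gt_zero)
    ultimately show ?thesis by simp
  qed
  \<comment> \<open>With the middle heading at \<mu> + \<gamma> - 2 h, the outer two must sum to 2
    cis (\<mu> - h) (A + \<i> B) to keep the displacement. Writing A + \<i> B = \<rho> cis \<nu>,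
    the headings \<mu> - h + \<nu> + \<kappa>' and \<mu> - h + \<nu> - \<kappa>' achieve this if cos
    \<kappa>' = \<rho>.\<close>
  define A where "A h = cos \<kappa> * cos h + sin h * sin \<gamma>" for h
  define B where "B h = sin h * (cos \<kappa> - cos \<gamma>)" for h
  define \<rho> where "\<rho> h = sqrt ((A h)\<^sup>2 + (B h)\<^sup>2)" for h
  define \<nu> where "\<nu> h = arctan (B h / A h)" for h
  \<comment> \<open>\<open>min 1\<close> makes \<kappa>' continuous before \<rho> \<le> 1 is known;
    \<sigma> restores the sign that \<open>arccos\<close> forgets.\<close>
  define \<kappa>' where "\<kappa>' h = \<sigma> * arccos (min 1 (\<rho> h))" for h
  have at0: "A 0 = cos \<kappa>" "B 0 = 0" "\<rho> 0 = cos \<kappa>" "\<nu> 0 = 0" "\<kappa>' 0 = \<kappa>"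
  proof -
    show "A 0 = cos \<kappa>" "B 0 = 0" by (simp_all add: A_def B_def)
    then show "\<rho> 0 = cos \<kappa>" "\<nu> 0 = 0" using cos\<kappa> by (simp_all add: \<rho>_def \<nu>_def)
    then show "\<kappa>' 0 = \<kappa>" using \<sigma> \<kappa> arccos_cos_eq_abs[of \<kappa>] by (simp add: \<kappa>'_def)
  qed
  have "continuous_on UNIV A" unfolding A_def by (intro continuous_intros)
  moreover have "continuous_on UNIV B" unfolding B_def by (intro continuous_intros)
  ultimately have "continuous_on UNIV \<rho>" unfolding \<rho>_def by (intro continuous_intros)
  have "0 \<le> \<rho> h" for h by (simp add: \<rho>_def)
  then have "-1 \<le> \<rho> h" for h by (rule order_trans[rotated]) simp
  then have "continuous_on UNIV \<kappa>'"
    unfolding \<kappa>'_def using \<open>continuous_on UNIV \<rho>\<close> by (intro continuous_intros) auto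
  then have \<kappa>'_lim: "(\<kappa>' \<longlongrightarrow> \<kappa>) (at_right 0)"
    using at0(5) by (metis UNIV_I continuous_on_def tendsto_within_subset subset_UNIV)
  have A_lim: "(A \<longlongrightarrow> cos \<kappa>) (at_right 0)"
    using at0(1) \<open>continuous_on UNIV A\<close> by (metis UNIV_I continuous_on_def tendsto_within_subset subset_UNIV)
  have B_lim: "(B \<longlongrightarrow> 0) (at_right 0)"
    using at0(2) \<open>continuous_on UNIV B\<close> by (metis UNIV_I continuous_on_def tendsto_within_subset subset_UNIV)
  have "(\<nu> \<longlongrightarrow> arctan (0 / cos \<kappa>)) (at_right 0)"
    unfolding \<nu>_def using A_lim B_lim cos\<kappa> by (intro tendsto_intros) auto
  then have \<nu>_lim: "(\<nu> \<longlongrightarrow> 0) (at_right 0)" by simp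
  have id_lim: "((\<lambda>h. h) \<longlongrightarrow> (0::real)) (at_right 0)" by (rule tendsto_ident_at)
  \<comment> \<open>A^2 + B^2 equals (cos \<kappa> cos h)^2 plus sin h times this expression, so its
    negative sign for small h gives \<rho> \<le> 1, even when \<kappa> = 0.\<close>
  have "((\<lambda>h. 2 * cos \<kappa> * cos h * sin \<gamma> + sin h * ((sin \<gamma>)\<^sup>2 + (cos \<kappa> - cos \<gamma>)\<^sup>2))
      \<longlongrightarrow> 2 * cos \<kappa> * cos 0 * sin \<gamma> + sin 0 * ((sin \<gamma>)\<^sup>2 + (cos \<kappa> - cos \<gamma>)\<^sup>2)) (at_right 0)"
    by (intro tendsto_intros)
  moreover have "2 * cos \<kappa> * cos 0 * sin \<gamma> + sin 0 * ((sin \<gamma>)\<^sup>2 + (cos \<kappa> - cos \<gamma>)\<^sup>2) < 0"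
    using cos\<kappa> sin\<gamma> by (simp add: mult_pos_neg)
  ultimately have e1: "eventually (\<lambda>h. 2 * cos \<kappa> * cos h * sin \<gamma> + sin h * ((sin \<gamma>)\<^sup>2 + (cos \<kappa> - cos \<gamma>)\<^sup>2) < 0) (at_right 0)"
    by (rule order_tendstoD)
  have e2: "eventually (\<lambda>h. 0 < h \<and> h < pi) (at_right (0::real))"
    using eventually_at_right_real[OF pi_gt_zero] by simp
  have e3: "eventually (\<lambda>h. 0 < A h) (at_right 0)" using A_lim cos\<kappa> by (rule order_tendstoD)
  have e4: "eventually (\<lambda>h. 0 < \<epsilon> + (h - \<nu> h + (\<kappa> - \<kappa>' h))) (at_right 0)"
  proof (rule order_tendstoD)
    show "((\<lambda>h. \<epsilon> + (h - \<nu> h + (\<kappa> - \<kappa>' h))) \<longlongrightarrow> \<epsilon> + (0 - 0 + (\<kappa> - \<kappa>))) (at_right 0)"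
      by (intro tendsto_intros \<nu>_lim \<kappa>'_lim)
  qed (use pos in simp)
  have e5: "eventually (\<lambda>h. 0 < \<epsilon>' + (h - \<nu> h - (\<kappa> - \<kappa>' h))) (at_right 0)"
  proof (rule order_tendstoD)
    show "((\<lambda>h. \<epsilon>' + (h - \<nu> h - (\<kappa> - \<kappa>' h))) \<longlongrightarrow> \<epsilon>' + (0 - 0 - (\<kappa> - \<kappa>))) (at_right 0)"
      by (intro tendsto_intros \<nu>_lim \<kappa>'_lim)
  qed (use pos in simp)
  have e6: "eventually (\<lambda>h. 0 < \<alpha> + (- h - \<nu> h + (\<kappa> - \<kappa>' h))) (at_right 0)"
  proof (rule order_tendstoD)
    show "((\<lambda>h. \<alpha> + (- h - \<nu> h + (\<kappa> - \<kappa>' h))) \<longlongrightarrow> \<alpha> + (- 0 - 0 + (\<kappa> - \<kappa>))) (at_right 0)"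
      by (intro tendsto_intros \<nu>_lim \<kappa>'_lim)
  qed (use \<alpha> pi_gt_zero in simp)
  have e7: "eventually (\<lambda>h. 0 < \<beta> + (- h - \<nu> h - (\<kappa> - \<kappa>' h))) (at_right 0)"
  proof (rule order_tendstoD)
    show "((\<lambda>h. \<beta> + (- h - \<nu> h - (\<kappa> - \<kappa>' h))) \<longlongrightarrow> \<beta> + (- 0 - 0 - (\<kappa> - \<kappa>))) (at_right 0)"
      by (intro tendsto_intros \<nu>_lim \<kappa>'_lim)
  qed (use \<beta> pi_gt_zero in simp)
  obtain h where h: "0 < h" "h < pi" "0 < A h"
      "2 * cos \<kappa> * cos h * sin \<gamma> + sin h * ((sin \<gamma>)\<^sup>2 + (cos \<kappa> - cos \<gamma>)\<^sup>2) < 0"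
    and l: "0 < \<epsilon> + (h - \<nu> h + (\<kappa> - \<kappa>' h))" "0 < \<epsilon>' + (h - \<nu> h - (\<kappa> - \<kappa>' h))"
      "0 < \<alpha> + (- h - \<nu> h + (\<kappa> - \<kappa>' h))" "0 < \<beta> + (- h - \<nu> h - (\<kappa> - \<kappa>' h))"
    using eventually_happens[OF eventually_conj[OF e1 eventually_conj[OF e2 eventually_conj[OF e3
      eventually_conj[OF e4 eventually_conj[OF e5 eventually_conj[OF e6 e7]]]]]]]
      trivial_limit_at_right_real by blast
  have "0 < sin h" using h by (intro sin_gt_zero)
  have "0 < B h" using \<open>0 < sin h\<close> cc by (simp add: B_def)
  have \<nu>: "0 < \<nu> h" using \<open>0 < B h\<close> h by (simp add: \<nu>_def)
  have "\<rho> h \<le> 1"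
  proof -
    have "(A h)\<^sup>2 + (B h)\<^sup>2 = (cos \<kappa>)\<^sup>2 * (cos h)\<^sup>2 + sin h *
       (2 * cos \<kappa> * cos h * sin \<gamma> + sin h * ((sin \<gamma>)\<^sup>2 + (cos \<kappa> - cos \<gamma>)\<^sup>2))"
      by (simp add: A_def B_def power2_eq_square algebra_simps)
    also have "\<dots> \<le> 1 * 1 + 0"
      using h \<open>0 < sin h\<close> by (intro add_mono mult_mono) (auto simp: power_le_one_iff abs_square_le_1 mult_nonneg_nonpos)
    finally show ?thesis by (simp add: \<rho>_def)
  qed
  have "0 < \<rho> h" using h by (simp add: \<rho>_def add_pos_nonneg)
  have cos\<kappa>': "cos (\<kappa>' h) = \<rho> h"
    using \<sigma>(2) \<open>\<rho> h \<le> 1\<close> \<open>0 < \<rho> h\<close> by (auto simp: \<kappa>'_def)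
  have polar: "\<rho> h * cos (\<nu> h) = A h" "\<rho> h * sin (\<nu> h) = B h"
  proof -
    have "sqrt (1 + (B h / A h)\<^sup>2) = \<rho> h / A h"
    proof (rule real_sqrt_unique)
      show "(\<rho> h / A h)\<^sup>2 = 1 + (B h / A h)\<^sup>2"
        using h by (simp add: \<rho>_def power_divide field_simps)
    qed (use h \<open>0 < \<rho> h\<close> in simp)
    then show "\<rho> h * cos (\<nu> h) = A h" "\<rho> h * sin (\<nu> h) = B h"
      using h \<open>0 < \<rho> h\<close> by (auto simp: \<nu>_def cos_arctan sin_arctan field_simps)
  qed
  \<comment> \<open>The lengths are the differences of the new inflection headings; their four
    changes add up to -4 \<nu>.\<close>
  define w :: word where "w = [(-1, \<epsilon> + (h - \<nu> h + (\<kappa> - \<kappa>' h))), (1, \<alpha> + (- h - \<nu> h + (\<kappa> - \<kappa>' h))),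
     (-1, \<beta> + (- h - \<nu> h - (\<kappa> - \<kappa>' h))), (1, \<epsilon>' + (h - \<nu> h - (\<kappa> - \<kappa>' h)))]"
  have "valid w" "turn w = turn [(-1, \<epsilon>), (1, \<alpha>), (-1, \<beta>), (1, \<epsilon>')]"
    using l by (auto simp: w_def)
  moreover have "disp w = disp [(-1, \<epsilon>), (1, \<alpha>), (-1, \<beta>), (1, \<epsilon>')]"
  proof -
    have M: "cis (\<nu> h) * (cis (\<kappa>' h) + cis (- \<kappa>' h)) = 2 * Complex (A h) (B h)"
      using cos\<kappa>' polar by (simp add: complex_eq_iff mult.commute)
    have M': "cis (- h) * (2 * Complex (A h) (B h)) = cis \<kappa> + cis (- \<kappa>) - cis \<gamma> + cis (\<gamma> - 2 * h)"
    proof -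
      have "cis (\<gamma> - 2 * h) = cis (- h) * cis (\<gamma> - h)" by (simp add: cis_mult)
      moreover have "cis \<gamma> = cis (- h) * cis (\<gamma> + h)" by (simp add: cis_mult)
      moreover have "cis \<kappa> + cis (- \<kappa>) = cis (- h) * (cis h * of_real (2 * cos \<kappa>))"
        by (simp add: cis_mult complex_eq_iff flip: mult.assoc)
      moreover have "2 * Complex (A h) (B h) = cis h * of_real (2 * cos \<kappa>) - cis (\<gamma> + h) + cis (\<gamma> - h)"
        by (simp add: complex_eq_iff A_def B_def cos_add sin_add cos_diff sin_diff algebra_simps)
      ultimately show ?thesis by (simp only: ring_distribs)
    qed
    define e where "e = cis (\<alpha> - \<epsilon> - \<beta> + \<epsilon>')"
    have "disp w = - \<i> + 2 * \<i> * (cis \<mu> * (cis (- h) * (cis (\<nu> h) * (cis (\<kappa>' h) + cis (- \<kappa>' h)))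
        - cis (\<gamma> - 2 * h))) - \<i> * e"
      by (simp add: w_def piece_disp_def e_def cis_mult algebra_simps \<mu>_def \<gamma>_def \<kappa>_def)
         (simp add: field_simps)
    also have "\<dots> = - \<i> + 2 * \<i> * (cis \<mu> * (cis \<kappa> + cis (- \<kappa>) - cis \<gamma>)) - \<i> * e"
      unfolding M M' by simp
    also have "\<dots> = - \<i> + 2 * \<i> * (cis (- \<epsilon>) + cis (\<alpha> - \<epsilon> - \<beta>) - cis (\<alpha> - \<epsilon>)) - \<i> * e"
    proof -
      have "cis \<mu> * cis \<kappa> = cis (- \<epsilon>)" "cis \<mu> * cis (- \<kappa>) = cis (\<alpha> - \<epsilon> - \<beta>)"
          "cis \<mu> * cis \<gamma> = cis (\<alpha> - \<epsilon>)"
        unfolding cis_mult by (rule arg_cong[where f = cis], simp add: \<mu>_def \<kappa>_def \<gamma>_def field_simps)+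
      then show ?thesis by (simp add: ring_distribs)
    qed
    also have "\<dots> = disp [(-1, \<epsilon>), (1, \<alpha>), (-1, \<beta>), (1, \<epsilon>')]"
    proof -
      have "cis (\<alpha> - \<epsilon>) = cis (- \<epsilon>) * cis \<alpha>" "cis (\<alpha> - \<epsilon> - \<beta>) = cis (- \<epsilon>) * cis \<alpha> * cis (- \<beta>)"
          "e = cis (- \<epsilon>) * cis \<alpha> * cis (- \<beta>) * cis \<epsilon>'"
        unfolding cis_mult e_def by (rule arg_cong[where f = cis], simp)+
      then show ?thesis by (simp add: piece_disp_def algebra_simps)
    qed
    finally show ?thesis .
  qed
  ultimately have "len [(-1, \<epsilon>), (1, \<alpha>), (-1, \<beta>), (1, \<epsilon>')] \<le> len w"
    using shortest unfolding shortest_def by metis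
  then show False using \<nu> by (simp add: w_def)
qed

section \<open>Short subarcs\<close>

text \<open>The second part is the rigidity used to recognise extremal curves: if the larger
  derivative yields no larger increment, the two derivatives agree at every point, the ends
  included.\<close>

lemma deriv_within_compare:
  fixes f g :: "real \<Rightarrow> real"
  assumes "p \<le> q"
    and f: "\<And>t. t \<in> {p..q} \<Longrightarrow> (f has_real_derivative f' t) (at t within {p..q})"
    and g: "\<And>t. t \<in> {p..q} \<Longrightarrow> (g has_real_derivative g' t) (at t within {p..q})"
    and le: "\<And>t. t \<in> {p..q} \<Longrightarrow> f' t \<le> g' t"
  shows "f q - f p \<le> g q - g p"
    and "p < q \<Longrightarrow> g q - g p \<le> f q - f p \<Longrightarrow> t \<in> {p..q} \<Longrightarrow> f' t = g' t"
proof -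
  define k where "k t = f t - g t" for t
  have k: "(k has_real_derivative f' t - g' t) (at t within {p..q})" if "t \<in> {p..q}" for t
    unfolding k_def by (intro derivative_intros f g that)
  have cont: "continuous_on {p..q} k"
    using k by (rule DERIV_continuous_on)
  have mono: "k y \<le> k x" if "p \<le> x" "x \<le> y" "y \<le> q" for x y
  proof (rule DERIV_nonpos_imp_decreasing_open[OF that(2)])
    fix t assume t: "x < t" "t < y"
    then have "(k has_real_derivative f' t - g' t) (at t)"
      using k[of t] that at_within_Icc_at[of p t q] by auto
    moreover have "f' t - g' t \<le> 0" using le[of t] t that by auto
    ultimately show "\<exists>y. (k has_real_derivative y) (at t) \<and> y \<le> 0" by blast
  qed (use cont that in \<open>auto intro: continuous_on_subset\<close>)
  show "f q - f p \<le> g q - g p" using mono[of p q] assms(1) by (simp add: k_def)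
  show "f' t = g' t" if "p < q" and ge: "g q - g p \<le> f q - f p" and t: "t \<in> {p..q}"
  proof -
    have const: "k x = k p" if "x \<in> {p..q}" for x
      using mono[of p x] mono[of x q] that ge by (auto simp: k_def)
    have "((\<lambda>_. k p) has_vector_derivative f' t - g' t) (at t within {p..q})"
    proof (rule has_vector_derivative_transform_within[OF _ zero_less_one t])
      show "(k has_vector_derivative f' t - g' t) (at t within {p..q})"
        using k[OF t] by (simp add: has_real_derivative_iff_has_vector_derivative)
    qed (rule const)
    from vector_derivative_within_closed_interval[OF \<open>p < q\<close> t this]
      vector_derivative_within_closed_interval[OF \<open>p < q\<close> t has_vector_derivative_const[of "k p"]]
    have "f' t - g' t = 0" by simp
    then show ?thesis by simp
  qed
qed

section \<open>Smoothness of |x| - sin |x| at the origin\<close>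

lemma DERIV_0_dominated:
  fixes h k :: "real \<Rightarrow> real"
  assumes h: "(h has_real_derivative 0) (at 0)" "h 0 = 0" and le: "\<And>x. \<bar>k x\<bar> \<le> \<bar>h x\<bar>"
  shows "(k has_real_derivative 0) (at 0)"
proof -
  have k0: "k 0 = 0" using le[of 0] h by simp
  have "((\<lambda>x. h x / x) \<longlongrightarrow> 0) (at 0)"
    using h by (simp add: has_field_derivative_iff)
  then have "((\<lambda>x. k x / x) \<longlongrightarrow> 0) (at 0)"
    by (rule tendsto_0_le[where K = 1]) (auto intro!: always_eventually divide_right_mono le simp: abs_divide)
  then show ?thesis using k0 by (simp add: has_field_derivative_iff)
qed

text \<open>The kink of |x| is harmless because x - sin x vanishes to third order at 0. Hence
  \<open>F\<close> below is twice differentiable even where an arc degenerates or changes its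
  turning direction.\<close>

lemma DERIV_abs_minus_sin:
  "((\<lambda>x. \<bar>x\<bar> - sin \<bar>x\<bar>) has_real_derivative sgn x * (1 - cos x)) (at x)"
proof (cases x "0 :: real" rule: linorder_cases)
  case less
  have "((\<lambda>x. - x + sin x) has_real_derivative sgn x * (1 - cos x)) (at x)"
    using less by (auto intro!: derivative_eq_intros)
  then show ?thesis
    by (rule has_field_derivative_transform_within_open[of _ _ _ "{..<0}"]) (use less in auto)
next
  case equal
  have "((\<lambda>x. x - sin x) has_real_derivative 0) (at (0::real))"
    by (auto intro!: derivative_eq_intros)
  then have "((\<lambda>x. \<bar>x\<bar> - sin \<bar>x\<bar>) has_real_derivative 0) (at (0::real))"
    by (rule DERIV_0_dominated) (auto simp: abs_if)
  then show ?thesis using equal by simp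
next
  case greater
  have "((\<lambda>x. x - sin x) has_real_derivative sgn x * (1 - cos x)) (at x)"
    using greater by (auto intro!: derivative_eq_intros)
  then show ?thesis
    by (rule has_field_derivative_transform_within_open[of _ _ _ "{0<..}"]) (use greater in auto)
qed

lemma DERIV_sgn_one_minus_cos:
  "((\<lambda>x. sgn x * (1 - cos x)) has_real_derivative sin \<bar>x\<bar>) (at x)"
proof (cases x "0 :: real" rule: linorder_cases)
  case less
  have "((\<lambda>x. cos x - 1) has_real_derivative sin \<bar>x\<bar>) (at x)"
    using less by (auto intro!: derivative_eq_intros)
  then show ?thesis
    by (rule has_field_derivative_transform_within_open[of _ _ _ "{..<0}"]) (use less in auto)
next
  case equal
  have "((\<lambda>x. 1 - cos x) has_real_derivative 0) (at (0::real))"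
    by (auto intro!: derivative_eq_intros)
  then have "((\<lambda>x. sgn x * (1 - cos x)) has_real_derivative 0) (at (0::real))"
    by (rule DERIV_0_dominated) (auto simp: abs_mult sgn_if)
  then show ?thesis using equal by simp
next
  case greater
  have "((\<lambda>x. 1 - cos x) has_real_derivative sin \<bar>x\<bar>) (at x)"
    using greater by (auto intro!: derivative_eq_intros)
  then show ?thesis
    by (rule has_field_derivative_transform_within_open[of _ _ _ "{0<..}"]) (use greater in auto)
qed

text \<open>A subarc normalised to start at 0 with heading 0; \<open>\<theta>\<close> is a
  real-valued lift of the direction of the velocity. The bound T \<le> 1 confines all angle
  differences to a range where sin or cos is monotone.\<close>

locale heading =
  fixes T :: real and \<theta> :: "real \<Rightarrow> real" and Y :: "real \<Rightarrow> complex"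
  assumes T: "0 < T" "T \<le> 1"
    and lip: "\<And>s t. s \<in> {0..T} \<Longrightarrow> t \<in> {0..T} \<Longrightarrow> \<bar>\<theta> s - \<theta> t\<bar> \<le> \<bar>s - t\<bar>"
    and start: "\<theta> 0 = 0" "Y 0 = 0"
    and deriv: "\<And>t. t \<in> {0..T} \<Longrightarrow> (Y has_vector_derivative cis (\<theta> t)) (at t within {0..T})"
begin

lemma bounds:
  assumes "t \<in> {0..T}"
  shows "\<bar>\<theta> t\<bar> \<le> t" "\<bar>\<theta> t - \<theta> T\<bar> \<le> T - t" "\<bar>\<theta> T\<bar> \<le> T"
  using lip[OF assms, of 0] lip[OF assms, of T] lip[of 0 T] assms T start by auto

lemma deriv_Re_Im:
  assumes "0 \<le> p" "q \<le> T" "t \<in> {p..q}"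
  shows "((\<lambda>t. Re (Y t * cis (- \<phi>))) has_real_derivative cos (\<theta> t - \<phi>)) (at t within {p..q})"
    and "((\<lambda>t. Im (Y t * cis (- \<phi>))) has_real_derivative sin (\<theta> t - \<phi>)) (at t within {p..q})"
proof -
  have *: "(Y has_vector_derivative cis (\<theta> t)) (at t within {p..q})"
    using assms by (intro has_vector_derivative_within_subset[OF deriv]) auto
  have re: "bounded_linear (\<lambda>y. Re (y * cis (- \<phi>)))"
    by (intro bounded_linear_compose[OF bounded_linear_Re bounded_linear_mult_left])
  have im: "bounded_linear (\<lambda>y. Im (y * cis (- \<phi>)))"
    by (intro bounded_linear_compose[OF bounded_linear_Im bounded_linear_mult_left])
  show "((\<lambda>t. Re (Y t * cis (- \<phi>))) has_real_derivative cos (\<theta> t - \<phi>)) (at t within {p..q})"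
    using bounded_linear.has_vector_derivative[OF re *]
    by (simp add: has_real_derivative_iff_has_vector_derivative cos_diff)
  show "((\<lambda>t. Im (Y t * cis (- \<phi>))) has_real_derivative sin (\<theta> t - \<phi>)) (at t within {p..q})"
    using bounded_linear.has_vector_derivative[OF im *]
    by (simp add: has_real_derivative_iff_has_vector_derivative sin_diff)
qed

text \<open>The tent min (t, 2 \<phi> - t) is the largest 1-Lipschitz heading with the given end
  values, and the sine increases on the relevant range. So this tent, a CC path, maximises the
  displacement across \<phi>, and uniquely so; the right-hand side is its value.\<close>

lemma upper_extremal:
  defines "\<phi> \<equiv> (\<theta> T + T) / 2"
  shows "Im (Y T * cis (- \<phi>)) \<le> cos \<phi> - 1 + (cos (\<phi> - \<theta> T) - 1)"
    and "cos \<phi> - 1 + (cos (\<phi> - \<theta> T) - 1) \<le> Im (Y T * cis (- \<phi>)) \<Longrightarrow>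
      (\<forall>t\<in>{0..\<phi>}. \<theta> t = t) \<and> (\<forall>t\<in>{\<phi>..T}. \<theta> t = 2 * \<phi> - t)"
proof -
  have \<phi>: "0 \<le> \<phi>" "\<phi> \<le> T" "T + \<theta> T = 2 * \<phi>" using bounds[of T] T by (auto simp: \<phi>_def)
  \<comment> \<open>As 1 < pi / 2, the angle \<theta> t - \<phi> stays where sin is
    increasing.\<close>
  have low: "\<phi> - \<theta> t \<le> 1" if "t \<in> {0..T}" for t
    using bounds[OF that] \<phi> T by auto
  have up1: "\<theta> t \<le> t" and up2: "\<theta> t \<le> 2 * \<phi> - t" if "t \<in> {0..T}" for t
    using bounds[OF that] \<phi> by auto
  define f where "f t = Im (Y t * cis (- \<phi>))" for t
  have f: "(f has_real_derivative sin (\<theta> t - \<phi>)) (at t within {p..q})"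
    if "0 \<le> p" "q \<le> T" "t \<in> {p..q}" for t p q
    unfolding f_def using that by (rule deriv_Re_Im(2))
  have g1: "((\<lambda>t. - cos (t - \<phi>)) has_real_derivative sin (t - \<phi>)) (at t within {0..\<phi>})" for t
    by (auto intro!: derivative_eq_intros)
  have g2: "((\<lambda>t. cos (\<phi> - t)) has_real_derivative sin (\<phi> - t)) (at t within {\<phi>..T})" for t
    by (auto intro!: derivative_eq_intros)
  have le1: "sin (\<theta> t - \<phi>) \<le> sin (t - \<phi>)" if "t \<in> {0..\<phi>}" for t
    using up1[of t] low[of t] that \<phi> pi_gt3 by (intro sin_monotone_2pi_le) auto
  have le2: "sin (\<theta> t - \<phi>) \<le> sin (\<phi> - t)" if "t \<in> {\<phi>..T}" for t
    using up2[of t] low[of t] that \<phi> pi_gt3 by (intro sin_monotone_2pi_le) auto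
  note c1 = deriv_within_compare[OF \<phi>(1) f[OF order_refl \<phi>(2)] g1 le1, simplified]
  note c2 = deriv_within_compare[OF \<phi>(2) f[OF \<phi>(1) order_refl] g2 le2, simplified]
  have f0: "f 0 = 0" by (simp add: f_def start)
  have *: "\<phi> - \<theta> T = T - \<phi>" using \<phi> by simp
  have cT: "cos (\<phi> - T) = cos (T - \<phi>)" using cos_minus[of "T - \<phi>"] by simp
  show "Im (Y T * cis (- \<phi>)) \<le> cos \<phi> - 1 + (cos (\<phi> - \<theta> T) - 1)"
    using c1(1) c2(1) f0 cT unfolding * f_def[symmetric] by simp
  assume "cos \<phi> - 1 + (cos (\<phi> - \<theta> T) - 1) \<le> Im (Y T * cis (- \<phi>))"
  then have eq: "f T = f \<phi> + cos (\<phi> - T) - 1" "f \<phi> = f 0 + cos \<phi> - 1"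
    using c1(1) c2(1) f0 cT unfolding * f_def[symmetric] by auto
  show "(\<forall>t\<in>{0..\<phi>}. \<theta> t = t) \<and> (\<forall>t\<in>{\<phi>..T}. \<theta> t = 2 * \<phi> - t)"
  proof (intro conjI ballI)
    fix t assume t: "t \<in> {0..\<phi>}"
    show "\<theta> t = t"
    proof (cases "\<phi> = 0")
      case False
      then have e: "sin (\<theta> t - \<phi>) = sin (t - \<phi>)" using c1(2)[of t] eq \<phi> t by auto
      have "0 \<le> t" "t \<le> \<phi>" "\<theta> t \<le> t" "\<phi> - \<theta> t \<le> 1" using up1[of t] low[of t] t \<phi> by auto
      then have "\<theta> t - \<phi> = t - \<phi>"
        by (intro sin_inj_pi[OF _ _ _ _ e]) (use pi_gt3 in linarith)+
      then show ?thesis by simp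
    qed (use t start in simp)
  next
    fix t assume t: "t \<in> {\<phi>..T}"
    show "\<theta> t = 2 * \<phi> - t"
    proof (cases "\<phi> = T")
      case False
      then have e: "sin (\<theta> t - \<phi>) = sin (\<phi> - t)" using c2(2)[of t] eq \<phi> t by auto
      have "\<phi> \<le> t" "\<theta> t \<le> 2 * \<phi> - t" "\<phi> - \<theta> t \<le> 1" using up2[of t] low[of t] t \<phi> by auto
      then have "\<theta> t - \<phi> = \<phi> - t"
        by (intro sin_inj_pi[OF _ _ _ _ e]) (use pi_gt3 in linarith)+
      then show ?thesis by simp
    qed (use t \<phi> in auto)
  qed
qed

end

lemma (in heading) mirrored: "heading T (\<lambda>t. - \<theta> t) (\<lambda>t. cnj (Y t))"
proof
  fix t assume "t \<in> {0..T}"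
  from bounded_linear.has_vector_derivative[OF bounded_linear_cnj deriv[OF this]]
  show "((\<lambda>t. cnj (Y t)) has_vector_derivative cis (- \<theta> t)) (at t within {0..T})"
    by (simp add: cis_cnj)
next
  fix s t assume "s \<in> {0..T}" "t \<in> {0..T}"
  then show "\<bar>- \<theta> s - - \<theta> t\<bar> \<le> \<bar>s - t\<bar>" using lip[of s t] by simp
qed (use T start in auto)

lemma (in heading) lower_extremal:
  defines "\<phi> \<equiv> (\<theta> T - T) / 2"
  shows "- (cos \<phi> - 1 + (cos (\<phi> - \<theta> T) - 1)) \<le> Im (Y T * cis (- \<phi>))"
    and "Im (Y T * cis (- \<phi>)) \<le> - (cos \<phi> - 1 + (cos (\<phi> - \<theta> T) - 1)) \<Longrightarrow>
      (\<forall>t\<in>{0..-\<phi>}. \<theta> t = - t) \<and> (\<forall>t\<in>{-\<phi>..T}. \<theta> t = 2 * \<phi> + t)"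
proof -
  have e: "(- \<theta> T + T) / 2 = - \<phi>" by (simp add: \<phi>_def field_simps)
  have i: "Im (cnj (Y T) * cis \<phi>) = - Im (Y T * cis (- \<phi>))" by simp
  have c: "cos (- \<phi> - - \<theta> T) = cos (\<phi> - \<theta> T)" using cos_minus[of "\<phi> - \<theta> T"] by simp
  note * = heading.upper_extremal[OF mirrored, unfolded e minus_minus c cos_minus i]
  show "- (cos \<phi> - 1 + (cos (\<phi> - \<theta> T) - 1)) \<le> Im (Y T * cis (- \<phi>))"
    using *(1) c by linarith
  assume "Im (Y T * cis (- \<phi>)) \<le> - (cos \<phi> - 1 + (cos (\<phi> - \<theta> T) - 1))"
  then have "(\<forall>t\<in>{0..- \<phi>}. - \<theta> t = t) \<and> (\<forall>t\<in>{- \<phi>..T}. - \<theta> t = 2 * - \<phi> - t)"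
    using *(2) c by linarith
  then show "(\<forall>t\<in>{0..-\<phi>}. \<theta> t = - t) \<and> (\<forall>t\<in>{-\<phi>..T}. \<theta> t = 2 * \<phi> + t)"
    by (force simp: algebra_simps)
qed

text \<open>The hypothesis \<open>ge\<close> says T \<le> F \<phi>. A heading that moves from 0 to
  \<open>\<theta> T\<close> at rate at most 1 is at distance at least p - t, 0 or t - q from \<phi>
  on the three intervals, so its progress along \<phi> is at most that of the CSC path.
  \<open>ge\<close> forces equality on each interval.\<close>

lemma (in heading) calibration:
  assumes \<phi>: "\<bar>\<phi>\<bar> + \<bar>\<phi> - \<theta> T\<bar> \<le> T"
    and ge: "sin \<bar>\<phi>\<bar> + (T - \<bar>\<phi>\<bar> - \<bar>\<phi> - \<theta> T\<bar>) + sin \<bar>\<phi> - \<theta> T\<bar> \<le> Re (Y T * cis (- \<phi>))"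
  defines "u \<equiv> if \<phi> \<ge> 0 then 1 else -1" and "v \<equiv> if \<theta> T \<ge> \<phi> then 1 else -1"
    and "p \<equiv> \<bar>\<phi>\<bar>" and "q \<equiv> T - \<bar>\<phi> - \<theta> T\<bar>"
  shows "\<forall>t\<in>{0..p}. \<theta> t = u * t" "\<forall>t\<in>{p..q}. \<theta> t = u * p" "\<forall>t\<in>{q..T}. \<theta> t = u * p + v * (t - q)"
proof -
  have pq: "0 \<le> p" "p \<le> q" "q \<le> T" using \<phi> by (auto simp: p_def q_def)
  have up: "u * p = \<phi>" by (simp add: u_def p_def)
  have far: "\<bar>\<theta> t - \<phi>\<bar> \<le> pi" "p - t \<le> \<bar>\<theta> t - \<phi>\<bar>" "t - q \<le> \<bar>\<theta> t - \<phi>\<bar>" if "t \<in> {0..T}" for t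
    using bounds[OF that] \<phi> pi_gt3 T that by (auto simp: p_def q_def)
  define f where "f t = Re (Y t * cis (- \<phi>))" for t
  have f: "(f has_real_derivative cos (\<theta> t - \<phi>)) (at t within {p..q})"
    if "0 \<le> p" "q \<le> T" "t \<in> {p..q}" for t p q
    unfolding f_def using that by (rule deriv_Re_Im(1))
  have g1: "((\<lambda>t. - sin (p - t)) has_real_derivative cos (p - t)) (at t within {0..p})" for t
    by (auto intro!: derivative_eq_intros)
  have g2: "((\<lambda>t. t) has_real_derivative 1) (at t within {p..q})" for t
    by (auto intro!: derivative_eq_intros)
  have g3: "((\<lambda>t. sin (t - q)) has_real_derivative cos (t - q)) (at t within {q..T})" for t
    by (auto intro!: derivative_eq_intros)
  have le1: "cos (\<theta> t - \<phi>) \<le> cos (p - t)" if "t \<in> {0..p}" for t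
    using far[of t] that pq cos_monotone_0_pi_le[of "p - t" "\<bar>\<theta> t - \<phi>\<bar>"] by auto
  have le3: "cos (\<theta> t - \<phi>) \<le> cos (t - q)" if "t \<in> {q..T}" for t
    using far[of t] that pq cos_monotone_0_pi_le[of "t - q" "\<bar>\<theta> t - \<phi>\<bar>"] by auto
  have p_T: "p \<le> T" and q_0: "0 \<le> q" using pq by auto
  note c1 = deriv_within_compare[OF pq(1) f[OF order_refl p_T] g1 le1, simplified]
  note c2 = deriv_within_compare[OF pq(2) f[OF pq(1) pq(3)] g2 cos_le_one, simplified]
  note c3 = deriv_within_compare[OF pq(3) f[OF q_0 order_refl] g3 le3, simplified]
  have f0: "f 0 = 0" by (simp add: f_def start)
  have "sin p + (q - p) + sin (T - q) \<le> f T"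
    using ge by (simp add: f_def p_def q_def)
  then have eq: "f p = f 0 + sin p" "f q = f p + (q - p)" "f T = f q + sin (T - q)"
    using c1(1) c2(1) c3(1) f0 by auto
  show "\<forall>t\<in>{0..p}. \<theta> t = u * t"
  proof
    fix t assume t: "t \<in> {0..p}"
    show "\<theta> t = u * t"
    proof (cases "p = 0")
      case False
      then have e: "cos \<bar>\<theta> t - \<phi>\<bar> = cos (p - t)" using c1(2)[of t] eq pq t by auto
      have "\<bar>\<theta> t - \<phi>\<bar> \<le> pi" "p - t \<le> \<bar>\<theta> t - \<phi>\<bar>" "0 \<le> p - t" using far[of t] t pq by auto
      then have "\<bar>\<theta> t - \<phi>\<bar> = p - t"
        by (intro cos_inj_pi[OF _ _ _ _ e]) linarith+
      moreover have "\<bar>\<theta> t\<bar> \<le> t" using bounds[of t] t pq by auto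
      ultimately show ?thesis unfolding u_def p_def by (cases "\<phi> \<ge> 0"; simp; linarith)
    qed (use t start in simp)
  qed
  show "\<forall>t\<in>{q..T}. \<theta> t = u * p + v * (t - q)"
  proof
    fix t assume t: "t \<in> {q..T}"
    show "\<theta> t = u * p + v * (t - q)"
    proof (cases "q = T")
      case False
      then have e: "cos \<bar>\<theta> t - \<phi>\<bar> = cos (t - q)" using c3(2)[of t] eq pq t by auto
      have "\<bar>\<theta> t - \<phi>\<bar> \<le> pi" "t - q \<le> \<bar>\<theta> t - \<phi>\<bar>" "0 \<le> t - q" using far[of t] t pq by auto
      then have "\<bar>\<theta> t - \<phi>\<bar> = t - q"
        by (intro cos_inj_pi[OF _ _ _ _ e]) linarith+
      moreover have "\<bar>\<theta> t - \<theta> T\<bar> \<le> T - t" using bounds[of t] t pq by auto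
      ultimately show ?thesis unfolding up v_def q_def by (cases "\<theta> T \<ge> \<phi>"; simp; linarith)
    qed (use t up in \<open>auto simp: q_def\<close>)
  qed
  then have "\<theta> q = \<phi>" using pq up by auto
  show "\<forall>t\<in>{p..q}. \<theta> t = u * p"
  proof
    fix t assume t: "t \<in> {p..q}"
    show "\<theta> t = u * p"
    proof (cases "p = q")
      case False
      then have e: "cos \<bar>\<theta> t - \<phi>\<bar> = cos 0" using c2(2)[of t] eq pq t by auto
      have "\<bar>\<theta> t - \<phi>\<bar> \<le> pi" using far[of t] t pq by auto
      then have "\<bar>\<theta> t - \<phi>\<bar> = 0"
        by (intro cos_inj_pi[OF _ _ _ _ e]) linarith+
      then show ?thesis using up by simp
    qed (use t up \<open>\<theta> q = \<phi>\<close> in auto)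
  qed
qed

lemma (in heading) CSC:
  assumes min: "\<And>w. valid w \<Longrightarrow> turn w = \<theta> T \<Longrightarrow> disp w = Y T \<Longrightarrow> T \<le> len w"
  shows "\<exists>p q u v. 0 \<le> p \<and> p \<le> q \<and> q \<le> T \<and> u \<in> {-1, 1} \<and> v \<in> {-1, 1} \<and>
    (\<forall>t\<in>{0..p}. \<theta> t = u * t) \<and> (\<forall>t\<in>{p..q}. \<theta> t = u * p) \<and>
    (\<forall>t\<in>{q..T}. \<theta> t = u * p + v * (t - q))"
proof -
  define b Q where "b = \<theta> T" and "Q = Y T"
  have b: "\<bar>b\<bar> \<le> T" using bounds[of T] T by (simp add: b_def)
  \<comment> \<open>The waste of an arc of angle |x|: its length minus its progress along the
    straight piece.\<close>
  define G G' :: "real \<Rightarrow> real" where "G x = \<bar>x\<bar> - sin \<bar>x\<bar>" and "G' x = sgn x * (1 - cos x)" for x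
  have G: "(G has_real_derivative G' x) (at x)" for x
    unfolding G_def[abs_def] G'_def by (rule DERIV_abs_minus_sin)
  have G': "(G' has_real_derivative sin \<bar>x\<bar>) (at x)" for x
    unfolding G'_def[abs_def] by (rule DERIV_sgn_one_minus_cos)
  define F where "F \<phi> = Re Q * cos \<phi> + Im Q * sin \<phi> + G \<phi> + G (\<phi> - b)" for \<phi>
  define F' where "F' \<phi> = Im Q * cos \<phi> - Re Q * sin \<phi> + G' \<phi> + G' (\<phi> - b)" for \<phi>
  define F'' where "F'' \<phi> = - (Re Q * cos \<phi> + Im Q * sin \<phi>) + sin \<bar>\<phi>\<bar> + sin \<bar>\<phi> - b\<bar>" for \<phi>
  have F: "(F has_real_derivative F' \<phi>) (at \<phi>)" for \<phi>
    unfolding F_def[abs_def] F'_def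
    by (auto intro!: derivative_eq_intros G DERIV_chain2[where g = "\<lambda>x. x - b" and f = G])
  have F': "(F' has_real_derivative F'' \<phi>) (at \<phi>)" for \<phi>
    unfolding F'_def[abs_def] F''_def
    by (auto intro!: derivative_eq_intros G' DERIV_chain2[where g = "\<lambda>x. x - b" and f = G'])
  \<comment> \<open>As |b| \<le> T, these are the ends of the set of \<phi> with |\<phi>| + |\<phi>
    - b| \<le> T, i.e. of the directions whose two arcs fit into length T.\<close>
  define l r where "l = (b - T) / 2" and "r = (b + T) / 2"
  have lr: "l < r" "l \<le> 0" "0 \<le> r" "l \<le> b" "b \<le> r" "r - l = T" using T b by (auto simp: l_def r_def field_simps)
  have Im_Q: "Im (Q * cis (- x)) = Im Q * cos x - Re Q * sin x" for x by simp
  have Re_Q: "Re (Q * cis (- x)) = Re Q * cos x + Im Q * sin x" for x by simp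
  have "continuous_on {l..r} F" by (rule DERIV_continuous_on) (rule has_field_derivative_at_within[OF F])
  then obtain \<phi> where \<phi>: "\<phi> \<in> {l..r}" and max: "\<And>x. x \<in> {l..r} \<Longrightarrow> F x \<le> F \<phi>"
    using continuous_attains_sup[of "{l..r}" F] lr by auto
  consider "\<phi> = r" | "\<phi> = l" | "l < \<phi>" "\<phi> < r" using \<phi> by force
  then show ?thesis
  proof cases
    case 1
    \<comment> \<open>At a maximum on the right end the derivative cannot be negative. This is the
      inequality opposite to \<open>upper_extremal(1)\<close>, so the rigidity in
      \<open>upper_extremal(2)\<close> applies.\<close>
    have "0 \<le> F' r"
    proof (rule ccontr)
      assume "\<not> 0 \<le> F' r"
      then obtain d where d: "0 < d" "\<And>h. 0 < h \<Longrightarrow> h < d \<Longrightarrow> F r < F (r - h)"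
        using DERIV_neg_dec_left[OF F, of r] by auto
      define h where "h = min (d / 2) T"
      have "0 < h" "h < d" "h \<le> r - l" using d(1) T lr by (auto simp: h_def)
      then show False using d(2)[of h] max[of "r - h"] 1 by auto
    qed
    moreover have "G' r = 1 - cos r" using lr by (cases "r = 0") (auto simp: G'_def)
    moreover have "G' (r - b) = 1 - cos (r - b)" using lr by (cases "r = b") (auto simp: G'_def)
    ultimately have "cos r - 1 + (cos (r - b) - 1) \<le> Im (Q * cis (- r))"
      unfolding Im_Q F'_def by simp
    then have "(\<forall>t\<in>{0..r}. \<theta> t = t) \<and> (\<forall>t\<in>{r..T}. \<theta> t = 2 * r - t)"
      using upper_extremal(2) unfolding b_def[symmetric] Q_def[symmetric] r_def[symmetric] by blast
    then show ?thesis using lr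
      by (intro exI[of _ r] exI[of _ 1] exI[of _ "-1"]) (auto simp: algebra_simps)
  next
    case 2
    have "F' l \<le> 0"
    proof (rule ccontr)
      assume "\<not> F' l \<le> 0"
      then obtain d where d: "0 < d" "\<And>h. 0 < h \<Longrightarrow> h < d \<Longrightarrow> F l < F (l + h)"
        using DERIV_pos_inc_right[OF F, of l] by auto
      define h where "h = min (d / 2) T"
      have "0 < h" "h < d" "h \<le> r - l" using d(1) T lr by (auto simp: h_def)
      then show False using d(2)[of h] max[of "l + h"] 2 by auto
    qed
    moreover have "G' l = - (1 - cos l)" using lr by (cases "l = 0") (auto simp: G'_def)
    moreover have "G' (l - b) = - (1 - cos (l - b))" using lr by (cases "l = b") (auto simp: G'_def)
    ultimately have "Im (Q * cis (- l)) \<le> - (cos l - 1 + (cos (l - b) - 1))"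
      unfolding Im_Q F'_def by simp
    then have "(\<forall>t\<in>{0..-l}. \<theta> t = - t) \<and> (\<forall>t\<in>{-l..T}. \<theta> t = 2 * l + t)"
      using lower_extremal(2) unfolding b_def[symmetric] Q_def[symmetric] l_def[symmetric] by blast
    then show ?thesis using lr
      by (intro exI[of _ "-l"] exI[of _ "-1"] exI[of _ 1]) (auto simp: algebra_simps)
  next
    case 3
    define d where "d = min (\<phi> - l) (r - \<phi>)"
    have d: "0 < d" "d \<le> \<phi> - l" "d \<le> r - \<phi>" using 3 by (auto simp: d_def)
    have F'0: "F' \<phi> = 0"
      using DERIV_local_max[OF F d(1)] max d by (auto simp: abs_if split: if_splits)
    have F''0: "F'' \<phi> \<le> 0"
    proof (rule ccontr)
      assume "\<not> F'' \<phi> \<le> 0"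
      then obtain e where e: "0 < e" "\<And>h. 0 < h \<Longrightarrow> h < e \<Longrightarrow> 0 < F' (\<phi> + h)"
        using DERIV_pos_inc_right[OF F', of \<phi>] F'0 by auto
      define h where "h = min e d / 2"
      have h: "0 < h" "h < e" "h < d" using e d by (auto simp: h_def)
      have "F \<phi> < F (\<phi> + h)"
      proof (rule DERIV_pos_imp_increasing_open[where f = F and a = \<phi> and b = "\<phi> + h"])
        fix x assume "\<phi> < x" "x < \<phi> + h"
        then show "\<exists>y. (F has_real_derivative y) (at x) \<and> 0 < y"
          using F[of x] e(2)[of "x - \<phi>"] h by auto
      next
        show "continuous_on {\<phi>..\<phi> + h} F"
          by (rule DERIV_continuous_on) (rule has_field_derivative_at_within[OF F])
      qed (use h in auto)
      then show False using max[of "\<phi> + h"] h d by auto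
    qed
    define u v :: real where "u = (if \<phi> \<ge> 0 then 1 else -1)" and "v = (if b \<ge> \<phi> then 1 else -1)"
    have u: "u \<in> {-1, 1}" "v \<in> {-1, 1}" "u * \<bar>\<phi>\<bar> = \<phi>" "v * \<bar>\<phi> - b\<bar> = b - \<phi>" by (auto simp: u_def v_def)
    have sum: "\<bar>\<phi>\<bar> + \<bar>\<phi> - b\<bar> \<le> T"
      using 3 b by (auto simp: l_def r_def abs_if field_simps)
    \<comment> \<open>Length of the straight piece; \<open>F'' \<phi>\<close> equals -S.\<close>
    define S where "S = Re (Q * cis (- \<phi>)) - sin \<bar>\<phi>\<bar> - sin \<bar>\<phi> - b\<bar>"
    have S: "0 \<le> S" using F''0 by (simp add: S_def F''_def)
    define w :: word where "w = [(u, \<bar>\<phi>\<bar>), (0, S), (v, \<bar>\<phi> - b\<bar>)]"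
    have "valid w" "turn w = \<theta> T" using S u by (auto simp: w_def b_def)
    moreover have "disp w = Y T"
    proof -
      have uG: "G' \<phi> = u * (1 - cos \<phi>)" "G' (\<phi> - b) = - v * (1 - cos (b - \<phi>))"
        using cos_minus[of "\<phi> - b"] by (auto simp: G'_def u_def v_def sgn_if)
      have us: "u * sin \<phi> = sin \<bar>\<phi>\<bar>" "v * sin (b - \<phi>) = sin \<bar>\<phi> - b\<bar>"
        using sin_minus[of "\<phi> - b"] by (auto simp: u_def v_def abs_if)
      have "disp w = - \<i> * u * (cis \<phi> - 1) + S * cis \<phi> - \<i> * v * (cis \<phi> * cis (b - \<phi>) - cis \<phi>)"
        using u by (auto simp: w_def piece_disp_def algebra_simps)
      \<comment> \<open>Seen in direction \<phi>, the real part matches by the choice of S, the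
        imaginary part because \<open>F' \<phi> = 0\<close>.\<close>
      then have "disp w * cis (- \<phi>) = - \<i> * u * (1 - cis (- \<phi>)) + S - \<i> * v * (cis (b - \<phi>) - 1)"
        using cis_mult[of \<phi> "- \<phi>"] by simp algebra
      also have "\<dots> = Q * cis (- \<phi>)"
      proof (rule complex_eqI)
        show "Re (- \<i> * u * (1 - cis (- \<phi>)) + S - \<i> * v * (cis (b - \<phi>) - 1)) = Re (Q * cis (- \<phi>))"
          unfolding S_def using us by (simp add: algebra_simps)
        show "Im (- \<i> * u * (1 - cis (- \<phi>)) + S - \<i> * v * (cis (b - \<phi>) - 1)) = Im (Q * cis (- \<phi>))"
          using F'0 unfolding F'_def Im_Q uG by (simp add: algebra_simps)
      qed
      finally show ?thesis by (simp add: Q_def)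
    qed
    \<comment> \<open>Since len w = F \<phi>, this is the hypothesis T \<le> F \<phi> of the
      calibration.\<close>
    ultimately have "T \<le> len w" by (rule min)
    then have ge: "sin \<bar>\<phi>\<bar> + (T - \<bar>\<phi>\<bar> - \<bar>\<phi> - \<theta> T\<bar>) + sin \<bar>\<phi> - \<theta> T\<bar> \<le> Re (Y T * cis (- \<phi>))"
      by (simp add: w_def S_def b_def Q_def)
    note cal = calibration[OF sum[unfolded b_def] ge, folded b_def, folded u_def v_def]
    show ?thesis
      by (intro exI[of _ "\<bar>\<phi>\<bar>"] exI[of _ "T - \<bar>\<phi> - b\<bar>"] exI[of _ u] exI[of _ v] conjI;
          (rule cal u | use sum in simp))
  qed
qed

section \<open>Shortest curves of curvature at most 1\<close>

lemma shortest_subword: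
  assumes "shortest (v @ w @ x)" "valid v" "valid x"
  shows "shortest w"
  unfolding shortest_def
proof (intro allI impI)
  fix w' assume w': "valid w' \<and> cis (turn w') = cis (turn w) \<and> disp w' = disp w"
  then have "valid (v @ w' @ x)" "cis (turn (v @ w' @ x)) = cis (turn (v @ w @ x))"
      "disp (v @ w' @ x) = disp (v @ w @ x)"
    using assms by (simp_all flip: cis_mult)
  then have "len (v @ w @ x) \<le> len (v @ w' @ x)"
    using assms(1) unfolding shortest_def by blast
  then show "len w \<le> len w'" by simp
qed

text \<open>Combines the exclusions for one arc with a piece of different curvature on each side:
  straight neighbours are impossible (reversal handles the second one), so both bend the other way,
  and then the arc exceeds pi. Mirroring reduces to v = 1.\<close>

lemma shortest_interior_arc:
  assumes s: "shortest [(u, k), (v, l), (u', m)]"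
    and u: "u \<in> {-1, 0, 1}" "u' \<in> {-1, 0, 1}" "v = 1 \<or> v = -1" "u \<noteq> v" "u' \<noteq> v"
    and pos: "0 < k" "0 < l" "0 < m"
  shows "u = - v" "u' = - v" "pi < l" "l < 2 * pi"
proof -
  have *: "u = - 1 \<and> u' = - 1 \<and> pi < l \<and> l < 2 * pi"
    if s: "shortest [(u, k), (1, l), (u', m)]" and u: "u \<in> {-1, 0, 1}" "u' \<in> {-1, 0, 1}" "u \<noteq> 1" "u' \<noteq> 1"
      and pos: "0 < k" "0 < m" for u k u' m :: real
  proof -
    have "shortest [(1, l)]"
      using shortest_subword[of "[(u, k)]" "[(1, l)]" "[(u', m)]"] s u pos by auto
    then have l: "l < 2 * pi" by (rule not_shortest_loop) simp
    have "u \<noteq> 0"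
      using s u pos \<open>0 < l\<close> l not_shortest_SCS not_shortest_SCC by auto
    moreover have "u' \<noteq> 0"
      using shortest_rev[OF s] \<open>u \<noteq> 0\<close> u pos \<open>0 < l\<close> l not_shortest_SCC by auto
    ultimately have "u = - 1" "u' = - 1" using u by auto
    moreover have "pi < l"
      using not_shortest_CCC[of k m l] s calculation pos \<open>0 < l\<close> by force
    ultimately show ?thesis using l by blast
  qed
  have "u = - v \<and> u' = - v \<and> pi < l \<and> l < 2 * pi"
  proof (cases "v = 1")
    case True
    have "u = - 1 \<and> u' = - 1 \<and> pi < l \<and> l < 2 * pi"
      by (rule *[OF _ u(1,2) _ _ pos(1,3)]) (use s u True in simp_all)
    then show ?thesis using True by simp
  next
    case False
    then have v: "v = -1" using u by blast
    have neg: "- x \<in> {-1, 0, 1}" "- x \<noteq> 1" if "x \<in> {-1, 0, 1}" "x \<noteq> -1" for x :: real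
      using that by auto
    have "u \<noteq> -1" "u' \<noteq> -1" using u(4,5) v by simp_all
    note n = neg[OF u(1) this(1)] neg[OF u(2) this(2)]
    have "- u = - 1 \<and> - u' = - 1 \<and> pi < l \<and> l < 2 * pi"
    proof (rule *[OF _ _ _ _ _ pos(1,3)])
      show "shortest [(- u, k), (1, l), (- u', m)]"
        using shortest_mirror[OF s] v by simp
    qed (rule n)+
    then show ?thesis using v by simp
  qed
  then show "u = - v" "u' = - v" "pi < l" "l < 2 * pi" by blast+
qed

section \<open>From chords of the unit circle to angles\<close>

lemma norm_cis_diff: "norm (cis x - cis y) = 2 * \<bar>sin ((x - y) / 2)\<bar>"
proof -
  have "cis x - cis y = cis y * (cis (x - y) - 1)"
    by (simp add: algebra_simps cis_mult)
  moreover have "norm (cis (x - y) - 1) = 2 * \<bar>sin ((x - y) / 2)\<bar>"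
    unfolding cis_conv_exp by (rule dist_exp_i_1)
  ultimately show ?thesis by (simp add: norm_mult)
qed

text \<open>A bound on chords yields directly only an \<open>arcsin\<close> bound on angles, which
  is weaker. Subdividing the interval and using arcsin h / h \<longlongrightarrow> 1 recovers the
  constant 1.\<close>

lemma chord_lipschitz:
  assumes close: "\<And>s t. s \<in> {0..T} \<Longrightarrow> t \<in> {0..T} \<Longrightarrow> \<bar>\<theta> s - \<theta> t\<bar> \<le> pi"
    and chord: "\<And>s t. s \<in> {0..T} \<Longrightarrow> t \<in> {0..T} \<Longrightarrow> norm (cis (\<theta> s) - cis (\<theta> t)) \<le> \<bar>s - t\<bar>"
    and st: "s \<in> {0..T}" "t \<in> {0..T}" and T: "T \<le> 1"
  shows "\<bar>\<theta> s - \<theta> t\<bar> \<le> \<bar>s - t\<bar>"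
proof -
  have step: "\<bar>\<theta> s - \<theta> t\<bar> \<le> 2 * arcsin (\<bar>s - t\<bar> / 2)" if "s \<in> {0..T}" "t \<in> {0..T}" for s t
  proof -
    have "sin (\<bar>\<theta> s - \<theta> t\<bar> / 2) \<le> \<bar>sin ((\<theta> s - \<theta> t) / 2)\<bar>"
    proof (cases "\<theta> t \<le> \<theta> s")
      case False
      then have "\<bar>\<theta> s - \<theta> t\<bar> / 2 = - ((\<theta> s - \<theta> t) / 2)" by (simp add: field_simps)
      then show ?thesis by (simp only: sin_minus)
    qed simp
    also have "\<dots> \<le> \<bar>s - t\<bar> / 2" using chord[OF that] by (simp add: norm_cis_diff)
    finally have le: "sin (\<bar>\<theta> s - \<theta> t\<bar> / 2) \<le> \<bar>s - t\<bar> / 2" .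
    have "0 \<le> sin (\<bar>\<theta> s - \<theta> t\<bar> / 2)" using close[OF that] by (intro sin_ge_zero) auto
    then have "arcsin (sin (\<bar>\<theta> s - \<theta> t\<bar> / 2)) \<le> arcsin (\<bar>s - t\<bar> / 2)"
      using le that T by (intro arcsin_le_arcsin) auto
    moreover have "arcsin (sin (\<bar>\<theta> s - \<theta> t\<bar> / 2)) = \<bar>\<theta> s - \<theta> t\<bar> / 2"
      using close[OF that] by (intro arcsin_sin) auto
    ultimately show ?thesis by simp
  qed
  have main: "\<bar>\<theta> y - \<theta> x\<bar> \<le> y - x" if xy: "x \<in> {0..T}" "y \<in> {0..T}" "x < y" for x y
  proof -
    \<comment> \<open>The sum over n + 1 equal steps, rewritten as y - x times a difference quotient
      of \<open>arcsin\<close> at 0.\<close>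
    have n: "\<bar>\<theta> y - \<theta> x\<bar> \<le> (y - x) * (arcsin ((y - x) / 2 / real (Suc n)) / ((y - x) / 2 / real (Suc n)))" for n
    proof -
      define h where "h = (y - x) / real (Suc n)"
      have h: "0 < h" "real (Suc n) * h = y - x" using xy by (simp_all add: h_def)
      have "\<bar>\<theta> (x + real k * h) - \<theta> x\<bar> \<le> real k * (2 * arcsin (h / 2))" if "k \<le> Suc n" for k
        using that
      proof (induction k)
        case (Suc k)
        have kh: "real (Suc k) * h \<le> real (Suc n) * h" "0 \<le> real k * h"
          using Suc.prems h(1) by (simp_all only: mult_right_mono of_nat_le_iff less_imp_le) simp
        then have in_T: "x + real (Suc k) * h \<in> {0..T}" "x + real k * h \<in> {0..T}"
        proof -
          have "real (Suc k) * h = real k * h + h" by (simp add: algebra_simps)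
          then show "x + real (Suc k) * h \<in> {0..T}" "x + real k * h \<in> {0..T}"
            using kh h xy unfolding atLeastAtMost_iff by linarith+
        qed
        have "\<bar>\<theta> (x + real (Suc k) * h) - \<theta> (x + real k * h)\<bar> \<le> 2 * arcsin (h / 2)"
          using step[OF in_T] h by (simp add: algebra_simps)
        then show ?case using Suc by (simp add: algebra_simps)
      qed simp
      from this[of "Suc n"] have "\<bar>\<theta> y - \<theta> x\<bar> \<le> real (Suc n) * (2 * arcsin (h / 2))"
        using h by (simp add: algebra_simps)
      also have "\<dots> = (y - x) * (arcsin ((y - x) / 2 / real (Suc n)) / ((y - x) / 2 / real (Suc n)))"
        using xy by (simp add: h_def field_simps)
      finally show ?thesis .
    qed
    have "(arcsin has_real_derivative inverse (sqrt (1 - 0\<^sup>2))) (at 0)"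
      by (rule DERIV_arcsin) auto
    then have lim: "((\<lambda>h. arcsin h / h) \<longlongrightarrow> 1) (at 0)"
      by (simp add: has_field_derivative_iff)
    have "filterlim (\<lambda>n. (y - x) / 2 / real (Suc n)) (at 0) sequentially"
      unfolding filterlim_at
    proof
      show "(\<lambda>n. (y - x) / 2 / real (Suc n)) \<longlonglongrightarrow> 0"
        by (rule LIMSEQ_Suc[OF lim_const_over_n])
    qed (use xy in auto)
    from filterlim_compose[OF lim this]
    have "(\<lambda>n. (y - x) * (arcsin ((y - x) / 2 / real (Suc n)) / ((y - x) / 2 / real (Suc n)))) \<longlonglongrightarrow> (y - x) * 1"
      by (intro tendsto_mult tendsto_const) (simp add: o_def)
    then have "\<bar>\<theta> y - \<theta> x\<bar> \<le> (y - x) * 1"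
      by (rule LIMSEQ_le_const) (use n in blast)
    then show ?thesis by simp
  qed
  show ?thesis
    using main[of s t] main[of t s] st by (cases s t rule: linorder_cases) auto
qed

lemma has_vector_derivative_cis_linear:
  "((\<lambda>t. cis (k * (t - p))) has_vector_derivative \<i> * of_real k * cis (k * (t - p))) (at t within S)"
proof -
  have "((\<lambda>t. of_real (cos (k * (t - p))) + \<i> * of_real (sin (k * (t - p)))) has_vector_derivative
      of_real (- sin (k * (t - p)) * k) + \<i> * of_real (cos (k * (t - p)) * k)) (at t within S)"
    by (intro has_vector_derivative_add has_vector_derivative_mult_right has_vector_derivative_of_real)
      (auto intro!: derivative_eq_intros)
  moreover have "of_real (- sin (k * (t - p)) * k) + \<i> * of_real (cos (k * (t - p)) * k) =
      \<i> * of_real k * cis (k * (t - p))"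
    by (simp add: complex_eq_iff)
  moreover have "of_real (cos x) + \<i> * of_real (sin x) = cis x" for x
    by (simp add: complex_eq_iff)
  ultimately show ?thesis by (simp only:)
qed

lemma has_vector_derivative_piece_disp:
  assumes "u \<in> {-1, 0, 1}"
  shows "((\<lambda>t. piece_disp u (t - p)) has_vector_derivative cis (u * (t - p))) (at t within S)"
proof (cases "u = 0")
  case True
  then show ?thesis
    by (auto simp: piece_disp_def intro!: derivative_eq_intros has_vector_derivative_of_real)
next
  case False
  have "((\<lambda>t. - \<i> * of_real u * (cis (u * (t - p)) - 1)) has_vector_derivative
      - \<i> * of_real u * (\<i> * of_real u * cis (u * (t - p)) - 0)) (at t within S)"
    by (intro has_vector_derivative_mult_right has_vector_derivative_diff
        has_vector_derivative_cis_linear has_vector_derivative_const)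
  moreover have "- \<i> * of_real u * (\<i> * of_real u * cis (u * (t - p)) - 0) = cis (u * (t - p))"
    using False assms by auto
  ultimately show ?thesis using False unfolding piece_disp_def by simp
qed

text \<open>A stage rescaled to curvature 1. The curvature bound enters as a Lipschitz condition on
  the velocity, so no second derivative occurs; \<open>min\<close> speaks of all subarcs, because
  words are substituted at arbitrary places.\<close>

locale dubins =
  fixes Z V :: "real \<Rightarrow> complex" and b c :: real
  assumes bc: "b < c"
    and deriv: "\<And>t. t \<in> {b..c} \<Longrightarrow> (Z has_vector_derivative V t) (at t within {b..c})"
    and unit: "\<And>t. t \<in> {b..c} \<Longrightarrow> norm (V t) = 1"
    and lip: "\<And>s t. s \<in> {b..c} \<Longrightarrow> t \<in> {b..c} \<Longrightarrow> norm (V s - V t) \<le> \<bar>s - t\<bar>"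
    and min: "\<And>s t w. b \<le> s \<Longrightarrow> s \<le> t \<Longrightarrow> t \<le> c \<Longrightarrow> valid w \<Longrightarrow> V t = V s * cis (turn w) \<Longrightarrow>
      Z t - Z s = V s * disp w \<Longrightarrow> t - s \<le> len w"
begin

text \<open>A condition on the velocity alone; integration (\<open>piece_displacement\<close>)
  recovers the position.\<close>

definition piece :: "real \<Rightarrow> real \<Rightarrow> real \<Rightarrow> bool" where
  "piece u p q \<longleftrightarrow> (\<forall>t\<in>{p..q}. V t = V p * cis (u * (t - p)))"

text \<open>As a relation between times, its closure \<open>bang\<^sup>*\<^sup>*\<close> expresses a
  finite concatenation of pieces, and its powers count them.\<close>

definition bang :: "real \<Rightarrow> real \<Rightarrow> bool" where
  "bang p q \<longleftrightarrow> b \<le> p \<and> p < q \<and> q \<le> c \<and> (\<exists>u\<in>{-1, 0, 1}. piece u p q)"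

lemma pieceD:
  assumes "piece u p q" "p \<le> t" "t \<le> q"
  shows "V t = V p * cis (u * (t - p))"
  using assms(1) unfolding piece_def by (rule bspec) (use assms in simp)

lemma piece_trans:
  assumes "piece u p q" "piece u q r" "p \<le> q" "q \<le> r"
  shows "piece u p r"
  unfolding piece_def
proof
  fix t assume t: "t \<in> {p..r}"
  show "V t = V p * cis (u * (t - p))"
  proof (cases "t \<le> q")
    case False
    have "V t = V p * (cis (u * (q - p)) * cis (u * (t - q)))"
      using pieceD[OF assms(1,3) order_refl] pieceD[OF assms(2), of t] t False by simp
    also have "cis (u * (q - p)) * cis (u * (t - q)) = cis (u * (t - p))"
      by (simp add: cis_mult algebra_simps)
    finally show ?thesis .
  qed (use t in \<open>auto intro: pieceD[OF assms(1)]\<close>)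
qed

lemma piece_displacement:
  assumes "piece u p q" "u \<in> {-1, 0, 1}" "b \<le> p" "p \<le> q" "q \<le> c"
  shows "V q = V p * cis (u * (q - p))" "Z q - Z p = V p * piece_disp u (q - p)"
proof -
  show "V q = V p * cis (u * (q - p))" using assms(1,4) order_refl by (rule pieceD)
  have "((\<lambda>t. Z t - V p * piece_disp u (t - p)) has_vector_derivative 0) (at t within {p..q})"
    if t: "t \<in> {p..q}" for t
  proof -
    have "(Z has_vector_derivative V p * cis (u * (t - p))) (at t within {p..q})"
      using assms t has_vector_derivative_within_subset[OF deriv[of t], of "{p..q}"]
        pieceD[OF assms(1), of t] by auto
    moreover have "((\<lambda>t. piece_disp u (t - p)) has_vector_derivative cis (u * (t - p))) (at t within {p..q})"
      using assms(2) by (rule has_vector_derivative_piece_disp)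
    ultimately show ?thesis
      by (auto intro!: derivative_eq_intros)
  qed
  note const = this
  obtain d where d: "\<And>t. t \<in> {p..q} \<Longrightarrow> Z t - V p * piece_disp u (t - p) = d"
    by (rule has_vector_derivative_zero_constant[OF convex_real_interval(5) const]) auto
  have "Z q - V p * piece_disp u (q - p) = d" "Z p - V p * piece_disp u (p - p) = d"
    by (rule d, use assms(4) in simp)+
  then show "Z q - Z p = V p * piece_disp u (q - p)" by (auto simp: algebra_simps)
qed

fun follows :: "word \<Rightarrow> real \<Rightarrow> bool" where
  "follows [] p \<longleftrightarrow> True"
| "follows ((u, l) # w) p \<longleftrightarrow> piece u p (p + l) \<and> follows w (p + l)"

lemma follows_displacement:
  assumes "follows w p" "valid w" "b \<le> p" "p + len w \<le> c"
  shows "V (p + len w) = V p * cis (turn w) \<and> Z (p + len w) - Z p = V p * disp w"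
  using assms
proof (induction w arbitrary: p rule: disp.induct)
  case (2 u l w)
  have le: "p + l \<le> c" "0 \<le> l" using 2 len_nonneg[of w] by auto
  have "V (p + l + len w) = V (p + l) * cis (turn w) \<and> Z (p + l + len w) - Z (p + l) = V (p + l) * disp w"
    by (rule "2.IH") (use "2.prems" le in \<open>auto simp: add.assoc\<close>)
  then have IH: "V (p + l + len w) = V (p + l) * cis (turn w)" "Z (p + l + len w) = Z (p + l) + V (p + l) * disp w"
    by (auto simp: algebra_simps)
  have P: "V (p + l) = V p * cis (u * l)" "Z (p + l) = Z p + V p * piece_disp u l"
    using piece_displacement[of u p "p + l"] 2 le by (auto simp: algebra_simps)
  have "V (p + l + len w) = V p * cis (u * l + turn w)"
    unfolding IH P by (simp add: cis_mult mult.assoc)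
  moreover have "Z (p + l + len w) - Z p = V p * (piece_disp u l + cis (u * l) * disp w)"
    unfolding IH P by (simp add: algebra_simps)
  ultimately show ?case by (simp add: add.assoc)
qed auto

lemma follows_shortest:
  assumes "follows w p" "valid w" "b \<le> p" "p + len w \<le> c"
  shows "shortest w"
  unfolding shortest_def
proof (intro allI impI)
  fix w' assume w': "valid w' \<and> cis (turn w') = cis (turn w) \<and> disp w' = disp w"
  have "p + len w - p \<le> len w'"
    using follows_displacement[OF assms] w' len_nonneg[OF assms(2)] assms
    by (intro min) auto
  then show "len w \<le> len w'" by simp
qed

lemma interior_arc:
  assumes "piece u p q" "piece v q r" "piece u' r s" "b \<le> p" "p < q" "q < r" "r < s" "s \<le> c"
    and "u \<in> {-1, 0, 1}" "u' \<in> {-1, 0, 1}" "v = 1 \<or> v = -1" "u \<noteq> v" "u' \<noteq> v"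
  shows "u = - v" "u' = - v" "pi < r - q" "r - q < 2 * pi"
proof -
  have "shortest [(u, q - p), (v, r - q), (u', s - r)]"
    using assms by (intro follows_shortest[of _ p]) auto
  from shortest_interior_arc[OF this] assms
  show "u = - v" "u' = - v" "pi < r - q" "r - q < 2 * pi" by auto
qed

lemma bang_local:
  assumes "b \<le> s" "s < t" "t \<le> c" "t \<le> s + 1"
  shows "bang\<^sup>*\<^sup>* s t"
proof -
  define T where "T = t - s"
  \<comment> \<open>The principal argument can serve as heading: over a length of at most 1 the
    chord from \<open>V s\<close> is at most 1, so the velocity stays within angle pi / 2 of
    \<open>V s\<close> and no branch jump occurs.\<close>
  define \<theta> where "\<theta> x = Arg (V (s + x) / V s)" for x
  define Y where "Y x = (Z (s + x) - Z s) / V s" for x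
  have sx: "s + x \<in> {b..c}" if "x \<in> {0..T}" for x
    using assms that by (auto simp: T_def)
  have Vs: "norm (V s) = 1" using assms by (intro unit) auto
  then have Vs0: "V s \<noteq> 0" by auto
  have nrm: "norm (V (s + x) / V s) = 1" if "x \<in> {0..T}" for x
    using unit[OF sx[OF that]] Vs by (simp add: norm_divide)
  have cis\<theta>: "cis (\<theta> x) = V (s + x) / V s" if "x \<in> {0..T}" for x
    using nrm[OF that] cis_Arg[of "V (s + x) / V s"] unfolding \<theta>_def sgn_eq by (cases "V (s + x) / V s = 0") auto
  have lift: "V (s + x) = V s * cis (\<theta> x)" if "x \<in> {0..T}" for x
    using cis\<theta>[OF that] Vs0 by simp
  have diff: "norm (cis (\<theta> x) - cis (\<theta> y)) \<le> \<bar>x - y\<bar>" if "x \<in> {0..T}" "y \<in> {0..T}" for x y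
    using lip[OF sx[OF that(1)] sx[OF that(2)]] Vs
    unfolding lift[OF that(1)] lift[OF that(2)] by (simp add: norm_mult flip: right_diff_distrib)
  have 0: "0 \<in> {0..T}" using assms by (simp add: T_def)
  have \<theta>0: "\<theta> 0 = 0" using Vs0 by (simp add: \<theta>_def)
  have small: "\<bar>\<theta> x\<bar> \<le> pi / 2" if "x \<in> {0..T}" for x
  proof -
    have "norm (1 - cis (\<theta> x)) \<le> 1"
      using diff[OF 0 that] \<theta>0 that assms by (auto simp: T_def)
    then have "Re (1 - cis (\<theta> x)) \<le> 1" using complex_Re_le_cmod order_trans by blast
    then have "0 \<le> cos (\<theta> x)" by simp
    then have "\<bar>Arg (V (s + x) / V s)\<bar> \<le> pi / 2"
      using cis\<theta>[OF that] unfolding Arg_Re_nonneg by (metis cis.sel(1))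
    then show ?thesis by (simp add: \<theta>_def)
  qed
  interpret heading T \<theta> Y
  proof
    show "0 < T" "T \<le> 1" using assms by (auto simp: T_def)
    show "\<theta> 0 = 0" "Y 0 = 0" using \<theta>0 by (auto simp: Y_def)
    show "\<bar>\<theta> x - \<theta> y\<bar> \<le> \<bar>x - y\<bar>" if "x \<in> {0..T}" "y \<in> {0..T}" for x y
    proof (rule chord_lipschitz[OF _ diff that \<open>T \<le> 1\<close>])
      fix x y assume "x \<in> {0..T}" "y \<in> {0..T}"
      then show "\<bar>\<theta> x - \<theta> y\<bar> \<le> pi" using small[of x] small[of y] by linarith
    qed
    fix x assume x: "x \<in> {0..T}"
    have "(Z has_vector_derivative V (s + x)) (at (s + x) within (\<lambda>x. s + x) ` {0..T})"
      by (rule has_vector_derivative_within_subset[OF deriv[OF sx[OF x]]])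
        (use assms in \<open>auto simp: T_def\<close>)
    moreover have "((\<lambda>x. s + x) has_vector_derivative 1) (at x within {0..T})"
      by (auto intro!: derivative_eq_intros)
    ultimately have "((\<lambda>x. Z (s + x)) has_vector_derivative V (s + x)) (at x within {0..T})"
      using vector_diff_chain_within[of "\<lambda>x. s + x" 1 x "{0..T}" Z] by (auto simp: o_def)
    then show "(Y has_vector_derivative cis (\<theta> x)) (at x within {0..T})"
      unfolding cis\<theta>[OF x] Y_def by (auto intro!: derivative_eq_intros)
  qed
  have "T \<le> len w" if "valid w" "turn w = \<theta> T" "disp w = Y T" for w
    using min[of s t w] assms that lift[of T] Vs0 by (auto simp: T_def Y_def)
  from CSC[OF this] obtain p q u v where pq: "0 \<le> p" "p \<le> q" "q \<le> T" "u \<in> {-1, 1}" "v \<in> {-1, 1}"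
    and \<theta>: "\<And>x. x \<in> {0..p} \<Longrightarrow> \<theta> x = u * x" "\<And>x. x \<in> {p..q} \<Longrightarrow> \<theta> x = u * p"
      "\<And>x. x \<in> {q..T} \<Longrightarrow> \<theta> x = u * p + v * (x - q)"
    by blast
  have piece: "piece d (s + x) (s + y)"
    if "0 \<le> x" "x \<le> y" "y \<le> T" and \<theta>: "\<And>r. r \<in> {x..y} \<Longrightarrow> \<theta> r = e + d * (r - x)" for d e x y
    unfolding piece_def
  proof
    fix r assume "r \<in> {s + x..s + y}"
    then show "V r = V (s + x) * cis (d * (r - (s + x)))"
      using lift[of "r - s"] lift[of x] \<theta>[of "r - s"] \<theta>[of x] that
      by (auto simp: cis_mult algebra_simps)
  qed
  have "bang\<^sup>*\<^sup>* (s + x) (s + y)"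
    if "d \<in> {-1, 0, 1}" "0 \<le> x" "x \<le> y" "y \<le> T" "\<And>r. r \<in> {x..y} \<Longrightarrow> \<theta> r = e + d * (r - x)" for d e x y
  proof (cases "x = y")
    case False
    then have "bang (s + x) (s + y)"
      using that piece[of x y e d] assms unfolding bang_def T_def by auto
    then show ?thesis by blast
  qed simp
  from this[of u 0 p 0] this[of 0 p q "u * p"] this[of v q T "u * p"]
  have "bang\<^sup>*\<^sup>* (s + 0) (s + p)" "bang\<^sup>*\<^sup>* (s + p) (s + q)" "bang\<^sup>*\<^sup>* (s + q) (s + T)"
    using pq \<theta> by auto
  then have "bang\<^sup>*\<^sup>* (s + 0) (s + T)" by (meson rtranclp_trans)
  then show ?thesis by (simp add: T_def)
qed

lemma bang_global: "bang\<^sup>*\<^sup>* b c"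
proof -
  have main: "bang\<^sup>*\<^sup>* b t" if "b \<le> t" "t \<le> c" "t \<le> b + real n" for n t
    using that
  proof (induction n arbitrary: t)
    case (Suc n)
    show ?case
    proof (cases "t \<le> b + real n")
      case False
      then have "bang\<^sup>*\<^sup>* b (b + real n)" using Suc by auto
      moreover have "bang\<^sup>*\<^sup>* (b + real n) t" using Suc False by (intro bang_local) auto
      ultimately show ?thesis by (rule rtranclp_trans)
    qed (use Suc in auto)
  qed auto
  obtain n where "c - b \<le> real n" using real_arch_simple by blast
  then show ?thesis using main[of c n] bc by simp
qed

lemma alternating_pieces:
  obtains m s u where "0 < m" "m \<le> 3" "s 0 = b" "s m = c"
    and "\<And>j. j < m \<Longrightarrow> s j < s (Suc j) \<and> u j \<in> {-1, 0, 1} \<and> piece (u j) (s j) (s (Suc j))"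
    and "\<And>j. Suc j < m \<Longrightarrow> u j \<noteq> u (Suc j)"
    and "m = 3 \<Longrightarrow> u 1 \<noteq> 0 \<Longrightarrow> u 0 = - u 1 \<and> u 2 = - u 1"
proof -
  \<comment> \<open>Minimality of the number of pieces makes adjacent curvatures different.\<close>
  define m where "m = (LEAST m. (bang ^^ m) b c)"
  have "\<exists>m. (bang ^^ m) b c" using bang_global by (simp add: rtranclp_power)
  then have m: "(bang ^^ m) b c" unfolding m_def by (rule LeastI_ex)
  have least: "m \<le> n" if "(bang ^^ n) b c" for n unfolding m_def using that by (rule Least_le)
  obtain s where s: "s 0 = b" "s m = c" "\<And>j. j < m \<Longrightarrow> bang (s j) (s (Suc j))"
    using m unfolding relpowp_fun_conv by auto
  obtain u where u: "\<And>j. j < m \<Longrightarrow> u j \<in> {-1, 0, 1} \<and> piece (u j) (s j) (s (Suc j))"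
    using s(3) unfolding bang_def by metis
  have between: "b \<le> s j" "s j < s (Suc j)" "s (Suc j) \<le> c" if "j < m" for j
    using s(3)[OF that] by (auto simp: bang_def)
  have distinct: "u j \<noteq> u (Suc j)" if j: "Suc j < m" for j
  proof
    assume eq: "u j = u (Suc j)"
    have lt: "j < m" using j by simp
    have "piece (u j) (s j) (s (Suc j))" "piece (u j) (s (Suc j)) (s (Suc (Suc j)))"
      using u[OF lt] u[OF j] eq by simp_all
    then have "piece (u j) (s j) (s (Suc (Suc j)))"
      by (rule piece_trans) (use between[OF lt] between[OF j] in simp_all)
    then have skip: "bang (s j) (s (Suc (Suc j)))"
      unfolding bang_def using u[OF lt] between[OF lt] between[OF j]
      by (intro conjI bexI[of _ "u j"]) linarith+
    \<comment> \<open>The breakpoints without \<open>s (Suc j)\<close>; the merged piece would give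
      a concatenation with m - 1 pieces.\<close>
    define s' where "s' i = (if i \<le> j then s i else s (Suc i))" for i
    have "bang (s' i) (s' (Suc i))" if "i < m - 1" for i
      using that s(3)[of i] s(3)[of "Suc i"] skip
      by (cases i j rule: linorder_cases) (simp_all add: s'_def)
    then have "(bang ^^ (m - 1)) b c"
      unfolding relpowp_fun_conv using s j by (intro exI[of _ s']) (auto simp: s'_def)
    then show False using least j by fastforce
  qed
  have arc: "u j = - u (Suc j)" "u (Suc (Suc j)) = - u (Suc j)"
      "pi < s (Suc (Suc j)) - s (Suc j)" "s (Suc (Suc j)) - s (Suc j) < 2 * pi"
    if "Suc (Suc j) < m" "u (Suc j) \<noteq> 0" for j
  proof -
    have lt: "j < m" "Suc j < m" using that by simp_all
    have v: "u (Suc j) = 1 \<or> u (Suc j) = -1" using u[OF lt(2)] that(2) by blast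
    note * = interior_arc[OF conjunct2[OF u[OF lt(1)]] conjunct2[OF u[OF lt(2)]] conjunct2[OF u[OF that(1)]]
      between(1,2)[OF lt(1)] between(2)[OF lt(2)] between(2,3)[OF that(1)]
      conjunct1[OF u[OF lt(1)]] conjunct1[OF u[OF that(1)]] v distinct[OF lt(2)] distinct[OF that(1), symmetric]]
    show "u j = - u (Suc j)" "u (Suc (Suc j)) = - u (Suc j)"
      "pi < s (Suc (Suc j)) - s (Suc j)" "s (Suc (Suc j)) - s (Suc j) < 2 * pi"
      by (fact *)+
  qed
  \<comment> \<open>With four pieces, a straight piece 1 would be the neighbour of the interior arc
    2. Otherwise pieces 1 and 2 are both interior arcs, hence longer than pi, and the first four
    pieces form a CCCC.\<close>
  have m3: "m \<le> 3"
  proof (rule ccontr)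
    assume "\<not> m \<le> 3"
    then have m4: "4 \<le> m" by simp
    show False
    proof (cases "u 1 = 0")
      case True
      have "u 1 \<noteq> u 2" using distinct[of 1] m4 by (simp add: numeral_2_eq_2)
      then show False using arc(1)[of 1] m4 True by (simp add: numeral_2_eq_2)
    next
      case False
      have a: "u 0 = - u 1" "u 2 = - u 1" "pi < s 2 - s 1" "s 2 - s 1 < 2 * pi"
        using arc[of 0] False m4 by (simp_all add: numeral_2_eq_2)
      have a': "u 3 = u 1" "pi < s 3 - s 2" "s 3 - s 2 < 2 * pi"
        using arc(2,3,4)[of 1] a(2) False m4 by (simp_all add: numeral_2_eq_2 numeral_3_eq_3)
      have P: "piece (- u 1) (s 0) (s 1)" "piece (u 1) (s 1) (s 2)" "piece (- u 1) (s 2) (s 3)" "piece (u 1) (s 3) (s 4)"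
        using u[of 0] u[of 1] u[of 2] u[of 3] m4 unfolding a a' by (simp_all add: eval_nat_numeral)
      have B: "b \<le> s 0" "s 0 < s 1" "s 1 < s 2" "s 2 < s 3" "s 3 < s 4" "s 4 \<le> c"
        using between[of 0] between[of 1] between[of 2] between[of 3] m4 by (simp_all add: eval_nat_numeral)
      have u1: "u 1 = 1 \<or> u 1 = -1" using u[of 1] m4 False by auto
      have sh: "shortest [(- u 1, s 1 - s 0), (u 1, s 2 - s 1), (- u 1, s 3 - s 2), (u 1, s 4 - s 3)]"
      proof (rule follows_shortest[of _ "s 0"])
        show "follows [(- u 1, s 1 - s 0), (u 1, s 2 - s 1), (- u 1, s 3 - s 2), (u 1, s 4 - s 3)] (s 0)"
          using P by simp
        show "valid [(- u 1, s 1 - s 0), (u 1, s 2 - s 1), (- u 1, s 3 - s 2), (u 1, s 4 - s 3)]"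
          using u1 B(2-5) by (elim disjE) simp_all
      qed (use B in simp_all)
      have "shortest [(-1, s 1 - s 0), (1, s 2 - s 1), (-1, s 3 - s 2), (1, s 4 - s 3)]"
        using u1
      proof
        assume "u 1 = 1"
        then show ?thesis using sh by simp
      next
        assume "u 1 = -1"
        then show ?thesis using shortest_mirror[OF sh] by simp
      qed
      moreover have "\<not> shortest [(-1, s 1 - s 0), (1, s 2 - s 1), (-1, s 3 - s 2), (1, s 4 - s 3)]"
        using B a a' by (intro not_shortest_CCCC) simp_all
      ultimately show False by simp
    qed
  qed
  have "0 < m" using m bc by (cases m) auto
  then show thesis
  proof (rule that[OF _ m3 s(1,2)])
    show "s j < s (Suc j) \<and> u j \<in> {-1, 0, 1} \<and> piece (u j) (s j) (s (Suc j))" if "j < m" for j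
      using u[OF that] between(2)[OF that] by blast
    show "u j \<noteq> u (Suc j)" if "Suc j < m" for j using that by (rule distinct)
    show "u 0 = - u 1 \<and> u 2 = - u 1" if "m = 3" "u 1 \<noteq> 0"
      using arc(1,2)[of 0] that by (simp add: numeral_2_eq_2)
  qed
qed

end

section \<open>Concatenation of curves\<close>

lemma has_vector_derivative_shift:
  assumes "(f has_vector_derivative D) (at t within {x..y})"
  shows "((\<lambda>t. f (t - d)) has_vector_derivative D) (at (t + d) within {x + d..y + d})"
proof -
  have "(\<lambda>t. t - d) ` {x + d..y + d} = {x..y}"
    by (auto simp: image_iff intro!: bexI[of _ "_ + d"])
  moreover have "((\<lambda>t. t - d) has_vector_derivative 1) (at (t + d) within {x + d..y + d})"
    using has_vector_derivative_diff[OF has_vector_derivative_id has_vector_derivative_const] by simp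
  ultimately show ?thesis
    using vector_diff_chain_within[of "\<lambda>t. t - d" 1 "t + d" "{x + d..y + d}" f D] assms
    by (auto simp: o_def)
qed

section \<open>One-sided C1 and C2 calculus on closed intervals\<close>

lemma C1_on_derivative:
  assumes "C1_on x y f" "t \<in> {x..y}"
  shows "(f has_vector_derivative velocity x y f t) (at t within {x..y})"
  using assms by (simp add: C1_on_def velocity_def vector_derivative_works)

lemma C1_onI:
  fixes f :: "real \<Rightarrow> 'a::euclidean_space"
  assumes "x < y" and g: "\<And>t. t \<in> {x..y} \<Longrightarrow> (f has_vector_derivative g t) (at t within {x..y})"
    and cont: "continuous_on {x..y} g"
  shows "C1_on x y f" and "\<And>t. t \<in> {x..y} \<Longrightarrow> velocity x y f t = g t"
proof -
  show *: "velocity x y f t = g t" if "t \<in> {x..y}" for t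
    unfolding velocity_def using vector_derivative_within_closed_interval[OF assms(1) that g[OF that]] .
  have "continuous_on {x..y} (velocity x y f)"
    using continuous_on_cong[THEN iffD2, OF refl * cont] .
  then show "C1_on x y f"
    unfolding C1_on_def using g by (blast intro: differentiableI_vector)
qed

text \<open>\<open>velocity\<close> depends on the interval on which it is taken. Explicit
  derivatives g and h avoid this and pass to subintervals and shifts.\<close>

lemma C2_onE:
  fixes f :: "real \<Rightarrow> 'a::euclidean_space"
  assumes "C2_on x y f"
  obtains g h where "\<And>t. t \<in> {x..y} \<Longrightarrow> (f has_vector_derivative g t) (at t within {x..y})"
    and "\<And>t. t \<in> {x..y} \<Longrightarrow> (g has_vector_derivative h t) (at t within {x..y})"
    and "continuous_on {x..y} h"
proof
  show "(f has_vector_derivative velocity x y f t) (at t within {x..y})"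
      "(velocity x y f has_vector_derivative velocity x y (velocity x y f) t) (at t within {x..y})"
    if "t \<in> {x..y}" for t
    using assms that by (simp_all add: C2_on_def C1_on_derivative)
  show "continuous_on {x..y} (velocity x y (velocity x y f))"
    using assms by (simp add: C2_on_def C1_on_def)
qed

lemma C2_onI:
  fixes f :: "real \<Rightarrow> 'a::euclidean_space"
  assumes "x < y"
    and f: "\<And>t. t \<in> {x..y} \<Longrightarrow> (f has_vector_derivative g t) (at t within {x..y})"
    and g: "\<And>t. t \<in> {x..y} \<Longrightarrow> (g has_vector_derivative h t) (at t within {x..y})"
    and h: "continuous_on {x..y} h"
  shows "C2_on x y f"
proof -
  have "continuous_on {x..y} g"
    unfolding continuous_on_eq_continuous_within using g by (blast intro: has_vector_derivative_continuous)
  note f' = C1_onI[OF assms(1) f this]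
  have "(velocity x y f has_vector_derivative h t) (at t within {x..y})" if "t \<in> {x..y}" for t
    by (rule has_vector_derivative_transform[OF that f'(2) g[OF that]])
  then show ?thesis
    using f'(1) C1_onI(1)[OF assms(1) _ h] by (simp add: C2_on_def)
qed

lemma C2_on_subinterval:
  fixes f :: "real \<Rightarrow> 'a::euclidean_space"
  assumes "C2_on x y f" "x \<le> x'" "x' < y'" "y' \<le> y"
  shows "C2_on x' y' f"
  using assms(1)
proof (rule C2_onE)
  fix g h
  assume gh: "\<And>t. t \<in> {x..y} \<Longrightarrow> (f has_vector_derivative g t) (at t within {x..y})"
    "\<And>t. t \<in> {x..y} \<Longrightarrow> (g has_vector_derivative h t) (at t within {x..y})" "continuous_on {x..y} h"
  have sub: "{x'..y'} \<subseteq> {x..y}" using assms by auto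
  show ?thesis
  proof (rule C2_onI[OF assms(3)])
    fix t assume t: "t \<in> {x'..y'}"
    show "(f has_vector_derivative g t) (at t within {x'..y'})"
      by (rule has_vector_derivative_within_subset[OF gh(1)[OF subsetD[OF sub t]] sub])
    show "(g has_vector_derivative h t) (at t within {x'..y'})"
      by (rule has_vector_derivative_within_subset[OF gh(2)[OF subsetD[OF sub t]] sub])
  qed (rule continuous_on_subset[OF gh(3) sub])
qed

lemma C2_on_shift:
  fixes f :: "real \<Rightarrow> 'a::euclidean_space"
  assumes "C2_on x y f" "x < y"
  shows "C2_on (x + d) (y + d) (\<lambda>t. f (t - d))"
  using assms(1)
proof (rule C2_onE)
  fix g h
  assume gh: "\<And>t. t \<in> {x..y} \<Longrightarrow> (f has_vector_derivative g t) (at t within {x..y})"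
    "\<And>t. t \<in> {x..y} \<Longrightarrow> (g has_vector_derivative h t) (at t within {x..y})" "continuous_on {x..y} h"
  show ?thesis
  proof (rule C2_onI)
    show "x + d < y + d" using assms(2) by simp
    show "continuous_on {x + d..y + d} (\<lambda>t. h (t - d))"
      by (rule continuous_on_compose2[OF gh(3)]) (auto intro!: continuous_intros)
    fix t assume "t \<in> {x + d..y + d}"
    then have t: "t - d \<in> {x..y}" by auto
    show "((\<lambda>t. f (t - d)) has_vector_derivative g (t - d)) (at t within {x + d..y + d})"
      using has_vector_derivative_shift[OF gh(1)[OF t], of d] by simp
    show "((\<lambda>t. g (t - d)) has_vector_derivative h (t - d)) (at t within {x + d..y + d})"
      using has_vector_derivative_shift[OF gh(2)[OF t], of d] by simp
  qed
qed

lemma C2_on_cong: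
  fixes f :: "real \<Rightarrow> 'a::euclidean_space"
  assumes "C2_on x y f" "x < y" and eq: "\<And>t. t \<in> {x..y} \<Longrightarrow> g t = f t"
  shows "C2_on x y g"
  using assms(1)
proof (rule C2_onE)
  fix f' h
  assume h: "\<And>t. t \<in> {x..y} \<Longrightarrow> (f has_vector_derivative f' t) (at t within {x..y})"
    "\<And>t. t \<in> {x..y} \<Longrightarrow> (f' has_vector_derivative h t) (at t within {x..y})" "continuous_on {x..y} h"
  show ?thesis
    by (rule C2_onI[OF assms(2) has_vector_derivative_transform[OF _ eq h(1)] h(2,3)])
qed

text \<open>One C2 piece as a relation between its ends: \<open>piecewise_C2_on\<close> becomes a
  reflexive transitive closure, so concatenation is transitivity and no breakpoint sequences need to
  be glued.\<close>

definition C2_step :: "(real \<Rightarrow> 'a::real_normed_vector) \<Rightarrow> real \<Rightarrow> real \<Rightarrow> bool" where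
  "C2_step f x y \<longleftrightarrow> x < y \<and> C2_on x y f"

lemma piecewise_C2_on_iff: "piecewise_C2_on b c f \<longleftrightarrow> (C2_step f)\<^sup>*\<^sup>* b c"
  unfolding piecewise_C2_on_def rtranclp_power relpowp_fun_conv C2_step_def by auto

lemma piecewise_C2_on_le: "piecewise_C2_on b c f \<Longrightarrow> b \<le> c"
  unfolding piecewise_C2_on_iff by (induction rule: rtranclp_induct) (auto simp: C2_step_def)

lemma piecewise_C2_on_trans:
  "piecewise_C2_on b m f \<Longrightarrow> piecewise_C2_on m c f \<Longrightarrow> piecewise_C2_on b c f"
  unfolding piecewise_C2_on_iff by (rule rtranclp_trans)

lemma piecewise_C2_on_single: "b \<le> c \<Longrightarrow> (b < c \<Longrightarrow> C2_on b c f) \<Longrightarrow> piecewise_C2_on b c f"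
  unfolding piecewise_C2_on_iff by (cases "b = c") (auto simp: C2_step_def)

lemma piecewise_C2_on_induct [consumes 1, case_names refl step]:
  assumes "piecewise_C2_on b c f"
    and "P b"
    and "\<And>x y. b \<le> x \<Longrightarrow> piecewise_C2_on b x f \<Longrightarrow> x < y \<Longrightarrow> C2_on x y f \<Longrightarrow> P x \<Longrightarrow> P y"
  shows "P c"
  using assms(1)[unfolded piecewise_C2_on_iff]
proof (induction rule: rtranclp_induct)
  case (step y z)
  then show ?case
    using assms(3)[of y z] piecewise_C2_on_le[of b y f] by (auto simp: piecewise_C2_on_iff C2_step_def)
qed (rule assms(2))

lemma piecewise_C2_on_subinterval:
  fixes f :: "real \<Rightarrow> 'a::euclidean_space"
  assumes "piecewise_C2_on b c f" "b \<le> b'" "b' \<le> c'" "c' \<le> c"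
  shows "piecewise_C2_on b' c' f"
proof -
  from assms(1) have "\<forall>b' c'. b \<le> b' \<longrightarrow> b' \<le> c' \<longrightarrow> c' \<le> c \<longrightarrow> piecewise_C2_on b' c' f"
  proof (induction rule: piecewise_C2_on_induct)
    case refl
    then show ?case by (auto intro!: piecewise_C2_on_single)
  next
    case (step x y)
    show ?case
    proof (intro allI impI)
      fix b' c' assume b'c': "b \<le> b'" "b' \<le> c'" "c' \<le> y"
      have last: "piecewise_C2_on p c' f" if "x \<le> p" "p \<le> c'" for p
        by (rule piecewise_C2_on_single[OF that(2) C2_on_subinterval[OF step(4) that(1)]])
          (use b'c' in auto)
      consider "c' \<le> x" | "b' \<le> x" "x \<le> c'" | "x \<le> b'" using b'c' by linarith
      then show "piecewise_C2_on b' c' f"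
      proof cases
        case 1
        then show ?thesis using step(5) b'c' by blast
      next
        case 2
        then have "piecewise_C2_on b' x f" using step(5) b'c' by blast
        then show ?thesis using last[of x] 2 by (blast intro: piecewise_C2_on_trans)
      next
        case 3
        then show ?thesis using last b'c' by blast
      qed
    qed
  qed
  then show ?thesis using assms by blast
qed

lemma piecewise_C2_on_shift:
  fixes f :: "real \<Rightarrow> 'a::euclidean_space"
  assumes "piecewise_C2_on b c f"
  shows "piecewise_C2_on (b + d) (c + d) (\<lambda>t. f (t - d))"
  using assms
proof (induction rule: piecewise_C2_on_induct)
  case (step x y)
  then show ?case
    by (intro piecewise_C2_on_trans[OF step(5)] piecewise_C2_on_single C2_on_shift[OF step(4,3)]) auto
qed (auto intro!: piecewise_C2_on_single)

lemma piecewise_C2_on_cong: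
  fixes f :: "real \<Rightarrow> 'a::euclidean_space"
  assumes "piecewise_C2_on b c f" and "\<And>t. t \<in> {b..c} \<Longrightarrow> g t = f t"
  shows "piecewise_C2_on b c g"
proof -
  from assms(1) have "(\<forall>t\<in>{b..c}. g t = f t) \<longrightarrow> piecewise_C2_on b c g"
  proof (induction rule: piecewise_C2_on_induct)
    case (step x y)
    show ?case
    proof
      assume eq: "\<forall>t\<in>{b..y}. g t = f t"
      then have "piecewise_C2_on b x g" using step by auto
      moreover have "piecewise_C2_on x y g"
        by (rule piecewise_C2_on_single, use step(3) in simp, rule C2_on_cong[OF step(4,3)])
          (use step(1) eq in auto)
      ultimately show "piecewise_C2_on b y g" by (rule piecewise_C2_on_trans)
    qed
  qed (auto intro!: piecewise_C2_on_single)
  then show ?thesis using assms(2) by blast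
qed

text \<open>Admissibility without exceptional null sets: the velocity is defined everywhere, and the bound on
  the acceleration becomes a Lipschitz condition, which is inherited by concatenations.\<close>

definition curve :: "real \<Rightarrow> real \<Rightarrow> real \<Rightarrow> (real \<Rightarrow> real^2) \<Rightarrow> (real \<Rightarrow> real^2) \<Rightarrow> bool" where
  "curve a b c z v \<longleftrightarrow>
     (\<forall>t\<in>{b..c}. (z has_vector_derivative v t) (at t within {b..c})) \<and>
     (\<forall>s\<in>{b..c}. \<forall>t\<in>{b..c}. norm (v s - v t) \<le> a * \<bar>s - t\<bar>) \<and>
     (\<forall>t\<in>{b..c}. norm (v t) = 1) \<and> piecewise_C2_on b c z"

lemma curveD:
  assumes "curve a b c z v"
  shows "t \<in> {b..c} \<Longrightarrow> (z has_vector_derivative v t) (at t within {b..c})"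
    and "s \<in> {b..c} \<Longrightarrow> t \<in> {b..c} \<Longrightarrow> norm (v s - v t) \<le> a * \<bar>s - t\<bar>"
    and "t \<in> {b..c} \<Longrightarrow> norm (v t) = 1" and "piecewise_C2_on b c z"
  using assms by (auto simp: curve_def)

lemma curve_subinterval:
  assumes "curve a b c z v" "b \<le> b'" "b' \<le> c'" "c' \<le> c"
  shows "curve a b' c' z v"
proof -
  have "{b'..c'} \<subseteq> {b..c}" using assms by auto
  then show ?thesis
    using assms unfolding curve_def
    by (blast intro: has_vector_derivative_within_subset piecewise_C2_on_subinterval)
qed

lemma curve_shift:
  assumes "curve a b c z v"
  shows "curve a (b + d) (c + d) (\<lambda>t. z (t - d)) (\<lambda>t. v (t - d))"
  unfolding curve_def
proof (intro conjI ballI)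
  fix t assume t: "t \<in> {b + d..c + d}"
  then show "norm (v (t - d)) = 1" using assms by (simp add: curve_def)
  have "(z has_vector_derivative v (t - d)) (at (t - d) within {b..c})"
    using assms t by (auto simp: curve_def)
  from has_vector_derivative_shift[OF this, of d]
  show "((\<lambda>t. z (t - d)) has_vector_derivative v (t - d)) (at t within {b + d..c + d})" by simp
  fix s assume "s \<in> {b + d..c + d}"
  then have "norm (v (t - d) - v (s - d)) \<le> a * \<bar>t - d - (s - d)\<bar>"
    using t by (intro curveD(2)[OF assms]) auto
  then show "norm (v (t - d) - v (s - d)) \<le> a * \<bar>t - s\<bar>" by simp
next
  show "piecewise_C2_on (b + d) (c + d) (\<lambda>t. z (t - d))"
    using assms by (intro piecewise_C2_on_shift) (simp add: curve_def)
qed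

lemma lipschitz_join:
  fixes v :: "real \<Rightarrow> 'a::real_normed_vector"
  assumes l: "\<And>s t. s \<in> {b..m} \<Longrightarrow> t \<in> {b..m} \<Longrightarrow> norm (v s - v t) \<le> a * \<bar>s - t\<bar>"
    and r: "\<And>s t. s \<in> {m..c} \<Longrightarrow> t \<in> {m..c} \<Longrightarrow> norm (v s - v t) \<le> a * \<bar>s - t\<bar>"
    and st: "s \<in> {b..c}" "t \<in> {b..c}"
  shows "norm (v s - v t) \<le> a * \<bar>s - t\<bar>"
proof -
  have main: "norm (v x - v y) \<le> a * \<bar>x - y\<bar>" if "x \<in> {b..c}" "y \<in> {b..c}" "x \<le> y" for x y
  proof -
    consider "y \<le> m" | "m \<le> x" | "x \<le> m" "m \<le> y" by linarith
    then show ?thesis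
    proof cases
      case 3
      have "norm (v x - v y) \<le> norm (v x - v m) + norm (v m - v y)"
        using norm_triangle_ineq[of "v x - v m" "v m - v y"] by simp
      also have "\<dots> \<le> a * \<bar>x - m\<bar> + a * \<bar>m - y\<bar>"
        using l[of x m] r[of m y] that 3 by (intro add_mono) auto
      also have "\<dots> = a * \<bar>x - y\<bar>" using 3 by (simp add: algebra_simps)
      finally show ?thesis .
    qed (use l[of x y] r[of x y] that in auto)
  qed
  show ?thesis
  proof (cases "s \<le> t")
    case False
    then show ?thesis using main[of t s] st by (simp add: norm_minus_commute abs_minus_commute)
  qed (use main st in auto)
qed

text \<open>Equal positions and velocities at m make the join C1. The second derivative may jump
  there, which the Lipschitz form of the curvature bound tolerates.\<close>

lemma curve_join:
  assumes 1: "curve a b m z1 v1" and 2: "curve a m c z2 v2"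
    and le: "b \<le> m" "m \<le> c" and eq: "z1 m = z2 m" "v1 m = v2 m"
  shows "curve a b c (\<lambda>t. if t \<le> m then z1 t else z2 t) (\<lambda>t. if t \<le> m then v1 t else v2 t)"
    (is "curve a b c ?z ?v")
  unfolding curve_def
proof (intro conjI ballI)
  have z1: "?z t = z1 t" "?v t = v1 t" if "t \<in> {b..m}" for t using that by auto
  have z2: "?z t = z2 t" "?v t = v2 t" if "t \<in> {m..c}" for t using that eq by auto
  fix t assume t: "t \<in> {b..c}"
  show "norm (?v t) = 1" using t 1 2 by (auto simp: curve_def)
  have ST: "{b..m} \<union> {m..c} = {b..c}" "{b..m} \<inter> {m..c} = {m}" using le by auto
  have "((\<lambda>t. if t \<in> {b..m} then z1 t else z2 t) has_vector_derivative
      (if t \<in> {b..m} then v1 t else v2 t)) (at t within {b..c})"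
  proof (rule has_vector_derivative_If_within_closures)
    show "t \<in> {b..m} \<union> {m..c}" "{b..c} = {b..m} \<union> {m..c}" using t ST by auto
    have "closure {b..m} \<inter> closure {m..c} = {m}" using ST by simp
    then have *: "{b..m} \<union> (closure {b..m} \<inter> closure {m..c}) = {b..m}"
      "{m..c} \<union> (closure {b..m} \<inter> closure {m..c}) = {m..c}" using le by auto
    show "(z1 has_vector_derivative v1 t) (at t within {b..m} \<union> (closure {b..m} \<inter> closure {m..c}))"
      if "t \<in> {b..m} \<union> (closure {b..m} \<inter> closure {m..c})"
      using that 1 unfolding * by (simp add: curve_def)
    show "(z2 has_vector_derivative v2 t) (at t within {m..c} \<union> (closure {b..m} \<inter> closure {m..c}))"
      if "t \<in> {m..c} \<union> (closure {b..m} \<inter> closure {m..c})"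
      using that 2 unfolding * by (simp add: curve_def)
    show "z1 t = z2 t" "v1 t = v2 t" if "t \<in> closure {b..m}" "t \<in> closure {m..c}"
    proof -
      have "t = m" using that by simp
      then show "z1 t = z2 t" "v1 t = v2 t" using eq by simp_all
    qed
  qed
  then have "(?z has_vector_derivative (if t \<in> {b..m} then v1 t else v2 t)) (at t within {b..c})"
    by (rule has_vector_derivative_transform[OF t, rotated]) auto
  moreover have "(if t \<in> {b..m} then v1 t else v2 t) = ?v t" using t by auto
  ultimately show "(?z has_vector_derivative ?v t) (at t within {b..c})" by (simp only:)
  fix s assume s: "s \<in> {b..c}"
  show "norm (?v t - ?v s) \<le> a * \<bar>t - s\<bar>"
  proof (rule lipschitz_join[OF _ _ t s])
    show "norm (?v s - ?v t) \<le> a * \<bar>s - t\<bar>" if "s \<in> {b..m}" "t \<in> {b..m}" for s t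
      unfolding z1(2)[OF that(1)] z1(2)[OF that(2)] using that by (rule curveD(2)[OF 1])
    show "norm (?v s - ?v t) \<le> a * \<bar>s - t\<bar>" if "s \<in> {m..c}" "t \<in> {m..c}" for s t
      unfolding z2(2)[OF that(1)] z2(2)[OF that(2)] using that by (rule curveD(2)[OF 2])
  qed
next
  have "piecewise_C2_on b m ?z"
    by (rule piecewise_C2_on_cong[of _ _ z1]) (use 1 in \<open>auto simp: curve_def\<close>)
  moreover have "piecewise_C2_on m c ?z"
    by (rule piecewise_C2_on_cong[of _ _ z2]) (use 2 eq in \<open>auto simp: curve_def\<close>)
  ultimately show "piecewise_C2_on b c ?z" by (rule piecewise_C2_on_trans)
qed

section \<open>Bounds almost everywhere versus Lipschitz bounds\<close>

lemma dense_le: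
  fixes f :: "real \<Rightarrow> real"
  assumes "b < c" and cont: "continuous_on {b..c} f"
    and dense: "\<And>x y. b \<le> x \<Longrightarrow> x < y \<Longrightarrow> y \<le> c \<Longrightarrow> \<exists>s\<in>{x<..<y}. f s \<le> k"
    and t: "t \<in> {b..c}"
  shows "f t \<le> k"
proof (rule ccontr)
  assume "\<not> f t \<le> k"
  then obtain d where d: "0 < d" "\<And>s. s \<in> {b..c} \<Longrightarrow> dist s t < d \<Longrightarrow> dist (f s) (f t) < f t - k"
    using cont t unfolding continuous_on_iff by (metis diff_gt_0_iff_gt not_le)
  define x y where "x = max b (t - d / 2)" and "y = min c (t + d / 2)"
  have "b \<le> x" "x < y" "y \<le> c" using t d(1) assms(1) by (auto simp: x_def y_def)
  from dense[OF this] obtain s where s: "s \<in> {x<..<y}" "f s \<le> k" by blast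
  then have "s \<in> {b..c}" "dist s t < d" using d(1) by (auto simp: x_def y_def dist_real_def)
  from d(2)[OF this] s(2) show False by (auto simp: dist_real_def)
qed

text \<open>A nonempty open interval is not a null set, so the property holds somewhere in it;
  \<open>dense_le\<close> then extends such a bound to every point by continuity.\<close>

lemma AE_interval_dense:
  assumes "AE x in lborel. x \<in> {b..c} \<longrightarrow> P x" "b \<le> x" "x < y" "y \<le> (c::real)"
  shows "\<exists>s\<in>{x<..<y}. P s"
proof (rule ccontr)
  assume no: "\<not> ?thesis"
  from assms(1) have "AE s in lborel. s \<notin> {x<..<y}"
    by eventually_elim (use no assms in auto)
  then have "{x<..<y} \<in> null_sets lborel"
    by (subst AE_iff_null_sets) auto
  then show False using assms by auto
qed

lemma norm_vector_derivative_le: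
  fixes v :: "real \<Rightarrow> 'a::real_normed_vector"
  assumes D: "(v has_vector_derivative D) (at x)" and x: "b < x" "x < c"
    and lip: "\<And>t. t \<in> {b..c} \<Longrightarrow> norm (v t - v x) \<le> a * \<bar>t - x\<bar>"
  shows "norm D \<le> a"
proof -
  have "((\<lambda>y. norm (v y - v x - (y - x) *\<^sub>R D) / norm (y - x)) \<longlongrightarrow> 0) (at x)"
    using D unfolding has_vector_derivative_def has_derivative_iff_norm by simp
  then have "((\<lambda>y. norm (v y - v x - (y - x) *\<^sub>R D) / norm (y - x) + a) \<longlongrightarrow> 0 + a) (at x)"
    by (intro tendsto_intros)
  moreover have "eventually (\<lambda>y. norm D \<le> norm (v y - v x - (y - x) *\<^sub>R D) / norm (y - x) + a) (at x)"
  proof -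
    have "eventually (\<lambda>y. y \<in> {b<..<c}) (at x)"
      using x by (intro eventually_at_in_open') auto
    moreover have "eventually (\<lambda>y. y \<noteq> x) (at x)" by (simp add: eventually_at_filter)
    ultimately show ?thesis
    proof eventually_elim
      case (elim y)
      have "\<bar>y - x\<bar> * norm D = norm ((v y - v x) - (v y - v x - (y - x) *\<^sub>R D))" by simp
      also have "\<dots> \<le> norm (v y - v x) + norm (v y - v x - (y - x) *\<^sub>R D)" by (rule norm_triangle_ineq4)
      also have "\<dots> \<le> a * \<bar>y - x\<bar> + norm (v y - v x - (y - x) *\<^sub>R D)"
        using lip[of y] elim by auto
      finally show ?case using elim by (simp add: field_simps)
    qed
  qed
  ultimately show ?thesis
    using tendsto_lowerbound[of _ "0 + a" "at x" "norm D"] by simp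
qed

lemma has_vector_derivative_unique_Icc:
  fixes f :: "real \<Rightarrow> 'a::euclidean_space"
  assumes "x < y" "t \<in> {x..y}" "(f has_vector_derivative D) (at t within {x..y})"
    "(f has_vector_derivative D') (at t within {x..y})"
  shows "D = D'"
  using vector_derivative_within_closed_interval[OF assms(1,2,3)]
    vector_derivative_within_closed_interval[OF assms(1,2,4)] by simp

text \<open>Carries the second derivative of a piece over to a velocity given in advance, typically
  that of the whole curve. One-sided derivatives are unique, so the two velocities agree on the
  piece.\<close>

lemma C2_on_velocity:
  fixes f :: "real \<Rightarrow> 'a::euclidean_space"
  assumes "C2_on x y f" "x < y"
    and v: "\<And>t. t \<in> {x..y} \<Longrightarrow> (f has_vector_derivative v t) (at t within {x..y})"
  obtains h where "\<And>t. t \<in> {x..y} \<Longrightarrow> (v has_vector_derivative h t) (at t within {x..y})"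
    "continuous_on {x..y} h"
proof -
  obtain g h where gh: "\<And>t. t \<in> {x..y} \<Longrightarrow> (f has_vector_derivative g t) (at t within {x..y})"
    "\<And>t. t \<in> {x..y} \<Longrightarrow> (g has_vector_derivative h t) (at t within {x..y})" "continuous_on {x..y} h"
    using assms(1) by (rule C2_onE) (rule that)
  have eq: "v t = g t" if "t \<in> {x..y}" for t
    using has_vector_derivative_unique_Icc[OF assms(2) that v[OF that] gh(1)[OF that]] .
  show thesis
  proof
    show "(v has_vector_derivative h t) (at t within {x..y})" if "t \<in> {x..y}" for t
      by (rule has_vector_derivative_transform[OF that eq gh(2)[OF that]])
  qed (rule gh(3))
qed

text \<open>On a C2 piece the second derivative is continuous, so a bound almost everywhere holds
  everywhere. The mean value inequality makes the velocity Lipschitz there, and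
  \<open>lipschitz_join\<close> passes the breakpoints.\<close>

lemma admissible_curve:
  assumes adm: "admissible N a p v0 vN t z" and "0 < t N"
  shows "curve a 0 (t N) z (velocity 0 (t N) z)"
proof -
  define T v where "T = t N" and "v = velocity 0 T z"
  have "0 < T" using assms by (simp add: T_def)
  have C1: "C1_on 0 T z" and C2: "piecewise_C2_on 0 T z"
    and AE: "AE s in lborel. s \<in> {0..T} \<longrightarrow> norm (velocity 0 T v s) \<le> a \<and> norm (v s) = 1"
    using adm by (auto simp: admissible_def T_def v_def)
  have zv: "(z has_vector_derivative v t) (at t within {0..T})" if "t \<in> {0..T}" for t
    unfolding v_def using C1 that by (rule C1_on_derivative)
  have cont: "continuous_on {0..T} v" using C1 by (simp add: C1_on_def v_def)
  note dense = AE_interval_dense[OF AE]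
  have unit: "norm (v t) = 1" if "t \<in> {0..T}" for t
  proof (rule antisym)
    show "norm (v t) \<le> 1"
      by (rule dense_le[OF \<open>0 < T\<close> _ _ that]) (use dense cont in \<open>force intro!: continuous_intros\<close>)+
    have "- norm (v t) \<le> - 1"
      by (rule dense_le[OF \<open>0 < T\<close> _ _ that]) (use dense cont in \<open>force intro!: continuous_intros\<close>)+
    then show "1 \<le> norm (v t)" by simp
  qed
  \<comment> \<open>The trivial premise is the instance y = T of the guard y \<le> T that the
    induction over initial segments {0..y} carries.\<close>
  have "T \<le> T \<longrightarrow> (\<forall>s\<in>{0..T}. \<forall>t\<in>{0..T}. norm (v s - v t) \<le> a * \<bar>s - t\<bar>)"
    using C2
  proof (induction rule: piecewise_C2_on_induct[where P = "\<lambda>y. y \<le> T \<longrightarrow>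
      (\<forall>s\<in>{0..y}. \<forall>t\<in>{0..y}. norm (v s - v t) \<le> a * \<bar>s - t\<bar>)"])
    case (step x y)
    show ?case
    proof (intro impI ballI)
      fix s t assume "y \<le> T" and st: "s \<in> {0..y}" "t \<in> {0..y}"
      have sub: "{x..y} \<subseteq> {0..T}" using step \<open>y \<le> T\<close> by auto
      have zv': "(z has_vector_derivative v t) (at t within {x..y})" if "t \<in> {x..y}" for t
        using zv[of t] that sub by (blast intro: has_vector_derivative_within_subset)
      obtain h where h: "\<And>t. t \<in> {x..y} \<Longrightarrow> (v has_vector_derivative h t) (at t within {x..y})"
        and conth: "continuous_on {x..y} h"
        by (rule C2_on_velocity[OF step(4,3)], erule zv', rule that)
      \<comment> \<open>Inside the piece, the second derivative relative to {0..T} is the piece's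
        own h.\<close>
      have vel: "velocity 0 T v r = h r" if "r \<in> {x<..<y}" for r
      proof -
        have "(v has_vector_derivative h r) (at r)"
          using h[of r] that at_within_Icc_at[of x r y] by auto
        then have "(v has_vector_derivative h r) (at r within {0..T})"
          by (rule has_vector_derivative_at_within)
        then show ?thesis
          unfolding velocity_def using that sub \<open>0 < T\<close>
          by (intro vector_derivative_within_closed_interval) auto
      qed
      have hle: "norm (h r) \<le> a" if "r \<in> {x..y}" for r
      proof (rule dense_le[OF step(3) _ _ that])
        fix x' y' assume "x \<le> x'" "x' < y'" "y' \<le> y"
        then obtain r where r: "r \<in> {x'<..<y'}" "norm (velocity 0 T v r) \<le> a"
          using dense[of x' y'] step(1) \<open>y \<le> T\<close> by auto
        moreover have "r \<in> {x<..<y}" using r \<open>x \<le> x'\<close> \<open>y' \<le> y\<close> by auto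
        ultimately show "\<exists>s\<in>{x'<..<y'}. norm (h s) \<le> a" using vel by auto
      qed (intro continuous_intros conth)
      show "norm (v s - v t) \<le> a * \<bar>s - t\<bar>"
      proof (rule lipschitz_join[OF _ _ st])
        show "norm (v s - v t) \<le> a * \<bar>s - t\<bar>" if "s \<in> {0..x}" "t \<in> {0..x}" for s t
          using step(3,5) that \<open>y \<le> T\<close> by auto
        show "norm (v s - v t) \<le> a * \<bar>s - t\<bar>" if st: "s \<in> {x..y}" "t \<in> {x..y}" for s t
        proof -
          have "norm (v s - v t) \<le> a * norm (s - t)"
          proof (rule differentiable_bound[OF _ _ _ st])
            show "(v has_derivative (\<lambda>k. k *\<^sub>R h r)) (at r within {x..y})" if "r \<in> {x..y}" for r
              using h[OF that] by (simp add: has_vector_derivative_def)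
            show "onorm (\<lambda>k. k *\<^sub>R h r) \<le> a" if "r \<in> {x..y}" for r
              by (rule onorm_le) (use hle[OF that] in \<open>simp add: mult.commute[of a] mult_left_mono\<close>)
          qed simp
          then show ?thesis by simp
        qed
      qed
    qed
  qed auto
  then show ?thesis
    unfolding curve_def using zv unit C2 by (simp add: T_def v_def)
qed

text \<open>The converse passage: the velocity is differentiable off finitely many breakpoints,
  which form a null set, and its derivative there is bounded by the Lipschitz constant.\<close>

lemma curve_admissible:
  assumes c: "curve a 0 (t N) z v" and "0 < t N"
    and t: "t 0 = 0" "\<forall>i\<in>{1..N}. t (i - 1) < t i" "\<forall>i\<in>{0..N}. z (t i) = p i"
    and v: "v 0 = v0" "v (t N) = vN"
  shows "admissible N a p v0 vN t z"
proof -
  define T where "T = t N"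
  have "0 < T" using assms by (simp add: T_def)
  have zv: "(z has_vector_derivative v t) (at t within {0..T})" if "t \<in> {0..T}" for t
    using that unfolding T_def by (rule curveD[OF c])
  have lip: "norm (v s - v t) \<le> a * \<bar>s - t\<bar>" if "s \<in> {0..T}" "t \<in> {0..T}" for s t
    using that unfolding T_def by (rule curveD[OF c])
  have C2: "piecewise_C2_on 0 T z" using c by (simp add: curve_def T_def)
  have "0 \<le> a"
    using order_trans[OF norm_ge_zero lip[of 0 T]] \<open>0 < T\<close> by (simp add: zero_le_mult_iff)
  then have "a-lipschitz_on {0..T} v"
    using lip by (auto simp: lipschitz_on_def dist_norm)
  then have cont: "continuous_on {0..T} v" by (rule lipschitz_on_continuous_on)
  have z1: "C1_on 0 T z"
    using \<open>0 < T\<close> zv cont by (rule C1_onI(1))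
  have z2: "velocity 0 T z s = v s" if "s \<in> {0..T}" for s
    using \<open>0 < T\<close> zv cont that by (rule C1_onI(2))
  have "T \<le> T \<longrightarrow> (\<exists>S. finite S \<and> (\<forall>x\<in>{0..T} - S. \<exists>D. (v has_vector_derivative D) (at x)))"
    using C2
  proof (induction rule: piecewise_C2_on_induct[where P = "\<lambda>y. y \<le> T \<longrightarrow>
      (\<exists>S. finite S \<and> (\<forall>x\<in>{0..y} - S. \<exists>D. (v has_vector_derivative D) (at x)))"])
    case refl
    then show ?case by (auto intro!: exI[of _ "{0}"])
  next
    case (step x y)
    show ?case
    proof
      assume "y \<le> T"
      then obtain S where S: "finite S" "\<And>r. r \<in> {0..x} - S \<Longrightarrow> \<exists>D. (v has_vector_derivative D) (at r)"
        using step by auto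
      have sub: "{x..y} \<subseteq> {0..T}" using step \<open>y \<le> T\<close> by auto
      have zv': "(z has_vector_derivative v t) (at t within {x..y})" if "t \<in> {x..y}" for t
        using zv[of t] that sub by (blast intro: has_vector_derivative_within_subset)
      obtain h where h: "\<And>t. t \<in> {x..y} \<Longrightarrow> (v has_vector_derivative h t) (at t within {x..y})"
        by (rule C2_on_velocity[OF step(4,3)], erule zv', rule that)
      have "\<exists>D. (v has_vector_derivative D) (at r)" if r: "r \<in> {0..y} - (S \<union> {x, y})" for r
      proof (cases "r \<le> x")
        case False
        then have "(v has_vector_derivative h r) (at r)"
          using h[of r] r at_within_Icc_at[of x r y] by auto
        then show ?thesis by blast
      qed (use S(2)[of r] r in auto)
      then show "\<exists>S. finite S \<and> (\<forall>x\<in>{0..y} - S. \<exists>D. (v has_vector_derivative D) (at x))"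
        using S(1) by (intro exI[of _ "S \<union> {x, y}"]) auto
    qed
  qed
  then obtain S where S: "finite S" "\<And>r. r \<in> {0..T} - S \<Longrightarrow> \<exists>D. (v has_vector_derivative D) (at r)"
    by auto
  have "AE s in lborel. s \<notin> S \<union> {0, T}"
    by (intro AE_not_in finite_imp_null_set_lborel) (use S in auto)
  then have "AE s in lborel. s \<in> {0..T} \<longrightarrow>
      norm (velocity 0 T (velocity 0 T z) s) \<le> a \<and> norm (velocity 0 T z s) = 1"
  proof eventually_elim
    case (elim s)
    show ?case
    proof
      assume s: "s \<in> {0..T}"
      then obtain D where D: "(v has_vector_derivative D) (at s)" using S(2) elim by blast
      have "norm D \<le> a"
        by (rule norm_vector_derivative_le[OF D, of 0 T]) (use s elim lip in auto)
      moreover have "(velocity 0 T z has_vector_derivative D) (at s within {0..T})"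
        by (rule has_vector_derivative_transform[OF s z2 has_vector_derivative_at_within[OF D]])
      then have "velocity 0 T (velocity 0 T z) s = D"
        by (subst (1) velocity_def) (rule vector_derivative_within_closed_interval[OF \<open>0 < T\<close> s])
      moreover have "norm (v s) = 1" using c s by (simp add: curve_def T_def)
      ultimately show "norm (velocity 0 T (velocity 0 T z) s) \<le> a \<and> norm (velocity 0 T z s) = 1"
        using z2[OF s] by simp
    qed
  qed
  then show ?thesis
    unfolding admissible_def T_def[symmetric]
    using t v z1 z2[of 0] z2[of T] C2 \<open>0 < T\<close> by (auto simp: T_def)
qed

section \<open>Stages of a solution\<close>

definition cplx :: "real^2 \<Rightarrow> complex" where
  "cplx x = Complex (x $ 1) (x $ 2)"

definition plane :: "complex \<Rightarrow> real^2" where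
  "plane w = vector [Re w, Im w]"

lemma cplx_plane [simp]: "cplx (plane w) = w"
  by (simp add: cplx_def plane_def)

lemma plane_cplx [simp]: "plane (cplx x) = x"
  by (simp add: cplx_def plane_def vec_eq_iff forall_2)

lemma norm_cplx [simp]: "norm (cplx x) = norm x"
  by (simp add: cplx_def norm_vec_def L2_set_def sum_2 cmod_def)

lemma norm_plane [simp]: "norm (plane w) = norm w"
  using norm_cplx[of "plane w"] by simp

lemma linear_cplx: "linear cplx"
  by (rule linearI) (simp_all add: cplx_def complex_eq_iff)

lemma linear_plane: "linear plane"
  by (rule linearI) (simp_all add: plane_def vec_eq_iff forall_2)

lemma bounded_linear_cplx: "bounded_linear cplx"
  using linear_cplx by (rule linear_conv_bounded_linear[THEN iffD1])

lemma bounded_linear_plane: "bounded_linear plane"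
  using linear_plane by (rule linear_conv_bounded_linear[THEN iffD1])

lemmas cplx_simps = linear_add[OF linear_cplx] linear_diff[OF linear_cplx] linear_scale[OF linear_cplx]
  linear_0[OF linear_cplx]
lemmas plane_simps = linear_add[OF linear_plane] linear_diff[OF linear_plane] linear_scale[OF linear_plane]
  linear_0[OF linear_plane]

text \<open>A unit-curvature piece shrunk by the factor 1 / a and run at unit speed. Its velocity is
  \<open>a\<close>-Lipschitz because a chord of the unit circle is no longer than the angle it
  spans.\<close>

lemma curve_piece:
  assumes u: "u \<in> {-1, 0, 1}" and V: "norm V = 1" and l: "0 \<le> l" and a: "0 < a"
  shows "curve a s (s + l / a) (\<lambda>t. x + (1 / a) *\<^sub>R plane (V * piece_disp u (a * (t - s))))
    (\<lambda>t. plane (V * cis (u * (a * (t - s)))))" (is "curve a s _ ?z ?v")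
proof -
  let ?h = "\<lambda>t. plane (V * (\<i> * of_real (u * a) * cis (u * (a * (t - s)))))"
  have z: "(?z has_vector_derivative ?v t) (at t within S)" for t S
  proof -
    have "((\<lambda>t. a * (t - s)) has_vector_derivative a) (at t within S)"
      using has_vector_derivative_mult_right[OF has_vector_derivative_diff[OF has_vector_derivative_id has_vector_derivative_const]]
      by simp
    moreover have "((\<lambda>r. piece_disp u (r - 0)) has_vector_derivative cis (u * (a * (t - s) - 0)))
        (at (a * (t - s)) within (\<lambda>t. a * (t - s)) ` S)"
      by (rule has_vector_derivative_piece_disp[OF u])
    ultimately have "((\<lambda>t. piece_disp u (a * (t - s))) has_vector_derivative a *\<^sub>R cis (u * (a * (t - s)))) (at t within S)"
      using vector_diff_chain_within by (fastforce simp: o_def)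
    from bounded_linear.has_vector_derivative[OF bounded_linear_plane has_vector_derivative_mult_right[OF this, of V]]
    have "((\<lambda>t. plane (V * piece_disp u (a * (t - s)))) has_vector_derivative
        a *\<^sub>R ?v t) (at t within S)"
      by (simp add: plane_simps)
    from has_vector_derivative_add[OF has_vector_derivative_const[of x]
      bounded_linear.has_vector_derivative[OF bounded_linear_scaleR_right[of "1 / a"] this]]
    show ?thesis using a by simp
  qed
  have v: "(?v has_vector_derivative ?h t) (at t within S)" for t S
  proof -
    have "((\<lambda>t. cis (u * a * (t - s))) has_vector_derivative \<i> * of_real (u * a) * cis (u * a * (t - s))) (at t within S)"
      by (rule has_vector_derivative_cis_linear)
    from bounded_linear.has_vector_derivative[OF bounded_linear_plane has_vector_derivative_mult_right[OF this, of V]]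
    show ?thesis by (simp add: mult.assoc)
  qed
  have h: "continuous_on S ?h" for S
    by (intro bounded_linear.continuous_on[OF bounded_linear_plane] continuous_intros)
  have "norm (?v r - ?v t) \<le> a * \<bar>r - t\<bar>" for r t
  proof -
    have "norm (?v r - ?v t) = norm (cis (u * (a * (r - s))) - cis (u * (a * (t - s))))"
      unfolding plane_simps[symmetric] right_diff_distrib[symmetric] by (simp add: norm_mult V)
    also have "\<dots> = 2 * \<bar>sin ((u * (a * (r - s)) - u * (a * (t - s))) / 2)\<bar>"
      by (rule norm_cis_diff)
    also have "\<dots> \<le> \<bar>u * (a * (r - s)) - u * (a * (t - s))\<bar>"
      using abs_sin_x_le_abs_x[of "(u * (a * (r - s)) - u * (a * (t - s))) / 2"] by simp
    also have "\<dots> = \<bar>u\<bar> * (a * \<bar>r - t\<bar>)"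
      using a by (simp add: abs_mult flip: right_diff_distrib)
    also have "\<dots> \<le> 1 * (a * \<bar>r - t\<bar>)"
      using u a by (intro mult_right_mono) auto
    finally show ?thesis by simp
  qed
  moreover have "piecewise_C2_on s (s + l / a) ?z"
    using l a by (intro piecewise_C2_on_single) (auto intro!: C2_onI[OF _ z v h])
  ultimately show ?thesis
    unfolding curve_def using z V by (simp add: norm_mult)
qed

lemma curve_word:
  assumes "valid w" "norm v0 = 1" and a: "0 < a"
  shows "\<exists>z v. curve a s (s + len w / a) z v \<and> z s = x \<and> v s = v0 \<and>
    z (s + len w / a) = x + (1 / a) *\<^sub>R plane (cplx v0 * disp w) \<and>
    v (s + len w / a) = plane (cplx v0 * cis (turn w))"
  using assms(1,2)
proof (induction w arbitrary: s x v0 rule: disp.induct)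
  case 1
  \<comment> \<open>For the empty word the interval is the single point s; a line with direction v0
    has the required velocity there.\<close>
  then show ?case
    by (intro exI[of _ "\<lambda>r. x + (r - s) *\<^sub>R v0"] exI[of _ "\<lambda>_. v0"])
      (auto simp: curve_def plane_simps intro!: piecewise_C2_on_single derivative_eq_intros)
next
  case (2 u l w)
  define m where "m = s + l / a"
  define z1 where "z1 t = x + (1 / a) *\<^sub>R plane (cplx v0 * piece_disp u (a * (t - s)))" for t
  define v1 where "v1 t = plane (cplx v0 * cis (u * (a * (t - s))))" for t
  have l: "0 \<le> l" "u \<in> {-1, 0, 1}" "valid w" using 2 by auto
  have c1: "curve a s m z1 v1"
    unfolding m_def z1_def[abs_def] v1_def[abs_def] using curve_piece[OF l(2) _ l(1) a] 2(3) by simp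
  have e1: "z1 s = x" "v1 s = v0" "z1 m = x + (1 / a) *\<^sub>R plane (cplx v0 * piece_disp u l)"
    "v1 m = plane (cplx v0 * cis (u * l))"
    using a by (simp_all add: z1_def v1_def m_def plane_simps)
  have "norm (v1 m) = 1" using e1 2(3) by (simp add: norm_mult)
  from "2.IH"[OF l(3) this, of m "z1 m"] obtain z2 v2 where
    c2: "curve a m (m + len w / a) z2 v2" and e2: "z2 m = z1 m" "v2 m = v1 m"
    "z2 (m + len w / a) = z1 m + (1 / a) *\<^sub>R plane (cplx (v1 m) * disp w)"
    "v2 (m + len w / a) = plane (cplx (v1 m) * cis (turn w))" by blast
  have le: "s \<le> m" "m \<le> m + len w / a" using l a len_nonneg[OF l(3)] by (auto simp: m_def)
  define z v where "z t = (if t \<le> m then z1 t else z2 t)" and "v t = (if t \<le> m then v1 t else v2 t)" for t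
  have end': "s + len ((u, l) # w) / a = m + len w / a"
    by (simp add: m_def add_divide_distrib)
  have "curve a s (m + len w / a) z v"
    unfolding z_def[abs_def] v_def[abs_def] by (rule curve_join[OF c1 c2 le]) (simp_all add: e2)
  moreover have "z s = x" "v s = v0" using le e1 by (simp_all add: z_def v_def)
  moreover have "z (m + len w / a) = z2 (m + len w / a)" "v (m + len w / a) = v2 (m + len w / a)"
    using e2(1,2) le by (auto simp: z_def v_def dest: antisym)
  then have "z (m + len w / a) = x + (1 / a) *\<^sub>R plane (cplx v0 * disp ((u, l) # w))"
    "v (m + len w / a) = plane (cplx v0 * cis (turn ((u, l) # w)))"
    unfolding e2 e1 by (simp_all add: algebra_simps plane_simps cis_mult)
  ultimately show ?case unfolding end' by blast
qed

text \<open>The part over {r..s} is replaced by the curve of the word, of length l, and everything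
  after it is delayed by d = l - (s - r). No node lies strictly between r and s, so all nodes are
  still visited in order, and optimality of the total time gives d \<ge> 0.\<close>

lemma solution_subarc_minimal:
  assumes sol: "solution N a p v0 vN t z" and a: "0 < a"
    and i: "i \<in> {1..N}" and p: "p (i - 1) \<noteq> p i"
    and r: "t (i - 1) \<le> r" "r \<le> s" "s \<le> t i"
    and c: "curve a 0 (t N) z v" and w: "valid w"
    and v: "cplx (v s) = cplx (v r) * cis (turn w)"
    and z: "z s = z r + (1 / a) *\<^sub>R plane (cplx (v r) * disp w)"
    and ends: "v 0 = v0" "v (t N) = vN"
  shows "s - r \<le> len w / a"
proof -
  have adm: "admissible N a p v0 vN t z" and opt: "\<And>t' z'. admissible N a p v0 vN t' z' \<Longrightarrow> t N \<le> t' N"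
    using sol by (auto simp: solution_def)
  have t0: "t 0 = 0" and inc: "\<And>j. j \<in> {1..N} \<Longrightarrow> t (j - 1) < t j" and zp: "\<And>j. j \<in> {0..N} \<Longrightarrow> z (t j) = p j"
    using adm by (auto simp: admissible_def)
  have mono: "t j \<le> t k" if "j \<le> k" "k \<le> N" for j k
    using that
  proof (induction k rule: dec_induct)
    case (step n)
    then show ?case using inc[of "Suc n"] by auto
  qed simp
  have r0: "0 \<le> r" and sN: "s \<le> t N" using mono[of 0 "i - 1"] mono[of i N] i r t0 by force+
  define l d where "l = len w / a" and "d = l - (s - r)"
  have l0: "0 \<le> l" using len_nonneg[OF w] a by (simp add: l_def)
  have "norm (v r) = 1" using r0 r sN by (intro curveD(3)[OF c]) auto
  from curve_word[OF w this a, of r "z r"] obtain z2 v2 where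
    c2: "curve a r (r + l) z2 v2" and e2: "z2 r = z r" "v2 r = v r" "z2 (r + l) = z s" "v2 (r + l) = v s"
    unfolding l_def using v z by (metis plane_cplx)
  have c1: "curve a 0 r z v" using r0 r sN by (intro curve_subinterval[OF c]) auto
  have "curve a (s + d) (t N + d) (\<lambda>x. z (x - d)) (\<lambda>x. v (x - d))"
    using r0 r sN by (intro curve_shift curve_subinterval[OF c]) auto
  moreover have "s + d = r + l" by (simp add: d_def)
  ultimately have c3: "curve a (r + l) (t N + d) (\<lambda>x. z (x - d)) (\<lambda>x. v (x - d))" by (simp only:)
  have rld: "r + l - d = s" by (simp add: d_def)
  define z' v' where "z' x = (if x \<le> r then z x else if x \<le> r + l then z2 x else z (x - d))"
    and "v' x = (if x \<le> r then v x else if x \<le> r + l then v2 x else v (x - d))" for x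
  have c': "curve a 0 (t N + d) z' v'"
    unfolding z'_def[abs_def] v'_def[abs_def]
  proof (rule curve_join[OF c1 curve_join[OF c2 c3]])
    show "r + l \<le> t N + d" using sN by (simp add: d_def)
    then show "r \<le> t N + d" using l0 by simp
  qed (use r0 l0 e2 rld in auto)
  \<comment> \<open>Node i - 1 comes no later than r and node i no earlier than s, so exactly the
    nodes from i on are delayed.\<close>
  define t' where "t' j = (if j < i then t j else t j + d)" for j
  have t'N: "t' N = t N + d" using i by (simp add: t'_def)
  have z'1: "z' x = z x" if "x \<le> r" for x using that by (simp add: z'_def)
  have z'2: "z' x = z (x - d)" "v' x = v (x - d)" if "r + l \<le> x" for x
    using that l0 e2 rld by (auto simp: z'_def v'_def dest: antisym)
  \<comment> \<open>The stage could collapse only if the subarc were the whole stage and the word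
    had length 0; then the nodes p (i - 1) and p i would coincide.\<close>
  have split: "t (i - 1) < t i + d"
  proof (rule ccontr)
    assume "\<not> ?thesis"
    then have *: "t i = s" "r = t (i - 1)" "l = 0" using r l0 by (auto simp: d_def)
    then have "z s = z r" using e2 by simp
    moreover have "i - 1 \<in> {0..N}" "i \<in> {0..N}" using i by auto
    ultimately show False using zp p * by metis
  qed
  have "admissible N a p v0 vN t' z'"
  proof (rule curve_admissible)
    show "curve a 0 (t' N) z' v'" using c' t'N by simp
    show "t' 0 = 0" using i t0 by (simp add: t'_def)
    show inc': "\<forall>j\<in>{1..N}. t' (j - 1) < t' j"
    proof
      fix j assume j: "j \<in> {1..N}"
      show "t' (j - 1) < t' j"
        using inc[OF j] split j by (cases "j = i") (auto simp: t'_def)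
    qed
    have "t (N - 1) < t N" using inc[of N] i by auto
    show "0 < t' N"
      unfolding t'N using split mono[of i N] mono[of 0 "i - 1"] t0 i by force
    show "\<forall>j\<in>{0..N}. z' (t' j) = p j"
    proof
      fix j assume j: "j \<in> {0..N}"
      show "z' (t' j) = p j"
      proof (cases "j < i")
        case True
        then have "t j \<le> t (i - 1)" using i by (intro mono) auto
        then show ?thesis using True r z'1[of "t j"] zp[OF j] by (simp add: t'_def)
      next
        case False
        then have "t i \<le> t j" using j by (intro mono) auto
        then have "r + l \<le> t j + d" using r by (simp add: d_def)
        then show ?thesis using False z'2(1)[of "t j + d"] zp[OF j] by (simp add: t'_def)
      qed
    qed
    show "v' 0 = v0" using r0 ends by (simp add: v'_def)
    have "r + l \<le> t N + d" using sN by (simp add: d_def)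
    then show "v' (t' N) = vN" using z'2(2)[of "t N + d"] ends by (simp add: t'N)
  qed
  then have "t N \<le> t N + d" using opt[of t' z'] t'N by simp
  then show ?thesis by (simp add: d_def l_def)
qed

text \<open>Times and positions are both multiplied by \<open>a\<close>: the speed remains 1, and
  the curvature bound becomes 1.\<close>

lemma solution_dubins:
  assumes sol: "solution N a p v0 vN t z" and a: "0 < a"
    and i: "i \<in> {1..N}" and p: "p (i - 1) \<noteq> p i"
    and c: "curve a 0 (t N) z v" and ends: "v 0 = v0" "v (t N) = vN"
    and le: "0 \<le> t (i - 1)" "t (i - 1) < t i" "t i \<le> t N"
  shows "dubins (\<lambda>s. of_real a * cplx (z (s / a))) (\<lambda>s. cplx (v (s / a))) (a * t (i - 1)) (a * t i)"
proof
  have sub: "s / a \<in> {t (i - 1)..t i}" if "s \<in> {a * t (i - 1)..a * t i}" for s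
    using that a by (simp add: field_simps)
  have c': "curve a (t (i - 1)) (t i) z v"
    using le by (intro curve_subinterval[OF c]) auto
  show "a * t (i - 1) < a * t i" using a le by simp
  show "norm (cplx (v (s / a))) = 1" if "s \<in> {a * t (i - 1)..a * t i}" for s
    using curveD(3)[OF c' sub[OF that]] by simp
  show "norm (cplx (v (r / a)) - cplx (v (s / a))) \<le> \<bar>r - s\<bar>"
    if "r \<in> {a * t (i - 1)..a * t i}" "s \<in> {a * t (i - 1)..a * t i}" for r s
  proof -
    have "norm (v (r / a) - v (s / a)) \<le> a * \<bar>r / a - s / a\<bar>"
      using sub that by (intro curveD(2)[OF c']) auto
    also have "\<dots> = \<bar>r - s\<bar>" using a by (simp flip: diff_divide_distrib)
    finally show ?thesis by (simp flip: cplx_simps)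
  qed
  show "((\<lambda>s. of_real a * cplx (z (s / a))) has_vector_derivative cplx (v (s / a)))
      (at s within {a * t (i - 1)..a * t i})" if s: "s \<in> {a * t (i - 1)..a * t i}" for s
  proof -
    have img: "(\<lambda>s. s / a) ` {a * t (i - 1)..a * t i} \<subseteq> {t (i - 1)..t i}" using sub by blast
    have "((\<lambda>s. s / a) has_vector_derivative 1 / a) (at s within {a * t (i - 1)..a * t i})"
      by (auto intro!: derivative_eq_intros)
    from vector_diff_chain_within[OF this has_vector_derivative_within_subset[OF curveD(1)[OF c' sub[OF s]] img]]
    have "((\<lambda>s. z (s / a)) has_vector_derivative (1 / a) *\<^sub>R v (s / a)) (at s within {a * t (i - 1)..a * t i})"
      by (simp add: o_def)
    from has_vector_derivative_mult_right[OF bounded_linear.has_vector_derivative[OF bounded_linear_cplx this], of "of_real a", unfolded cplx_simps]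
    show ?thesis using a by (simp add: scaleR_conv_of_real)
  qed
  fix r s w
  assume rs: "a * t (i - 1) \<le> r" "r \<le> s" "s \<le> a * t i" and w: "valid w"
    and V: "cplx (v (s / a)) = cplx (v (r / a)) * cis (turn w)"
    and Z: "of_real a * cplx (z (s / a)) - of_real a * cplx (z (r / a)) = cplx (v (r / a)) * disp w"
  have "s / a - r / a \<le> len w / a"
  proof (rule solution_subarc_minimal[OF sol a i p _ _ _ c w V _ ends])
    show "t (i - 1) \<le> r / a" "r / a \<le> s / a" "s / a \<le> t i"
      using rs a by (simp_all add: field_simps)
    have "cplx (v (r / a)) * disp w = of_real a * (cplx (z (s / a)) - cplx (z (r / a)))"
      using Z by (simp add: algebra_simps)
    then have "(1 / a) *\<^sub>R plane (cplx (v (r / a)) * disp w) = plane (cplx (z (s / a)) - cplx (z (r / a)))"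
      using a by (simp add: plane_simps flip: scaleR_conv_of_real)
    then show "z (s / a) = z (r / a) + (1 / a) *\<^sub>R plane (cplx (v (r / a)) * disp w)"
      by (simp add: plane_simps)
  qed
  then have "(s - r) / a \<le> len w / a" by (simp add: diff_divide_distrib)
  then show "s - r \<le> len w" using a by (simp add: divide_le_cancel)
qed

section \<open>Unit-curvature pieces versus the arcs and segments of the statement\<close>

lemma vector_cos_sin: "vector [cos x, sin x] = plane (cis x)"
  by (simp add: plane_def)

lemma is_piece_of_piece:
  assumes "dubins (\<lambda>s. of_real a * cplx (z (s / a))) V b c" and a: "0 < a"
    and u: "u \<in> {-1, 0, 1}" and le: "b \<le> a * p" "p < q" "a * q \<le> c"
    and piece: "dubins.piece V u (a * p) (a * q)"
  shows "is_piece a (if u = 0 then Seg else Arc) u z p q"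
proof -
  interpret dubins "\<lambda>s. of_real a * cplx (z (s / a))" V b c by fact
  define V0 where "V0 = V (a * p)"
  have V0: "norm V0 = 1" unfolding V0_def using le a by (intro unit) (auto intro: order_trans[OF _ le(3)])
  have z: "z s = z p + (1 / a) *\<^sub>R plane (V0 * piece_disp u (a * s - a * p))" if s: "s \<in> {p..q}" for s
  proof -
    have ps: "a * p \<le> a * s" "a * s \<le> a * q" using s a by auto
    have "piece u (a * p) (a * s)"
      unfolding piece_def by (intro ballI pieceD[OF piece]) (use ps in auto)
    moreover have "a * s \<le> c" using ps le by linarith
    ultimately have "of_real a * cplx (z (a * s / a)) - of_real a * cplx (z (a * p / a)) =
        V0 * piece_disp u (a * s - a * p)"
      unfolding V0_def using u le(1) ps(1) by (intro piece_displacement(2))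
    then have "V0 * piece_disp u (a * s - a * p) = a *\<^sub>R (cplx (z s) - cplx (z p))"
      using a by (simp add: scaleR_conv_of_real algebra_simps)
    then show ?thesis using a by (simp add: plane_simps)
  qed
  show ?thesis
  proof (cases "u = 0")
    case True
    have "z s = z p + (s - p) *\<^sub>R plane V0" if "s \<in> {p..q}" for s
    proof -
      have "V0 * piece_disp u (a * s - a * p) = (a * (s - p)) *\<^sub>R V0"
        using True by (simp add: piece_disp_def scaleR_conv_of_real algebra_simps)
      then show ?thesis using z[OF that] a by (simp add: plane_simps)
    qed
    then have "line_segment z p q"
      unfolding line_segment_def
      by (intro exI[of _ "z p"] exI[of _ "plane V0"] conjI ballI) (simp_all only: norm_plane V0)
    then show ?thesis using True by simp
  next
    case False
    then have u1: "u = 1 \<or> u = -1" using u by auto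
    \<comment> \<open>The direction from the centre to the starting point: the velocity V0 is this
      radius turned by a quarter, to the left if u = 1 and to the right if u = -1.\<close>
    define \<theta> where "\<theta> = Arg (- \<i> * of_real u * V0)"
    have "norm (- \<i> * of_real u * V0) = 1" using u1 V0 by (auto simp: norm_mult)
    then have \<theta>: "cis \<theta> = - \<i> * of_real u * V0"
      unfolding \<theta>_def by (subst cis_Arg) (auto simp: sgn_eq)
    have "z s = (z p - (1 / a) *\<^sub>R plane (cis \<theta>)) + (1 / a) *\<^sub>R vector [cos (\<theta> + u * a * (s - p)), sin (\<theta> + u * a * (s - p))]"
      if "s \<in> {p..q}" for s
    proof -
      have "V0 * piece_disp u (a * s - a * p) = cis \<theta> * (cis (u * (a * s - a * p)) - 1)"
        using False by (simp add: piece_disp_def \<theta>)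
      also have "\<dots> = cis (\<theta> + u * a * (s - p)) - cis \<theta>"
        by (simp add: cis_mult algebra_simps)
      finally show ?thesis
        unfolding vector_cos_sin z[OF that]
        by (simp only: plane_simps scaleR_diff_right) (simp add: algebra_simps)
    qed
    then have "circular_arc a u z p q"
      unfolding circular_arc_def using u1 by blast
    then show ?thesis using False by simp
  qed
qed

text \<open>Serves the length claim, which concerns an arbitrary CCC decomposition: its geometric
  arcs must become pieces of the velocity before \<open>interior_arc\<close> applies. Uniqueness of
  the one-sided derivative identifies the velocity of the arc with v.\<close>

lemma piece_of_circular_arc:
  assumes "dubins Z (\<lambda>s. cplx (v (s / a))) b c" and a: "0 < a"
    and arc: "circular_arc a \<sigma> z p q" and "p < q"
    and v: "\<And>t. t \<in> {p..q} \<Longrightarrow> (z has_vector_derivative v t) (at t within {p..q})"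
  shows "dubins.piece (\<lambda>s. cplx (v (s / a))) \<sigma> (a * p) (a * q)"
proof -
  interpret dubins Z "\<lambda>s. cplx (v (s / a))" b c by fact
  from arc obtain x \<theta> where \<sigma>: "\<sigma> = 1 \<or> \<sigma> = -1"
    and z: "\<And>s. s \<in> {p..q} \<Longrightarrow> z s = x + (1 / a) *\<^sub>R plane (cis (\<theta> + \<sigma> * a * (s - p)))"
    unfolding circular_arc_def vector_cos_sin by blast
  have vt: "cplx (v t) = \<i> * of_real \<sigma> * cis \<theta> * cis (\<sigma> * a * (t - p))" if t: "t \<in> {p..q}" for t
  proof -
    have "((\<lambda>t. cis (\<sigma> * a * (t - p))) has_vector_derivative \<i> * of_real (\<sigma> * a) * cis (\<sigma> * a * (t - p))) (at t within {p..q})"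
      by (rule has_vector_derivative_cis_linear)
    from has_vector_derivative_add[OF has_vector_derivative_const[of x]
      bounded_linear.has_vector_derivative[OF bounded_linear_scaleR_right[of "1 / a"]
      bounded_linear.has_vector_derivative[OF bounded_linear_plane has_vector_derivative_mult_right[OF this, of "cis \<theta>"]]]]
    have "((\<lambda>t. x + (1 / a) *\<^sub>R plane (cis \<theta> * cis (\<sigma> * a * (t - p)))) has_vector_derivative
        (1 / a) *\<^sub>R plane (cis \<theta> * (\<i> * of_real (\<sigma> * a) * cis (\<sigma> * a * (t - p))))) (at t within {p..q})"
      by simp
    then have "(z has_vector_derivative
        (1 / a) *\<^sub>R plane (cis \<theta> * (\<i> * of_real (\<sigma> * a) * cis (\<sigma> * a * (t - p))))) (at t within {p..q})"
      by (rule has_vector_derivative_transform[OF t, rotated]) (simp add: z cis_mult)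
    from has_vector_derivative_unique_Icc[OF \<open>p < q\<close> t v[OF t] this]
    have "cplx (v t) = (1 / a) *\<^sub>R (cis \<theta> * (\<i> * of_real (\<sigma> * a) * cis (\<sigma> * a * (t - p))))"
      by (simp add: cplx_simps)
    then show ?thesis using a by (simp add: scaleR_conv_of_real)
  qed
  show ?thesis
    unfolding piece_def
  proof
    fix s assume s: "s \<in> {a * p..a * q}"
    then have "s / a \<in> {p..q}" "a * p / a = p" "p \<in> {p..q}" using a \<open>p < q\<close> by (auto simp: field_simps)
    then show "cplx (v (s / a)) = cplx (v (a * p / a)) * cis (\<sigma> * (s - a * p))"
      using vt[of "s / a"] vt[of p] a by (simp add: algebra_simps)
  qed
qed

theorem theorem1:
  fixes N :: nat and a :: real
    and p :: "nat \<Rightarrow> real^2" and v0 vN :: "real^2"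
    and t :: "nat \<Rightarrow> real" and z :: "real \<Rightarrow> real^2"
  assumes "N \<ge> 1" and "a > 0"
    and "\<forall>i\<in>{1..N}. p (i - 1) \<noteq> p i"
    and "norm v0 = 1" and "norm vN = 1"
    and "solution N a p v0 vN t z"
  shows "\<forall>i\<in>{1..N}.
      (\<exists>w. (subseq w [Arc, Seg, Arc] \<or> subseq w [Arc, Arc, Arc]) \<and>
           of_type a z (t (i - 1)) (t i) w) \<and>
      (\<forall>s \<sigma>. decomposition a z (t (i - 1)) (t i) [Arc, Arc, Arc] s \<sigma> \<longrightarrow>
           s 2 - s 1 > pi / a)"
proof
  fix i assume i: "i \<in> {1..N}"
  note a = \<open>a > 0\<close>
  have adm: "admissible N a p v0 vN t z" using assms(6) by (simp add: solution_def)
  then have t0: "t 0 = 0" and inc: "\<And>j. j \<in> {1..N} \<Longrightarrow> t (j - 1) < t j"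
    by (auto simp: admissible_def)
  have mono: "t j \<le> t k" if "j \<le> k" "k \<le> N" for j k
    using that
  proof (induction k rule: dec_induct)
    case (step n)
    then show ?case using inc[of "Suc n"] by auto
  qed simp
  have le: "0 \<le> t (i - 1)" "t (i - 1) < t i" "t i \<le> t N"
    using mono[of 0 "i - 1"] inc[OF i] mono[of i N] i t0 by force+
  then have tN: "0 < t N" by linarith
  define v where "v = velocity 0 (t N) z"
  have c: "curve a 0 (t N) z v" unfolding v_def using adm tN by (rule admissible_curve)
  have ends: "v 0 = v0" "v (t N) = vN" using adm by (auto simp: admissible_def v_def)
  have ci: "curve a (t (i - 1)) (t i) z v" using le by (intro curve_subinterval[OF c]) auto
  let ?Z = "\<lambda>s. of_real a * cplx (z (s / a))" and ?V = "\<lambda>s. cplx (v (s / a))"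
  have dubins: "dubins ?Z ?V (a * t (i - 1)) (a * t i)"
    by (rule solution_dubins[OF assms(6) a i bspec[OF assms(3) i] c ends le])
  interpret dubins ?Z ?V "a * t (i - 1)" "a * t i" by fact
  show "(\<exists>w. (subseq w [Arc, Seg, Arc] \<or> subseq w [Arc, Arc, Arc]) \<and>
           of_type a z (t (i - 1)) (t i) w) \<and>
      (\<forall>s \<sigma>. decomposition a z (t (i - 1)) (t i) [Arc, Arc, Arc] s \<sigma> \<longrightarrow>
           s 2 - s 1 > pi / a)"
  proof
    obtain m s u where m: "0 < m" "m \<le> 3" "s 0 = a * t (i - 1)" "s m = a * t i"
      and su: "\<And>j. j < m \<Longrightarrow> s j < s (Suc j) \<and> u j \<in> {-1, 0, 1} \<and> piece (u j) (s j) (s (Suc j))"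
      and alt: "\<And>j. Suc j < m \<Longrightarrow> u j \<noteq> u (Suc j)"
      and ccc: "m = 3 \<Longrightarrow> u 1 \<noteq> 0 \<Longrightarrow> u 0 = - u 1 \<and> u 2 = - u 1"
      by (rule alternating_pieces) (rule that)
    have smono: "s j \<le> s k" if "j \<le> k" "k \<le> m" for j k
      using that
    proof (induction k rule: dec_induct)
      case (step n)
      then show ?case using su[of n] by auto
    qed simp
    define letter where "letter j = (if u j = 0 then Seg else Arc)" for j
    define w where "w = map letter [0..<m]"
    have lw: "length w = m" "\<And>j. j < m \<Longrightarrow> w ! j = letter j" by (simp_all add: w_def)
    have cont: "continuous_on {t (i - 1)..t i} v"
    proof -
      have "a-lipschitz_on {t (i - 1)..t i} v"
        using curveD(2)[OF ci] a by (auto simp: lipschitz_on_def dist_norm)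
      then show ?thesis by (rule lipschitz_on_continuous_on)
    qed
    have "C1_on (t (i - 1)) (t i) z"
      using le(2) curveD(1)[OF ci] cont by (rule C1_onI(1))
    moreover have "is_piece a (w ! j) (u j) z (s j / a) (s (Suc j) / a)" if "j < m" for j
      unfolding lw(2)[OF that] letter_def
    proof (rule is_piece_of_piece[OF dubins a])
      show "u j \<in> {-1, 0, 1}" using su[OF that] by blast
      show "a * t (i - 1) \<le> a * (s j / a)" using smono[of 0 j] m that a by simp
      show "s j / a < s (Suc j) / a" using su[OF that] a by (simp add: divide_strict_right_mono)
      show "a * (s (Suc j) / a) \<le> a * t i" using smono[of "Suc j" m] m that a by simp
      show "piece (u j) (a * (s j / a)) (a * (s (Suc j) / a))" using su[OF that] a by simp
    qed
    moreover have "u (Suc j) = - u j" if "Suc j < m" "w ! j = Arc" "w ! Suc j = Arc" for j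
    proof -
      have "u j \<noteq> 0" "u (Suc j) \<noteq> 0" using that lw(2)[of j] lw(2)[of "Suc j"] by (auto simp: letter_def split: if_splits)
      moreover have "u j \<in> {-1, 0, 1}" "u (Suc j) \<in> {-1, 0, 1}" using su[of j] su[of "Suc j"] that by auto
      ultimately show ?thesis using alt[OF that(1)] by auto
    qed
    ultimately have "of_type a z (t (i - 1)) (t i) w"
      unfolding of_type_def decomposition_def lw(1) using su m a
      by (intro exI[of _ "\<lambda>j. s j / a"] exI[of _ u]) (auto simp: divide_strict_right_mono)
    moreover have "subseq w [Arc, Seg, Arc] \<or> subseq w [Arc, Arc, Arc]"
    proof -
      consider "m = 1" | "m = 2" | "m = 3" using m by linarith
      then show ?thesis
      proof cases
        case 1
        then show ?thesis by (auto simp: w_def letter_def)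
      next
        case 2
        then show ?thesis using alt[of 0] by (auto simp: w_def letter_def upt_rec)
      next
        case 3
        \<comment> \<open>A straight middle piece has arcs on both sides by \<open>alt\<close>; a
          curved one has arcs of the opposite curvature on both sides by \<open>ccc\<close>.\<close>
        then show ?thesis using alt[of 0] alt[of 1] ccc
          by (auto simp: w_def letter_def upt_rec numeral_2_eq_2)
      qed
    qed
    ultimately show "\<exists>w. (subseq w [Arc, Seg, Arc] \<or> subseq w [Arc, Arc, Arc]) \<and>
           of_type a z (t (i - 1)) (t i) w" by blast
  next
    show "\<forall>s \<sigma>. decomposition a z (t (i - 1)) (t i) [Arc, Arc, Arc] s \<sigma> \<longrightarrow> s 2 - s 1 > pi / a"
    proof (intro allI impI)
      fix s \<sigma> assume dec: "decomposition a z (t (i - 1)) (t i) [Arc, Arc, Arc] s \<sigma>"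
      have ends': "s 0 = t (i - 1)" "s 3 = t i"
        and step: "\<And>j. j < 3 \<Longrightarrow> s j < s (Suc j) \<and> is_piece a ([Arc, Arc, Arc] ! j) (\<sigma> j) z (s j) (s (Suc j))"
        and sgn: "\<And>j. Suc j < 3 \<Longrightarrow> [Arc, Arc, Arc] ! j = Arc \<Longrightarrow> [Arc, Arc, Arc] ! Suc j = Arc \<Longrightarrow> \<sigma> (Suc j) = - \<sigma> j"
        using dec by (auto simp: decomposition_def numeral_3_eq_3)
      have lt: "s 0 < s 1" "s 1 < s 2" "s 2 < s 3"
        and arcs: "circular_arc a (\<sigma> 0) z (s 0) (s 1)" "circular_arc a (\<sigma> 1) z (s 1) (s 2)" "circular_arc a (\<sigma> 2) z (s 2) (s 3)"
        using step[of 0] step[of 1] step[of 2] by (simp_all add: numeral_2_eq_2 numeral_3_eq_3)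
      have \<sigma>: "\<sigma> 1 = - \<sigma> 0" "\<sigma> 2 = - \<sigma> 1"
        using sgn[of 0] sgn[of 1] by (simp_all add: numeral_2_eq_2)
      have \<sigma>1: "\<sigma> 1 = 1 \<or> \<sigma> 1 = -1" using arcs(2) by (simp add: circular_arc_def)
      have pc: "piece \<tau> (a * x) (a * y)" if "circular_arc a \<tau> z x y" "x < y" "t (i - 1) \<le> x" "y \<le> t i" for \<tau> x y
        using curve_subinterval[OF ci that(3) less_imp_le[OF that(2)] that(4)]
        by (intro piece_of_circular_arc[OF dubins a that(1,2)]) (rule curveD(1))
      \<comment> \<open>Opposite signs make the curvatures of the outer arcs differ from that of the
        middle one, which is what \<open>interior_arc\<close> requires; the lengths are measured in
        the time scaled by \<open>a\<close>.\<close>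
      have "pi < a * s 2 - a * s 1"
        by (rule interior_arc(3)[OF pc[OF arcs(1)] pc[OF arcs(2)] pc[OF arcs(3)]])
          (use lt ends' a \<sigma> \<sigma>1 in auto)
      then show "s 2 - s 1 > pi / a" using a by (simp add: field_simps)
    qed
  qed
qed

end
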